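(* Let $f$ be an indefinite and anisotropic integral binary hermitian form over $k$, let $C$ be its ocean, let $\mathbb{H}_f\subset\mathbb{H}^3$ be the totally geodesic hyperbolic plane whose boundary at infinity is the circle $\{[z:w]\in\mathbb{P}^1(\mathbb{C}): f(z,w)=0\}$, and let $\pi:C\to\mathbb{H}_f$ be the nearest point projection. Then $\pi$ is a homeomorphism.
   Context: $D<0$ is a fundamental discriminant, $k=\mathbb{Q}(\sqrt D)\subset\mathbb{C}$, $A=\mathbb{Z}[\frac{D+\sqrt D}{2}]$ its ring of integers. For $z\in\mathbb{C}$, $N(z)=|z|^2$; for a non-zero ideal $I\subseteq A$, $N(I)=|A/I|$. A binary hermitian form over $k$ is $f(x,y)=aN(x)+cN(y)+\nu x\bar y+\bar\nu\bar x y$ ($a,c\in\mathbb{Q}$, $\nu\in k$), extended to $\mathbb{C}^2$ by the same formula; it is integral if $f(A^2)\subseteq\mathbb{Z}$, indefinite if it takes both signs on $k^2$, anisotropic if $f(\mathbf w)\ne0$ for all non-zero $\mathbf w\in k^2$. Cusps are the elements of $\mathbb{P}^1(k)=k\cup\{\infty\}$; writing $\alpha=a/b$ with $a,b\in A$ not both zero ($\infty=1/0$), put $F(\alpha)=f(a,b)/N(aA+bA)$. In the upper half-space model $\mathbb{H}^3=\{(z,\zeta):z\in\mathbb{C},\zeta>0\}$ (boundary $\mathbb{P}^1(\mathbb{C})$), for $\alpha=a/b\in k$ ($b\neq0$) let $d_\alpha(z,\zeta)=\frac{N(b)}{N(aA+bA)}\cdot\frac{|z-\alpha|^2+\zeta^2}{\zeta}$,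 $d_\infty(z,\zeta)=1/\zeta$, and $H_\alpha=\{w: d_\alpha(w)\le d_\beta(w)\ \forall\beta\}$. The spine $X=\bigcup_{\alpha\ne\beta}H_\alpha\cap H_\beta$ has as 2-cells the two-dimensional sets $\sigma_{\alpha,\beta}=H_\alpha\cap H_\beta$ ($\alpha\ne\beta$). The ocean of $f$ is the union $C$ of all 2-cells $\sigma_{\alpha,\beta}$ with $F(\alpha)F(\beta)<0$. *)

theory Defs
  imports "HOL-Analysis.Analysis" "HOL-Computational_Algebra.Squarefree"
begin

section \<open>The imaginary quadratic field and its ring of integers\<close>

definition fundamental_discriminant :: "int \<Rightarrow> bool" where
  "fundamental_discriminant D \<longleftrightarrow> D \<noteq> 1 \<and>
     (D mod 4 = 1 \<and> squarefree D \<or>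
      D mod 4 = 0 \<and> squarefree (D div 4) \<and> (D div 4) mod 4 \<in> {2, 3})"

definition quad_field :: "int \<Rightarrow> complex set" where
  "quad_field D = {of_rat r + of_rat s * csqrt (of_int D) | r s. True}"

definition quad_gen :: "int \<Rightarrow> complex" where
  "quad_gen D = (of_int D + csqrt (of_int D)) / 2"

definition quad_int :: "int \<Rightarrow> complex set" where
  "quad_int D = {of_int m + of_int n * quad_gen D | m n. True}"

definition Nm :: "complex \<Rightarrow> real" where
  "Nm z = (cmod z)\<^sup>2"

definition ideal_gen2 :: "int \<Rightarrow> complex \<Rightarrow> complex \<Rightarrow> complex set" where
  "ideal_gen2 D a b = {a * x + b * y | x y. x \<in> quad_int D \<and> y \<in> quad_int D}"

definition ideal_norm :: "int \<Rightarrow> complex set \<Rightarrow> nat" where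
  "ideal_norm D I =
     card (quad_int D // {(x, y). x \<in> quad_int D \<and> y \<in> quad_int D \<and> x - y \<in> I})"


section \<open>Binary hermitian forms\<close>

text \<open>The argument of \<^const>\<open>Re\<close> is a real number, so \<^const>\<open>Re\<close> merely changes the type.\<close>

definition herm_form :: "rat \<Rightarrow> rat \<Rightarrow> complex \<Rightarrow> complex \<Rightarrow> complex \<Rightarrow> real" where
  "herm_form a c \<nu> x y =
     of_rat a * Nm x + of_rat c * Nm y + Re (\<nu> * x * cnj y + cnj \<nu> * cnj x * y)"

lemma of_real_herm_form:
  "complex_of_real (herm_form a c \<nu> x y) =
     of_rat a * of_real (Nm x) + of_rat c * of_real (Nm y) + \<nu> * x * cnj y + cnj \<nu> * cnj x * y"
proof -
  have "Im (\<nu> * x * cnj y + cnj \<nu> * cnj x * y) = 0"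
    by (simp add: algebra_simps)
  then have "complex_of_real (Re (\<nu> * x * cnj y + cnj \<nu> * cnj x * y)) =
      \<nu> * x * cnj y + cnj \<nu> * cnj x * y"
    by (simp only: complex_eq_iff) simp
  moreover have "complex_of_real (of_rat r) = of_rat r" for r
    by (cases r) (simp add: of_rat_rat)
  ultimately show ?thesis
    unfolding herm_form_def by (simp only: of_real_add of_real_mult add.assoc)
qed

definition binary_hermitian_form :: "int \<Rightarrow> (complex \<Rightarrow> complex \<Rightarrow> real) \<Rightarrow> bool" where
  "binary_hermitian_form D f \<longleftrightarrow> (\<exists>a c. \<exists>\<nu>\<in>quad_field D. f = herm_form a c \<nu>)"

definition integral_form :: "int \<Rightarrow> (complex \<Rightarrow> complex \<Rightarrow> real) \<Rightarrow> bool" where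
  "integral_form D f \<longleftrightarrow> (\<forall>x\<in>quad_int D. \<forall>y\<in>quad_int D. f x y \<in> \<int>)"

definition indefinite_form :: "int \<Rightarrow> (complex \<Rightarrow> complex \<Rightarrow> real) \<Rightarrow> bool" where
  "indefinite_form D f \<longleftrightarrow>
     (\<exists>x\<in>quad_field D. \<exists>y\<in>quad_field D. f x y > 0) \<and>
     (\<exists>x\<in>quad_field D. \<exists>y\<in>quad_field D. f x y < 0)"

definition anisotropic_form :: "int \<Rightarrow> (complex \<Rightarrow> complex \<Rightarrow> real) \<Rightarrow> bool" where
  "anisotropic_form D f \<longleftrightarrow>
     (\<forall>x\<in>quad_field D. \<forall>y\<in>quad_field D. (x, y) \<noteq> (0, 0) \<longrightarrow> f x y \<noteq> 0)"


section \<open>Projective line and cusps\<close>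

text \<open>\<open>Fin z\<close> is $[z:1]$ and \<open>Infty\<close> is $[1:0]$.\<close>

datatype proj_point = Fin complex | Infty

definition proj_pt :: "complex \<Rightarrow> complex \<Rightarrow> proj_point" where
  "proj_pt z w = (if w = 0 then Infty else Fin (z / w))"

definition cusps :: "int \<Rightarrow> proj_point set" where
  "cusps D = insert Infty (Fin ` quad_field D)"

text \<open>A choice of a fraction $a/b$ representing a cusp; the quantities below do not depend on it.\<close>

definition cusp_rep :: "int \<Rightarrow> proj_point \<Rightarrow> complex \<times> complex" where
  "cusp_rep D \<alpha> = (SOME (a, b). a \<in> quad_int D \<and> b \<in> quad_int D \<and>
                      (a, b) \<noteq> (0, 0) \<and> proj_pt a b = \<alpha>)"

definition cusp_value :: "int \<Rightarrow> (complex \<Rightarrow> complex \<Rightarrow> real) \<Rightarrow> proj_point \<Rightarrow> real" where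
  "cusp_value D f \<alpha> = (case cusp_rep D \<alpha> of (a, b) \<Rightarrow>
     f a b / real (ideal_norm D (ideal_gen2 D a b)))"


section \<open>Hyperbolic 3-space\<close>

definition H3 :: "(complex \<times> real) set" where
  "H3 = {(z, \<zeta>). \<zeta> > 0}"

text \<open>Here \<^const>\<open>dist\<close> is the Euclidean distance of \<^typ>\<open>complex \<times> real\<close>.\<close>

definition hyp_dist :: "complex \<times> real \<Rightarrow> complex \<times> real \<Rightarrow> real" where
  "hyp_dist p q = arcosh (1 + (dist p q)\<^sup>2 / (2 * snd p * snd q))"

definition geodesic_line :: "(real \<Rightarrow> complex \<times> real) \<Rightarrow> bool" where
  "geodesic_line \<gamma> \<longleftrightarrow> range \<gamma> \<subseteq> H3 \<and> (\<forall>s t. hyp_dist (\<gamma> s) (\<gamma> t) = \<bar>s - t\<bar>)"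

definition totally_geodesic :: "(complex \<times> real) set \<Rightarrow> bool" where
  "totally_geodesic P \<longleftrightarrow> P \<subseteq> H3 \<and>
     (\<forall>\<gamma> s t. geodesic_line \<gamma> \<and> s \<noteq> t \<and> \<gamma> s \<in> P \<and> \<gamma> t \<in> P \<longrightarrow> range \<gamma> \<subseteq> P)"

text \<open>
  Dimension two, for subsets of the 3-dimensional space \<^typ>\<open>complex \<times> real\<close>: the set contains
  a topological 2-disc but no topological 3-ball. It is only applied to hyperbolically convex sets,
  where this is the usual dimension.
\<close>

definition two_dimensional :: "(complex \<times> real) set \<Rightarrow> bool" where
  "two_dimensional S \<longleftrightarrow>
     (\<exists>T\<subseteq>S. T homeomorphic ball (0 :: complex) 1) \<and>
     \<not> (\<exists>T\<subseteq>S. T homeomorphic ball (0 :: complex \<times> real) 1)"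

text \<open>
  The limit points of a subset of \<^const>\<open>H3\<close> on the boundary sphere of the compactification of
  \<^const>\<open>H3\<close>; a sequence accumulates at \<^const>\<open>Infty\<close> iff it is unbounded for the Euclidean distance.
\<close>

definition ideal_boundary :: "(complex \<times> real) set \<Rightarrow> proj_point set" where
  "ideal_boundary P = {Fin z | z. (z, 0) \<in> closure P} \<union> {\<xi>. \<xi> = Infty \<and> \<not> bounded P}"

definition form_circle :: "(complex \<Rightarrow> complex \<Rightarrow> real) \<Rightarrow> proj_point set" where
  "form_circle f = {proj_pt z w | z w. (z, w) \<noteq> (0, 0) \<and> f z w = 0}"

definition form_plane :: "(complex \<Rightarrow> complex \<Rightarrow> real) \<Rightarrow> (complex \<times> real) set" where
  "form_plane f = (THE P. totally_geodesic P \<and> two_dimensional P \<and>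
                          ideal_boundary P = form_circle f)"

definition nearest_point :: "(complex \<times> real) set \<Rightarrow> complex \<times> real \<Rightarrow> complex \<times> real" where
  "nearest_point P w = arg_min_on (hyp_dist w) P"


section \<open>The spine and the ocean\<close>

definition cusp_dist :: "int \<Rightarrow> proj_point \<Rightarrow> complex \<times> real \<Rightarrow> real" where
  "cusp_dist D \<alpha> w = (case w of (z, \<zeta>) \<Rightarrow> (case \<alpha> of
       Infty \<Rightarrow> 1 / \<zeta>
     | Fin x \<Rightarrow> (case cusp_rep D \<alpha> of (a, b) \<Rightarrow>
         Nm b / real (ideal_norm D (ideal_gen2 D a b)) * (((cmod (z - x))\<^sup>2 + \<zeta>\<^sup>2) / \<zeta>))))"

definition horo_cell :: "int \<Rightarrow> proj_point \<Rightarrow> (complex \<times> real) set" where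
  "horo_cell D \<alpha> = {w \<in> H3. \<forall>\<beta>\<in>cusps D. cusp_dist D \<alpha> w \<le> cusp_dist D \<beta> w}"

definition spine_cell :: "int \<Rightarrow> proj_point \<Rightarrow> proj_point \<Rightarrow> (complex \<times> real) set" where
  "spine_cell D \<alpha> \<beta> = horo_cell D \<alpha> \<inter> horo_cell D \<beta>"

definition ocean :: "int \<Rightarrow> (complex \<Rightarrow> complex \<Rightarrow> real) \<Rightarrow> (complex \<times> real) set" where
  "ocean D f = \<Union> {spine_cell D \<alpha> \<beta> | \<alpha> \<beta>. \<alpha> \<in> cusps D \<and> \<beta> \<in> cusps D \<and> \<alpha> \<noteq> \<beta> \<and>
                  two_dimensional (spine_cell D \<alpha> \<beta>) \<and>
                  cusp_value D f \<alpha> * cusp_value D f \<beta> < 0}"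

end

theory Submission
  imports Defs
begin

text \<open>
  As \<open>f\<close> is anisotropic, its circle is a Euclidean circle $|z - c| = r$ in \<open>\<complex>\<close>. There is a Klein
  model of hyperbolic space (the unit ball of \<^typ>\<open>complex \<times> real\<close>, with chords as geodesics) in
  which the plane of \<open>f\<close> is the equatorial disc and the nearest point projection is the vertical
  one. After multiplication by a factor that does not depend on the cusp, every \<open>d\<^sub>\<alpha>\<close> becomes an affine
  function \<open>W\<^sub>\<alpha> + B\<^sub>\<alpha> \<bullet> p\<close> on the ball, and its vertical slope \<open>snd B\<^sub>\<alpha>\<close> has the sign of
  \<open>F(\<alpha>)\<close>, up to a sign common to all cusps. Along a vertical line the cusps of one sign are thus
  the nearest ones below, and those of the other sign above, exactly one point; these points form
  the graph of a continuous function. By local finiteness and a Baire argument every point of the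
  graph lies in a two-dimensional cell, so the graph is the ocean.

  The arithmetic input is that the minimum over the cusps of \<open>d\<^sub>\<alpha>\<close> is bounded on \<^const>\<open>H3\<close>, and
  that \<open>|F(\<alpha>)|\<close> is bounded below. Both follow from pigeonhole arguments with crude constants, which
  avoid the multiplicativity of the ideal norm.
\<close>

section \<open>Affine functions on the ball\<close>

text \<open>Hermitian forms are the vectors of a four-dimensional Lorentz space: points of
  \<open>H3\<close> are timelike, cusps lightlike, and \<open>f\<close> is spacelike.
  \<open>cusp_dist\<close> pairs a point with a lightlike vector, hence is linear before
  normalisation and affine on the projective (Klein) ball. The coordinates put the vector of
  \<open>f\<close> on the vertical axis, so that pairing with it reads off a last coordinate; this
  is why the vertical slope knows the sign of the cusp value. Two obstacles shape the proof. A
  vertical line might stay in the territory of one sign all the way to the sphere; this is excluded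
  because the minimum of the affine functions tends to 0 there like
  \<open>sqrt (1 - (norm p)\<^sup>2)\<close>, whereas the slopes stay away from 0. And a sign change
  alone does not put a point into a cell of dimension two, which the ocean demands; hence the Baire
  argument. Since the plane, the nearest points and the fractions are given by \<open>THE\<close>,
  \<open>arg_min_on\<close> and \<open>SOME\<close>, uniqueness has to be proved for the first two,
  and ideal norms have to be estimated for an arbitrary fraction.\<close>

lemma pair_in_ball: "r \<ge> 0 \<Longrightarrow> (y, t) \<in> ball (0 :: complex \<times> real) r \<longleftrightarrow> (norm y)\<^sup>2 + t\<^sup>2 < r\<^sup>2"
  using real_sqrt_less_iff[of "(norm y)\<^sup>2 + t\<^sup>2" "r\<^sup>2"] by (simp add: norm_Pair)

lemma pair_in_cball: "r \<ge> 0 \<Longrightarrow> (y, t) \<in> cball (0 :: complex \<times> real) r \<longleftrightarrow> (norm y)\<^sup>2 + t\<^sup>2 \<le> r\<^sup>2"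
  using real_sqrt_le_iff[of "(norm y)\<^sup>2 + t\<^sup>2" "r\<^sup>2"] by (simp add: norm_Pair)

text \<open>As \<open>s\<close> tends to 1 from the left, the left side tends to 0 and the right
  side to \<open>2 * c\<close>. \<open>exists_level\<close> uses this to go so far towards the
  sphere that the upper bound for the minimum drops below what a slope of size \<open>c\<close>
  accumulates on the way.\<close>

lemma near_boundary:
  fixes c C :: real
  assumes "c > 0" shows "\<exists>s. 0 < s \<and> s < 1 \<and> C * sqrt (1 - s\<^sup>2) < 2 * c * s"
proof -
  have "((\<lambda>s. 2 * c * s - C * sqrt (1 - s\<^sup>2)) \<longlongrightarrow> 2 * c * 1 - C * sqrt (1 - 1\<^sup>2)) (at_left 1)"
    by (intro tendsto_intros)
  then have "((\<lambda>s. 2 * c * s - C * sqrt (1 - s\<^sup>2)) \<longlongrightarrow> 2 * c) (at_left 1)" by simp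
  then have "\<forall>\<^sub>F s in at_left 1. 0 < 2 * c * s - C * sqrt (1 - s\<^sup>2)"
    using assms by (intro order_tendstoD(1)[of _ "2 * c"]) auto
  moreover have "\<forall>\<^sub>F s in at_left (1 :: real). 0 < s \<and> s < 1"
    using eventually_at_left_real[of 0 "1 :: real"] by (auto elim: eventually_mono)
  ultimately have "\<forall>\<^sub>F s in at_left (1 :: real). 0 < s \<and> s < 1 \<and> C * sqrt (1 - s\<^sup>2) < 2 * c * s"
    by eventually_elim auto
  then show ?thesis
    using eventually_happens'[OF trivial_limit_at_left_real[of "1 :: real"]] by blast
qed

lemma ball_pair_shift:
  assumes "(y, t) \<in> ball (0 :: complex \<times> real) 1"
  shows "\<exists>d>0. \<forall>s. \<bar>s\<bar> < d \<longrightarrow> (y, t + s) \<in> ball 0 1"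
proof -
  obtain d where "d > 0" "ball (y, t) d \<subseteq> ball 0 1" using assms by (meson open_ball openE)
  then show ?thesis
    by (intro exI[of _ d]) (auto simp: dist_Pair_Pair dist_real_def subset_iff)
qed

lemma eventually_pair_ball:
  fixes a :: real
  assumes "e > 0" shows "\<forall>\<^sub>F y in at y0. (y, a) \<in> ball (y0 :: complex, a) e"
  unfolding eventually_at
  by (rule exI[of _ e]) (use assms in \<open>auto simp: dist_Pair_Pair dist_commute\<close>)

lemma eventually_norm_less_1:
  assumes "norm (y0 :: complex) < 1" shows "\<forall>\<^sub>F y in at y0. norm y < 1"
proof -
  have "((\<lambda>y. norm y) \<longlongrightarrow> norm y0) (at y0)" by (intro tendsto_intros)
  then show ?thesis using assms by (rule order_tendstoD(2))
qed

text \<open>\<open>norm_B_le\<close> makes every function nonnegative on the ball;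
  \<open>finite_W_le\<close> is the discreteness of the cusps; \<open>near\<close> says that the
  least cusp distance is bounded, the square root being the common factor; \<open>gap\<close> comes
  from non-zero integers having absolute value at least 1.\<close>

locale cusp_functions =
  fixes I :: "'i set" and W :: "'i \<Rightarrow> real" and B :: "'i \<Rightarrow> complex \<times> real"
  assumes norm_B_le: "i \<in> I \<Longrightarrow> norm (B i) \<le> W i"
    and finite_W_le: "finite {i \<in> I. W i \<le> R}"
    and near: "\<exists>C. \<forall>p\<in>ball 0 1. \<exists>i\<in>I. W i + B i \<bullet> p \<le> C * sqrt (1 - (norm p)\<^sup>2)"
    and gap: "\<exists>c>0. \<forall>i\<in>I. c \<le> \<bar>snd (B i)\<bar>"
begin

section \<open>Cells of a locally finite family\<close>

definition m :: "'i \<Rightarrow> complex \<times> real \<Rightarrow> real" where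
  "m i p = W i + B i \<bullet> p"

text \<open>Not cut down to the ball, so that it is closed in the whole space; \<open>cell\<close>
  is closed only relative to the ball.\<close>

definition dominated :: "'i \<Rightarrow> (complex \<times> real) set" where
  "dominated i = (\<Inter>j\<in>I. {p. m i p \<le> m j p})"

definition cell :: "'i \<Rightarrow> (complex \<times> real) set" where
  "cell i = ball 0 1 \<inter> dominated i"

definition positive :: "'i set" where "positive = {i \<in> I. snd (B i) > 0}"

definition negative :: "'i set" where "negative = {i \<in> I. snd (B i) < 0}"

definition Pos :: "(complex \<times> real) set" where "Pos = (\<Union>i\<in>positive. cell i)"

definition Neg :: "(complex \<times> real) set" where "Neg = (\<Union>i\<in>negative. cell i)"

lemma continuous_m: "continuous_on UNIV (m i)"
  unfolding m_def by (intro continuous_intros)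

lemma closed_dominated: "closed (dominated i)"
  unfolding dominated_def
  by (intro closed_INT ballI closed_Collect_le continuous_on_subset[OF continuous_m]) auto

lemma m_pair: "m i (y, t) = m i (y, 0) + snd (B i) * t"
  by (cases "B i") (simp add: m_def inner_Pair)

text \<open>Away from the sphere a bound on \<open>m i\<close> thus bounds \<open>W i\<close>, which
  turns \<open>finite_W_le\<close> into local finiteness.\<close>

lemma m_lower:
  assumes "i \<in> I" shows "(1 - norm p) * W i \<le> m i p"
proof -
  have "- (B i \<bullet> p) \<le> norm (B i) * norm p"
    using Cauchy_Schwarz_ineq2[of "B i" p] by linarith
  also have "\<dots> \<le> W i * norm p"
    using norm_B_le[OF assms] by (intro mult_right_mono) auto
  finally show ?thesis by (simp add: m_def algebra_simps)
qed

lemma W_nonneg: "i \<in> I \<Longrightarrow> 0 \<le> W i"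
  using norm_B_le[of i] norm_ge_zero[of "B i"] by linarith

lemma m_nonneg: "i \<in> I \<Longrightarrow> p \<in> ball 0 1 \<Longrightarrow> 0 \<le> m i p"
  using m_lower[of i p] W_nonneg[of i] mult_nonneg_nonneg[of "1 - norm p" "W i"]
  by (meson W_nonneg diff_ge_0_iff_ge less_imp_le mem_ball_0 order_trans)

lemma finite_m_le:
  assumes "\<rho> < 1" shows "finite {i \<in> I. \<exists>p\<in>cball 0 \<rho>. m i p \<le> C}"
proof (rule finite_subset[OF _ finite_W_le[of "C / (1 - \<rho>)"]], safe)
  fix i a b assume i: "i \<in> I" and p: "(a, b) \<in> cball 0 \<rho>" and le: "m i (a, b) \<le> C"
  have "(1 - \<rho>) * W i \<le> (1 - norm (a, b)) * W i"
    using p W_nonneg[OF i] by (intro mult_right_mono) auto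
  with m_lower[OF i, of "(a, b)"] le show "W i \<le> C / (1 - \<rho>)"
    using assms by (simp add: field_simps)
qed

lemma m_bounded_on_cells:
  obtains C where "\<And>p. p \<in> ball 0 1 \<Longrightarrow> \<exists>i\<in>I. m i p \<le> C"
    and "\<And>i p. p \<in> cell i \<Longrightarrow> m i p \<le> C"
proof -
  obtain C where C: "\<forall>p\<in>ball 0 1. \<exists>i\<in>I. W i + B i \<bullet> p \<le> C * sqrt (1 - (norm p)\<^sup>2)"
    using near by blast
  have 1: "\<exists>i\<in>I. m i p \<le> \<bar>C\<bar>" if "p \<in> ball 0 1" for p
  proof -
    from C that obtain i where i: "i \<in> I" "m i p \<le> C * sqrt (1 - (norm p)\<^sup>2)"
      unfolding m_def by blast
    have "(norm p)\<^sup>2 \<le> 1" using that by (simp add: power_le_one)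
    then have "0 \<le> sqrt (1 - (norm p)\<^sup>2)" "sqrt (1 - (norm p)\<^sup>2) \<le> 1" by auto
    then have "C * sqrt (1 - (norm p)\<^sup>2) \<le> \<bar>C\<bar> * 1"
      by (intro mult_mono) auto
    with i show ?thesis by force
  qed
  have 2: "m i p \<le> \<bar>C\<bar>" if p: "p \<in> cell i" for i p
  proof -
    from p have "p \<in> ball 0 1" by (simp add: cell_def)
    from 1[OF this] obtain j where "j \<in> I" "m j p \<le> \<bar>C\<bar>" by blast
    moreover from p \<open>j \<in> I\<close> have "m i p \<le> m j p" by (auto simp: cell_def dominated_def)
    ultimately show ?thesis by linarith
  qed
  from 1 2 show thesis by (rule that)
qed

text \<open>A function is bounded on its own cell by a constant independent of the index, so
  \<open>finite_m_le\<close> applies.\<close>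

lemma finite_active:
  assumes "\<rho> < 1" shows "finite {i \<in> I. cell i \<inter> cball 0 \<rho> \<noteq> {}}"
proof -
  obtain C where "\<And>i p. p \<in> cell i \<Longrightarrow> m i p \<le> C"
    by (rule m_bounded_on_cells) blast
  then show ?thesis
    by (intro finite_subset[OF _ finite_m_le[OF assms, of C]]) blast
qed

text \<open>Only finitely many indices have a value below the constant at \<open>p\<close>, so the
  minimum over a possibly infinite family is attained among them.\<close>

lemma exists_cell:
  assumes "p \<in> ball 0 1" obtains i where "i \<in> I" "p \<in> cell i"
proof -
  obtain C where "\<exists>i\<in>I. m i p \<le> C"
    using assms by (rule_tac m_bounded_on_cells) blast
  then obtain i0 where i0: "i0 \<in> I" "m i0 p \<le> C" by blast
  define J where "J = {i \<in> I. m i p \<le> C}"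
  have "finite J"
    by (rule finite_subset[OF _ finite_m_le[of "norm p" C]]) (use assms in \<open>auto simp: J_def\<close>)
  moreover have "J \<noteq> {}" using i0 by (auto simp: J_def)
  ultimately have k: "arg_min_on (\<lambda>i. m i p) J \<in> J"
      "\<And>j. j \<in> J \<Longrightarrow> m (arg_min_on (\<lambda>i. m i p) J) p \<le> m j p"
    by (rule arg_min_if_finite(1), rule arg_min_least)
  define i where "i = arg_min_on (\<lambda>i. m i p) J"
  have "i \<in> I" "m i p \<le> C" "\<And>j. j \<in> I \<Longrightarrow> m j p \<le> C \<Longrightarrow> m i p \<le> m j p"
    using k unfolding i_def[symmetric] by (auto simp: J_def)
  then have "m i p \<le> m j p" if "j \<in> I" for j
    using that by (cases "m j p \<le> C") auto
  with \<open>i \<in> I\<close> assms show thesis by (intro that) (auto simp: cell_def dominated_def)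
qed

section \<open>The territories of the two signs\<close>

lemma cover: "p \<in> ball 0 1 \<Longrightarrow> p \<in> Pos \<or> p \<in> Neg"
proof -
  assume "p \<in> ball 0 1"
  then obtain i where i: "i \<in> I" "p \<in> cell i" by (rule exists_cell)
  moreover from gap i(1) have "snd (B i) \<noteq> 0" by force
  ultimately show ?thesis by (auto simp: Pos_def Neg_def positive_def negative_def neq_iff)
qed

text \<open>Only finitely many of the cells meet \<open>cball 0 \<rho>\<close>, and inside it they
  may be replaced by the closed sets \<open>dominated i\<close>.\<close>

lemma closed_cells_cball:
  assumes "J \<subseteq> I" "\<rho> < 1"
  shows "closed (cball 0 \<rho> \<inter> (\<Union>i\<in>J. cell i))"
proof -
  have "cball 0 \<rho> \<inter> (\<Union>i\<in>J. cell i) =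
      cball 0 \<rho> \<inter> (\<Union>i \<in> {i \<in> J. cell i \<inter> cball 0 \<rho> \<noteq> {}}. dominated i)"
    using assms(2) by (auto simp: cell_def)
  moreover have "finite {i \<in> J. cell i \<inter> cball 0 \<rho> \<noteq> {}}"
    by (rule finite_subset[OF _ finite_active[OF assms(2)]]) (use assms(1) in auto)
  ultimately show ?thesis
    by (auto intro!: closed_Int closed_UN closed_dominated)
qed

lemma not_in_cells_open:
  assumes "J \<subseteq> I" "p \<in> ball 0 1" "p \<notin> (\<Union>i\<in>J. cell i)"
  shows "\<exists>e>0. ball p e \<subseteq> ball 0 1 \<and> ball p e \<inter> (\<Union>i\<in>J. cell i) = {}"
proof -
  define \<rho> where "\<rho> = (norm p + 1) / 2"
  have \<rho>: "norm p < \<rho>" "\<rho> < 1" using assms(2) by (auto simp: \<rho>_def)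
  define U where "U = ball 0 \<rho> - cball 0 \<rho> \<inter> (\<Union>i\<in>J. cell i)"
  have "open U"
    unfolding U_def by (intro open_Diff closed_cells_cball assms \<rho> open_ball)
  moreover have "p \<in> U" using \<rho> assms(3) by (auto simp: U_def)
  ultimately obtain e where "e > 0" "ball p e \<subseteq> U" by (meson openE)
  moreover have "U \<subseteq> ball 0 1" using \<rho> by (auto simp: U_def)
  moreover have "U \<inter> (\<Union>i\<in>J. cell i) = {}" by (auto simp: U_def)
  ultimately have "e > 0 \<and> ball p e \<subseteq> ball 0 1 \<and> ball p e \<inter> (\<Union>i\<in>J. cell i) = {}"
    by blast
  then show ?thesis ..
qed

text \<open>On the way up from \<open>s\<close> to \<open>t\<close> the function minimal at
  \<open>t\<close> would increase and the one minimal at \<open>s\<close> would decrease, which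
  contradicts the two minimalities.\<close>

lemma Pos_below_Neg:
  assumes "(y, s) \<in> Neg" "(y, t) \<in> Pos" shows "t \<le> s"
proof (rule ccontr)
  assume "\<not> t \<le> s"
  then have st: "s < t" by simp
  from assms obtain i j where i: "i \<in> I" "snd (B i) > 0" "(y, t) \<in> dominated i"
    and j: "j \<in> I" "snd (B j) < 0" "(y, s) \<in> dominated j"
    by (auto simp: Pos_def Neg_def positive_def negative_def cell_def)
  have "m j (y, s) \<le> m i (y, s)" using i j by (auto simp: dominated_def)
  also have "\<dots> < m i (y, t)" using i st by (simp add: m_pair[of i y s] m_pair[of i y t])
  also have "\<dots> \<le> m j (y, t)" using i j by (auto simp: dominated_def)
  also have "\<dots> < m j (y, s)" using j st by (simp add: m_pair[of j y s] m_pair[of j y t])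
  finally show False .
qed

text \<open>A long enough vertical segment over \<open>y\<close> starts in \<open>Pos\<close> and
  ends in \<open>Neg\<close>. Both sets are closed along it and cover it, so by connectedness they
  meet.\<close>

lemma exists_level:
  assumes "norm y < 1" shows "\<exists>t. (y, t) \<in> Pos \<inter> Neg"
proof -
  define h where "h = sqrt (1 - (norm y)\<^sup>2)"
  have y2: "(norm y)\<^sup>2 < 1" using assms by (simp add: power_less_one_iff)
  then have h: "h > 0" "h\<^sup>2 = 1 - (norm y)\<^sup>2" by (auto simp: h_def)
  obtain C where C: "\<forall>p\<in>ball 0 1. \<exists>i\<in>I. m i p \<le> C * sqrt (1 - (norm p)\<^sup>2)"
    using near unfolding m_def by blast
  obtain c where c: "c > 0" "\<forall>i\<in>I. c \<le> \<bar>snd (B i)\<bar>" using gap by blast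
  obtain s where s: "0 < s" "s < 1" "C * sqrt (1 - s\<^sup>2) < 2 * c * s"
    using near_boundary[OF c(1)] by blast
  \<comment> \<open>\<open>h\<close> is half the length of the vertical chord over \<open>y\<close>;
    scaling \<open>s\<close> by it transports \<open>near_boundary\<close> to this chord.\<close>
  define \<tau> where "\<tau> = h * s"
  have \<tau>: "0 < \<tau>" using h s by (simp add: \<tau>_def)
  have s2: "s\<^sup>2 < 1" using s by (simp add: power_less_one_iff)
  then have \<tau>2: "\<tau>\<^sup>2 < h\<^sup>2" using h(1) by (simp add: \<tau>_def power_mult_distrib)
  have bound: "C * sqrt (h\<^sup>2 - \<tau>\<^sup>2) < 2 * c * \<tau>"
  proof -
    have "h\<^sup>2 - \<tau>\<^sup>2 = h\<^sup>2 * (1 - s\<^sup>2)" by (simp add: \<tau>_def power_mult_distrib algebra_simps)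
    then have "sqrt (h\<^sup>2 - \<tau>\<^sup>2) = h * sqrt (1 - s\<^sup>2)" using h(1) by (simp add: real_sqrt_mult)
    with s h show ?thesis by (simp add: \<tau>_def)
  qed
  have in_ball: "(y, t) \<in> ball 0 1" if "\<bar>t\<bar> \<le> \<tau>" for t
  proof -
    have "t\<^sup>2 \<le> \<tau>\<^sup>2" using that power_mono[of "\<bar>t\<bar>" \<tau> 2] by simp
    then show ?thesis using \<tau>2 h pair_in_ball[of 1 y t] by simp
  qed
  \<comment> \<open>A function minimal at one end of the segment must decrease towards that end.
    Otherwise its value at the opposite end is smaller by at least \<open>2 * c * \<tau>\<close>,
    hence negative by \<open>bound\<close>, against \<open>m_nonneg\<close>.\<close>
  have key: "snd (B i) * t < 0" if t: "\<bar>t\<bar> = \<tau>" and i: "i \<in> I" "(y, t) \<in> cell i" for i t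
  proof (rule ccontr)
    assume "\<not> snd (B i) * t < 0"
    then have "snd (B i) * t = \<bar>snd (B i)\<bar> * \<tau>" by (simp add: abs_mult[symmetric] flip: t)
    then have ge: "c * \<tau> \<le> snd (B i) * t" using c i \<tau> by simp
    from C in_ball[of t] t obtain j where j: "j \<in> I" "m j (y, t) \<le> C * sqrt (1 - (norm (y, t))\<^sup>2)"
      by force
    have "1 - (norm (y, t))\<^sup>2 = h\<^sup>2 - \<tau>\<^sup>2"
      using t h by (simp add: norm_Pair flip: t)
    with j have "m j (y, t) \<le> C * sqrt (h\<^sup>2 - \<tau>\<^sup>2)" by simp
    moreover have "m i (y, t) \<le> m j (y, t)" using i j by (auto simp: cell_def dominated_def)
    moreover have "0 \<le> m i (y, - t)" using in_ball[of "- t"] t i by (intro m_nonneg) auto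
    moreover have "m i (y, t) = m i (y, - t) + 2 * (snd (B i) * t)"
      by (simp add: m_pair[of i y t] m_pair[of i y "- t"])
    ultimately show False using bound ge by linarith
  qed
  have neg: "(y, \<tau>) \<in> Neg"
  proof -
    obtain i where i: "i \<in> I" "(y, \<tau>) \<in> cell i" using exists_cell[OF in_ball[of \<tau>]] \<tau> by auto
    with key[of \<tau> i] \<tau> show ?thesis
      by (auto simp: Neg_def negative_def mult_less_0_iff)
  qed
  have pos: "(y, - \<tau>) \<in> Pos"
  proof -
    obtain i where i: "i \<in> I" "(y, - \<tau>) \<in> cell i" using exists_cell[OF in_ball[of "- \<tau>"]] \<tau> by auto
    with key[of "- \<tau>" i] \<tau> show ?thesis
      by (auto simp: Pos_def positive_def zero_less_mult_iff)
  qed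
  \<comment> \<open>Radius of the smallest ball around 0 that contains the segment; closedness is
    available only in closed balls of radius below 1.\<close>
  define \<rho> where "\<rho> = sqrt ((norm y)\<^sup>2 + \<tau>\<^sup>2)"
  have \<rho>: "\<rho> < 1" "0 \<le> \<rho>" "\<rho>\<^sup>2 = (norm y)\<^sup>2 + \<tau>\<^sup>2"
    using \<tau>2 h by (auto simp: \<rho>_def)
  have cb: "(y, t) \<in> cball 0 \<rho>" if "t \<in> {- \<tau>..\<tau>}" for t
    using that \<rho> power_mono[of "\<bar>t\<bar>" \<tau> 2] pair_in_cball[of \<rho> y t] by (simp add: abs_le_iff)
  define P where "P = Pair y -` (cball 0 \<rho> \<inter> Pos)"
  define N where "N = Pair y -` (cball 0 \<rho> \<inter> Neg)"
  have sub: "positive \<subseteq> I" "negative \<subseteq> I" by (auto simp: positive_def negative_def)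
  have "closed P" "closed N"
    unfolding P_def N_def Pos_def Neg_def
    by (rule continuous_closed_vimage, (rule closed_cells_cball sub \<rho>)+, intro continuous_intros)+
  moreover have "connected {- \<tau>..\<tau>}" by simp
  moreover have "{- \<tau>..\<tau>} \<subseteq> P \<union> N"
  proof
    fix t assume t: "t \<in> {- \<tau>..\<tau>}"
    then have "(y, t) \<in> ball 0 1" by (intro in_ball) auto
    from cover[OF this] cb[OF t] show "t \<in> P \<union> N" by (auto simp: P_def N_def)
  qed
  moreover have "\<tau> \<in> N \<inter> {- \<tau>..\<tau>}" "- \<tau> \<in> P \<inter> {- \<tau>..\<tau>}"
    using neg pos \<tau> cb by (auto simp: P_def N_def)
  ultimately have "P \<inter> N \<inter> {- \<tau>..\<tau>} \<noteq> {}"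
    using connected_closedD[of "{- \<tau>..\<tau>}" P N] by blast
  then show ?thesis by (auto simp: P_def N_def)
qed

section \<open>The graph over the equatorial disc\<close>

definition level :: "complex \<Rightarrow> real" where
  "level y = (THE t. (y, t) \<in> Pos \<inter> Neg)"

lemma level_unique: "(y, t) \<in> Pos \<inter> Neg \<Longrightarrow> level y = t"
  unfolding level_def by (rule the_equality) (auto intro!: antisym dest: Pos_below_Neg)

lemma level_in: "norm y < 1 \<Longrightarrow> (y, level y) \<in> Pos \<inter> Neg"
  using exists_level level_unique by metis

lemma Pos_subset_ball: "Pos \<subseteq> ball 0 1" and Neg_subset_ball: "Neg \<subseteq> ball 0 1"
  by (auto simp: Pos_def Neg_def cell_def)

text \<open>A point slightly below the graph is not in \<open>Neg\<close>, so it has a neighbourhood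
  free of \<open>Neg\<close>. This lies in \<open>Pos\<close> and keeps the nearby levels above it;
  symmetrically from the other side.\<close>

lemma continuous_level: "continuous_on (ball 0 1) level"
proof (rule continuous_at_imp_continuous_on, safe)
  fix y0 :: complex assume "y0 \<in> ball 0 1"
  then have y0: "norm y0 < 1" by simp
  note L = level_in[OF y0]
  then have Lb: "(y0, level y0) \<in> ball 0 1" using Pos_subset_ball by blast
  obtain d where d: "d > 0" "\<And>s. \<bar>s\<bar> < d \<Longrightarrow> (y0, level y0 + s) \<in> ball 0 1"
    using ball_pair_shift[OF Lb] by blast
  have sub: "positive \<subseteq> I" "negative \<subseteq> I" by (auto simp: positive_def negative_def)
  have "(level \<longlongrightarrow> level y0) (at y0)"
  proof (rule order_tendstoI)
    fix a assume a: "a < level y0"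
    \<comment> \<open>Raising \<open>a\<close> close to the level keeps \<open>(y0, a')\<close>
      inside the ball.\<close>
    define a' where "a' = max a (level y0 - d / 2)"
    have a': "a \<le> a'" "a' < level y0" using a d by (auto simp: a'_def)
    have "(y0, a') \<in> ball 0 1"
      using d(2)[of "a' - level y0"] a' d(1) by (auto simp: a'_def)
    moreover have "(y0, a') \<notin> Neg" using Pos_below_Neg[of y0 a' "level y0"] L a' by auto
    ultimately obtain e where e: "e > 0" "ball (y0, a') e \<subseteq> ball 0 1" "ball (y0, a') e \<inter> Neg = {}"
      using not_in_cells_open[OF sub(2), of "(y0, a')"] unfolding Neg_def by blast
    show "\<forall>\<^sub>F y in at y0. a < level y"
      using eventually_pair_ball[OF e(1), where ?y0.0 = y0 and a = a'] eventually_norm_less_1[OF y0]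
    proof eventually_elim
      case (elim y)
      then have ya: "(y, a') \<in> ball 0 1" "(y, a') \<notin> Neg" using e by auto
      then have "(y, a') \<in> Pos" using cover by blast
      then have "a' \<le> level y" using level_in[OF elim(2)] Pos_below_Neg by blast
      moreover have "level y \<noteq> a'" using ya level_in[OF elim(2)] by auto
      ultimately show ?case using a' by linarith
    qed
  next
    fix a assume a: "level y0 < a"
    define a' where "a' = min a (level y0 + d / 2)"
    have a': "a' \<le> a" "level y0 < a'" using a d by (auto simp: a'_def)
    have "(y0, a') \<in> ball 0 1"
      using d(2)[of "a' - level y0"] a' d(1) by (auto simp: a'_def)
    moreover have "(y0, a') \<notin> Pos" using Pos_below_Neg[of y0 "level y0" a'] L a' by auto
    ultimately obtain e where e: "e > 0" "ball (y0, a') e \<subseteq> ball 0 1" "ball (y0, a') e \<inter> Pos = {}"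
      using not_in_cells_open[OF sub(1), of "(y0, a')"] unfolding Pos_def by blast
    show "\<forall>\<^sub>F y in at y0. level y < a"
      using eventually_pair_ball[OF e(1), where ?y0.0 = y0 and a = a'] eventually_norm_less_1[OF y0]
    proof eventually_elim
      case (elim y)
      then have ya: "(y, a') \<in> ball 0 1" "(y, a') \<notin> Pos" using e by auto
      then have "(y, a') \<in> Neg" using cover by blast
      then have "level y \<le> a'" using level_in[OF elim(2)] Pos_below_Neg by blast
      moreover have "level y \<noteq> a'" using ya level_in[OF elim(2)] by auto
      ultimately show ?case using a' by linarith
    qed
  qed
  then show "isCont level y0" by (simp add: continuous_at)
qed

lemma Pos_Int_Neg_eq_graph: "Pos \<inter> Neg = (\<lambda>y. (y, level y)) ` ball 0 1"
proof (intro equalityI subsetI)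
  fix p assume p: "p \<in> Pos \<inter> Neg"
  obtain y t where yt: "p = (y, t)" by fastforce
  have "(norm y)\<^sup>2 + t\<^sup>2 < 1"
    using p yt Pos_subset_ball pair_in_ball[of 1 y t] by auto
  then have "(norm y)\<^sup>2 < 1" using zero_le_power2[of t] by linarith
  then have "norm y < 1" by (simp add: power_less_one_iff)
  then show "p \<in> (\<lambda>y. (y, level y)) ` ball 0 1"
    using level_unique[of y t] p yt by auto
qed (use level_in in auto)

text \<open>
  The finitely many sets \<open>cell i \<inter> cell j\<close> that meet the graph near a point are closed, so those
  with empty interior in the graph do not cover a neighbourhood of the point.
\<close>

lemma thick_pair:
  assumes y0: "norm y0 < 1"
  obtains i j y1 e where "i \<in> positive" "j \<in> negative" "(y0, level y0) \<in> cell i \<inter> cell j"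
    "e > 0" "ball y1 e \<subseteq> ball 0 1" "(\<lambda>y. (y, level y)) ` ball y1 e \<subseteq> cell i \<inter> cell j"
proof -
  define g where "g = (\<lambda>y. (y, level y))"
  obtain \<delta> where \<delta>: "\<delta> > 0" "cball y0 \<delta> \<subseteq> ball 0 1"
    using y0 open_contains_cball[of "ball (0 :: complex) 1"] by (metis mem_ball_0 open_ball)
  define V where "V = cball y0 \<delta>"
  have cont: "continuous_on V g"
    unfolding g_def V_def
    by (intro continuous_intros continuous_on_subset[OF continuous_level] \<delta>)
  have gb: "g y \<in> ball 0 1" "g y \<in> Pos" "g y \<in> Neg" if "y \<in> V" for y
    using level_in[of y] that \<delta>(2) Pos_subset_ball unfolding g_def V_def
    by (meson IntD1 IntD2 mem_ball_0 subsetD)+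
  have "compact (g ` V)"
    using cont by (rule compact_continuous_image) (simp add: V_def)
  moreover have "g ` V \<noteq> {}" using \<delta> by (auto simp: V_def)
  \<comment> \<open>By compactness the graph over \<open>V\<close> stays in a closed ball of radius
    below 1, where only finitely many cells are active.\<close>
  ultimately obtain p where p: "p \<in> g ` V" "\<forall>q\<in>g ` V. norm q \<le> norm p"
    using continuous_attains_sup[of "g ` V" norm] continuous_on_norm_id by blast
  define \<rho> where "\<rho> = norm p"
  have \<rho>: "\<rho> < 1" using p gb by (auto simp: \<rho>_def)
  have gc: "g y \<in> cball 0 \<rho>" if "y \<in> V" for y using p that by (auto simp: \<rho>_def)
  define act where "act = {i \<in> I. cell i \<inter> cball 0 \<rho> \<noteq> {}}"
  define pairs where "pairs = (positive \<inter> act) \<times> (negative \<inter> act)"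
  \<comment> \<open>\<open>dominated\<close> instead of \<open>cell\<close> makes these sets closed;
    over \<open>V\<close> the two agree, as the graph lies in the ball.\<close>
  define E where "E = (\<lambda>(i, j). {y \<in> V. g y \<in> dominated i \<inter> dominated j})"
  have fin: "finite pairs"
    unfolding pairs_def act_def using finite_active[OF \<rho>] by auto
  have closedE: "closed (E x)" for x
  proof -
    have "E x = V \<inter> g -` (dominated (fst x) \<inter> dominated (snd x))"
      by (auto simp: E_def split: prod.splits)
    moreover have "closed \<dots>"
      by (intro continuous_closed_preimage cont closed_Int closed_dominated) (simp add: V_def)
    ultimately show ?thesis by simp
  qed
  have VE: "V \<subseteq> (\<Union>x\<in>pairs. E x)"
  proof
    fix y assume y: "y \<in> V"
    then obtain i j where "i \<in> positive" "g y \<in> cell i" "j \<in> negative" "g y \<in> cell j"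
      using gb(2,3)[OF y] by (auto simp: Pos_def Neg_def)
    then have "(i, j) \<in> pairs" "y \<in> E (i, j)" using y gc[OF y]
      by (auto simp: pairs_def act_def E_def cell_def positive_def negative_def)
    then show "y \<in> (\<Union>x\<in>pairs. E x)" by blast
  qed
  define T1 where "T1 = {x \<in> pairs. interior (E x) = {}}"
  define T2 where "T2 = {x \<in> pairs. interior (E x) \<noteq> {}}"
  have empty: "interior (\<Union>x\<in>T. E x) = {}" if "finite T" "T \<subseteq> T1" for T
    using that
  proof (induction T rule: finite_induct)
    case (insert x T)
    have "interior (E x \<union> (\<Union>x\<in>T. E x)) = interior (E x)"
      using insert by (intro interior_closed_Un_empty_interior closedE) auto
    then show ?case using insert by (auto simp: T1_def)
  qed simp
  have "\<exists>x\<in>T2. y0 \<in> E x"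
  proof (rule ccontr)
    assume no: "\<not> (\<exists>x\<in>T2. y0 \<in> E x)"
    define U where "U = ball y0 \<delta> - (\<Union>x\<in>T2. E x)"
    have "finite T2" using fin by (simp add: T2_def)
    then have "open U" unfolding U_def by (intro open_Diff closed_UN ballI closedE open_ball)
    moreover have "U \<subseteq> (\<Union>x\<in>T1. E x)"
    proof
      fix y assume y: "y \<in> U"
      then have "y \<in> V" by (auto simp: U_def V_def)
      then obtain x where "x \<in> pairs" "y \<in> E x" using VE by blast
      moreover from this have "x \<notin> T2" using y by (auto simp: U_def)
      ultimately show "y \<in> (\<Union>x\<in>T1. E x)" unfolding T1_def T2_def by blast
    qed
    ultimately have "U \<subseteq> interior (\<Union>x\<in>T1. E x)" by (rule interior_maximal[rotated])
    moreover have "y0 \<in> U" using no \<delta> by (auto simp: U_def)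
    moreover have "finite T1" using fin by (simp add: T1_def)
    ultimately show False using empty[of T1] by blast
  qed
  then obtain i j where ij: "(i, j) \<in> T2" "y0 \<in> E (i, j)" by force
  \<comment> \<open>The disc lies around some \<open>y1\<close>, in general not around
    \<open>y0\<close>, which may be on the edge of the cell.\<close>
  then obtain y1 where "y1 \<in> interior (E (i, j))" by (auto simp: T2_def)
  then obtain e where e: "e > 0" "ball y1 e \<subseteq> E (i, j)" by (auto simp: mem_interior)
  have cellE: "g y \<in> cell i \<inter> cell j" if "y \<in> E (i, j)" for y
    using that gb(1) by (auto simp: E_def cell_def)
  show thesis
  proof (rule that)
    show "i \<in> positive" "j \<in> negative" using ij by (auto simp: T2_def pairs_def)
    show "(y0, level y0) \<in> cell i \<inter> cell j" using cellE[OF ij(2)] by (simp add: g_def)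
    show "e > 0" by fact
    have "E (i, j) \<subseteq> V" by (auto simp: E_def)
    then show "ball y1 e \<subseteq> ball 0 1" using e(2) \<delta>(2) unfolding V_def by blast
    show "(\<lambda>y. (y, level y)) ` ball y1 e \<subseteq> cell i \<inter> cell j" 
      using cellE e(2) by (auto simp: g_def subset_iff)
  qed
qed

end

section \<open>Geodesics in the Klein model\<close>

text \<open>Lorentz product of \<open>(1, p)\<close> and \<open>(1, q)\<close> after scaling both to
  the hyperboloid: the hyperbolic cosine of the distance in the Klein ball.\<close>

definition klein_cosh :: "'a :: real_inner \<Rightarrow> 'a \<Rightarrow> real" where
  "klein_cosh p q = (1 - p \<bullet> q) / (sqrt (1 - (norm p)\<^sup>2) * sqrt (1 - (norm q)\<^sup>2))"

text \<open>
  In the hyperboloid model the difference between \<open>x\<close> and the interpolated point is isotropic and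
  orthogonal to the timelike vector \<open>p\<close>, so it vanishes.
\<close>

lemma klein_cosh_collinear:
  fixes p q x :: "'a :: real_inner"
  assumes p: "norm p < 1" and q: "norm q < 1" and x: "norm x < 1" and st: "s \<noteq> t"
    and pq: "klein_cosh p q = cosh (s - t)"
    and xp: "klein_cosh x p = cosh (u - s)"
    and xq: "klein_cosh x q = cosh (u - t)"
  shows "\<exists>v. x = p + v *\<^sub>R (q - p)"
proof -
  define np where "np = 1 / sqrt (1 - (norm p)\<^sup>2)"
  define nq where "nq = 1 / sqrt (1 - (norm q)\<^sup>2)"
  define nx where "nx = 1 / sqrt (1 - (norm x)\<^sup>2)"
  have pos: "0 < 1 - (norm p)\<^sup>2" "0 < 1 - (norm q)\<^sup>2" "0 < 1 - (norm x)\<^sup>2"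
    using p q x by (auto simp: power_less_one_iff)
  then have n_pos: "np > 0" "nq > 0" "nx > 0" by (auto simp: np_def nq_def nx_def)
  define a where "a = t - u"
  define b where "b = u - s"
  have ab: "sinh (a + b) \<noteq> 0" using st by (simp add: a_def b_def)
  \<comment> \<open>Interpolation weights on a geodesic of the hyperboloid, for the point at signed
    distance \<open>b\<close> from \<open>p\<close> and \<open>a\<close> from
    \<open>q\<close>.\<close>
  define A where "A = sinh a / sinh (a + b)"
  define B where "B = sinh b / sinh (a + b)"
  have gpp: "np\<^sup>2 * (1 - p \<bullet> p) = 1" and gqq: "nq\<^sup>2 * (1 - q \<bullet> q) = 1"
    and gxx: "nx\<^sup>2 * (1 - x \<bullet> x) = 1"
    using pos by (auto simp: np_def nq_def nx_def power_divide dot_square_norm)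
  have gpq: "np * nq * (1 - p \<bullet> q) = cosh (a + b)"
    using pq cosh_minus[of "s - t"] by (simp add: klein_cosh_def np_def nq_def a_def b_def)
  have gxp: "nx * np * (1 - x \<bullet> p) = cosh b"
    using xp by (simp add: klein_cosh_def np_def nx_def b_def)
  have gxq: "nx * nq * (1 - x \<bullet> q) = cosh a"
    using xq cosh_minus[of "u - t"] by (simp add: klein_cosh_def nq_def nx_def a_def)
  have e1: "cosh b = A + B * cosh (a + b)"
  proof -
    have "sinh a = sinh (a + b) * cosh b - cosh (a + b) * sinh b"
      using sinh_diff[of "a + b" b] by simp
    then show ?thesis using ab by (simp add: A_def B_def field_simps)
  qed
  have e2: "cosh a = B + A * cosh (a + b)"
  proof -
    have "sinh b = sinh (a + b) * cosh a - cosh (a + b) * sinh a"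
      using sinh_diff[of "a + b" a] by simp
    then show ?thesis using ab by (simp add: A_def B_def field_simps)
  qed
  have e3: "A * cosh b + B * cosh a = 1"
  proof -
    have "A * cosh b + B * cosh a = (sinh a * cosh b + cosh a * sinh b) / sinh (a + b)"
      by (simp add: A_def B_def add_divide_distrib)
    then show ?thesis using ab by (simp flip: sinh_add)
  qed
  \<comment> \<open>Time and space components of the difference, taken on the hyperboloid, between
    \<open>x\<close> and the interpolated point.\<close>
  define T where "T = nx - A * np - B * nq"
  define Y where "Y = nx *\<^sub>R x - (A * np) *\<^sub>R p - (B * nq) *\<^sub>R q"
  have "np * (T - Y \<bullet> p) = nx * np * (1 - x \<bullet> p) - A * (np\<^sup>2 * (1 - p \<bullet> p)) - B * (np * nq * (1 - p \<bullet> q))"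
    by (simp add: T_def Y_def inner_simps algebra_simps power2_eq_square inner_commute)
  also have "\<dots> = 0" unfolding gxp gpp gpq using e1 by simp
  finally have TY: "T = Y \<bullet> p" using n_pos by simp
  have "T\<^sup>2 - Y \<bullet> Y = nx\<^sup>2 * (1 - x \<bullet> x) + A\<^sup>2 * (np\<^sup>2 * (1 - p \<bullet> p)) + B\<^sup>2 * (nq\<^sup>2 * (1 - q \<bullet> q))
      - 2 * A * (nx * np * (1 - x \<bullet> p)) - 2 * B * (nx * nq * (1 - x \<bullet> q))
      + 2 * A * B * (np * nq * (1 - p \<bullet> q))"
    by (simp add: T_def Y_def inner_simps algebra_simps power2_eq_square inner_commute)
  also have "\<dots> = 1 + A\<^sup>2 + B\<^sup>2 - 2 * A * cosh b - 2 * B * cosh a + 2 * A * B * cosh (a + b)"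
    unfolding gxp gpp gpq gqq gxx gxq by simp
  also have "\<dots> = 1 - (A * cosh b + B * cosh a)"
    unfolding e1 e2 by (simp add: algebra_simps power2_eq_square)
  also have "\<dots> = 0" using e3 by simp
  finally have "(Y \<bullet> p)\<^sup>2 = (norm Y)\<^sup>2" using TY by (simp add: dot_square_norm)
  moreover have "(Y \<bullet> p)\<^sup>2 \<le> (norm Y)\<^sup>2 * (norm p)\<^sup>2"
    using Cauchy_Schwarz_ineq[of Y p] by (simp add: dot_square_norm)
  ultimately have "(norm Y)\<^sup>2 * (1 - (norm p)\<^sup>2) \<le> 0" by (simp add: algebra_simps)
  then have "(norm Y)\<^sup>2 \<le> 0" using pos(1) by (simp add: mult_le_0_iff)
  then have Y0: "Y = 0" by simp
  then have "nx = A * np + B * nq" using TY by (simp add: T_def)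
  moreover have "nx *\<^sub>R x = (A * np) *\<^sub>R p + (B * nq) *\<^sub>R q" using Y0 by (simp add: Y_def algebra_simps)
  ultimately have "nx *\<^sub>R x = nx *\<^sub>R p + (B * nq) *\<^sub>R (q - p)" by (simp add: algebra_simps)
  then have "(1 / nx) *\<^sub>R nx *\<^sub>R x = (1 / nx) *\<^sub>R (nx *\<^sub>R p + (B * nq) *\<^sub>R (q - p))" by simp
  then have "x = p + (B * nq / nx) *\<^sub>R (q - p)" using n_pos by (simp add: scaleR_add_right)
  then show ?thesis ..
qed

text \<open>The geodesic of the hyperboloid spanned by the lightlike vectors
  \<open>(1, \<xi>)\<close> and \<open>(1, \<eta>)\<close>, projected to the ball; the exponential
  weights give unit speed.\<close>

definition chord :: "'a :: real_inner \<Rightarrow> 'a \<Rightarrow> real \<Rightarrow> 'a" where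
  "chord \<xi> \<eta> t = (1 / (exp t + exp (- t))) *\<^sub>R (exp t *\<^sub>R \<xi> + exp (- t) *\<^sub>R \<eta>)"

lemma exp_add_exp_minus_pos: "0 < exp t + exp (- t :: real)"
  by (intro add_pos_pos) auto

text \<open>The terms with \<open>exp (s + t)\<close> and \<open>exp (- s - t)\<close> cancel
  because the ends are unit vectors; only the mixed terms survive, and they add up to
  \<open>2 * cosh (s - t)\<close>.\<close>

lemma one_minus_inner_chord:
  assumes "norm \<xi> = 1" "norm \<eta> = 1"
  shows "1 - chord \<xi> \<eta> s \<bullet> chord \<xi> \<eta> t =
    2 * (1 - \<xi> \<bullet> \<eta>) * cosh (s - t) / ((exp s + exp (- s)) * (exp t + exp (- t)))"
proof -
  have n: "\<xi> \<bullet> \<xi> = 1" "\<eta> \<bullet> \<eta> = 1" using assms by (auto simp: dot_square_norm)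
  define S where "S = exp s + exp (- s)"
  define T where "T = exp t + exp (- t)"
  have ST: "S \<noteq> 0" "T \<noteq> 0" using exp_add_exp_minus_pos[of s] exp_add_exp_minus_pos[of t]
    by (auto simp: S_def T_def)
  define E where "E = exp s * exp t + exp (- s) * exp (- t)"
  have C: "exp s * exp (- t) + exp (- s) * exp t = 2 * cosh (s - t)"
    by (simp add: cosh_def exp_diff exp_minus field_simps)
  have "chord \<xi> \<eta> s \<bullet> chord \<xi> \<eta> t =
      (E + (exp s * exp (- t) + exp (- s) * exp t) * (\<xi> \<bullet> \<eta>)) / (S * T)"
    unfolding chord_def S_def[symmetric] T_def[symmetric] E_def
    by (simp add: inner_simps n inner_commute[of \<eta> \<xi>] algebra_simps add_divide_distrib)
  then have "1 - chord \<xi> \<eta> s \<bullet> chord \<xi> \<eta> t = (S * T - (E + 2 * cosh (s - t) * (\<xi> \<bullet> \<eta>))) / (S * T)"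
    unfolding C using ST by (simp add: diff_divide_distrib)
  also have "S * T = E + (exp s * exp (- t) + exp (- s) * exp t)"
    by (simp add: S_def T_def E_def algebra_simps)
  then have "S * T - (E + 2 * cosh (s - t) * (\<xi> \<bullet> \<eta>)) = 2 * (1 - \<xi> \<bullet> \<eta>) * cosh (s - t)"
    unfolding C by (simp add: algebra_simps)
  finally show ?thesis by (simp add: S_def T_def)
qed

lemma chord_in_ball:
  assumes "norm \<xi> = 1" "norm \<eta> = 1" "\<xi> \<noteq> \<eta>"
  shows "norm (chord \<xi> \<eta> t) < 1"
    and "sqrt (1 - (norm (chord \<xi> \<eta> t))\<^sup>2) = sqrt (2 * (1 - \<xi> \<bullet> \<eta>)) / (exp t + exp (- t))"
    and "0 < 1 - \<xi> \<bullet> \<eta>"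
proof -
  have n: "\<xi> \<bullet> \<xi> = 1" "\<eta> \<bullet> \<eta> = 1" using assms by (auto simp: dot_square_norm)
  have "0 < (\<xi> - \<eta>) \<bullet> (\<xi> - \<eta>)" using assms by simp
  also have "\<dots> = 2 * (1 - \<xi> \<bullet> \<eta>)"
    using n by (simp add: inner_diff_left inner_diff_right inner_commute)
  finally show pos: "0 < 1 - \<xi> \<bullet> \<eta>" by simp
  have eq: "1 - (norm (chord \<xi> \<eta> t))\<^sup>2 = 2 * (1 - \<xi> \<bullet> \<eta>) / (exp t + exp (- t))\<^sup>2"
    using one_minus_inner_chord[OF assms(1,2), of t t] by (simp add: dot_square_norm power2_eq_square)
  moreover have "0 < \<dots>" using pos exp_add_exp_minus_pos[of t] by simp
  ultimately have "(norm (chord \<xi> \<eta> t))\<^sup>2 < 1" by linarith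
  then show "norm (chord \<xi> \<eta> t) < 1" by (simp add: power_less_one_iff)
  show "sqrt (1 - (norm (chord \<xi> \<eta> t))\<^sup>2) = sqrt (2 * (1 - \<xi> \<bullet> \<eta>)) / (exp t + exp (- t))"
    unfolding eq using exp_add_exp_minus_pos[of t] by (simp add: real_sqrt_divide)
qed

lemma klein_cosh_chord:
  assumes "norm \<xi> = 1" "norm \<eta> = 1" "\<xi> \<noteq> \<eta>"
  shows "klein_cosh (chord \<xi> \<eta> s) (chord \<xi> \<eta> t) = cosh (s - t)"
proof -
  define \<mu> where "\<mu> = 2 * (1 - \<xi> \<bullet> \<eta>)"
  have \<mu>: "sqrt \<mu> * sqrt \<mu> = \<mu>" "\<mu> > 0" using chord_in_ball(3)[OF assms] by (auto simp: \<mu>_def)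
  show ?thesis
    unfolding klein_cosh_def one_minus_inner_chord[OF assms(1,2)] chord_in_ball(2)[OF assms]
      \<mu>_def[symmetric]
    using \<mu> exp_add_exp_minus_pos[of s] exp_add_exp_minus_pos[of t] by simp
qed

lemma chord_through:
  fixes p q :: "'a :: euclidean_space"
  assumes p: "norm p < 1" and q: "norm q < 1" and "p \<noteq> q"
  obtains \<xi> \<eta> where "norm \<xi> = 1" "norm \<eta> = 1" "\<xi> \<noteq> \<eta>"
    "\<And>v. norm (p + v *\<^sub>R (q - p)) < 1 \<Longrightarrow> \<exists>t. p + v *\<^sub>R (q - p) = chord \<xi> \<eta> t"
proof -
  define l where "l = q - p"
  have l: "l \<noteq> 0" using assms by (simp add: l_def)
  have pi: "p \<in> interior (ball 0 1)" using p by (simp add: interior_open)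
  obtain d where d: "0 < d" "p + d *\<^sub>R l \<in> frontier (ball 0 1)"
    by (rule ray_to_frontier[OF bounded_ball pi l])
  have l': "- l \<noteq> 0" using l by simp
  obtain d' where d': "0 < d'" "p + d' *\<^sub>R (- l) \<in> frontier (ball 0 1)"
    by (rule ray_to_frontier[OF bounded_ball pi l'])
  define \<xi> where "\<xi> = p + d *\<^sub>R l"
  define \<eta> where "\<eta> = p - d' *\<^sub>R l"
  have n: "norm \<xi> = 1" "norm \<eta> = 1" using d d' by (auto simp: \<xi>_def \<eta>_def frontier_ball)
  have "\<xi> - \<eta> = (d + d') *\<^sub>R l" by (simp add: \<xi>_def \<eta>_def algebra_simps)
  then have ne: "\<xi> \<noteq> \<eta>" using l d d' by auto
  \<comment> \<open>By convexity: if \<tau> were at least \<open>e\<close>, the point at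
    \<open>e\<close> would lie between \<open>p\<close> and the point at \<tau>, hence inside the
    open ball.\<close>
  have between: "\<tau> < e" if "norm (p + \<tau> *\<^sub>R k) < 1" "norm (p + e *\<^sub>R k) = 1" "e > 0" for \<tau> e k
  proof (rule ccontr)
    assume "\<not> \<tau> < e"
    then have \<tau>: "e \<le> \<tau>" "0 < \<tau>" using that by auto
    have "p + e *\<^sub>R k = (1 - e / \<tau>) *\<^sub>R p + (e / \<tau>) *\<^sub>R (p + \<tau> *\<^sub>R k)"
      using \<tau> by (simp add: algebra_simps)
    also have "\<dots> \<in> ball 0 1"
      using \<tau> that p by (intro convexD[OF convex_ball]) auto
    finally show False using that by simp
  qed
  have "\<exists>t. p + v *\<^sub>R (q - p) = chord \<xi> \<eta> t" if "norm (p + v *\<^sub>R (q - p)) < 1" for v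
  proof -
    have v1: "norm (p + v *\<^sub>R l) < 1" using that by (simp add: l_def)
    have "v < d" using between[of v l d] v1 n d by (simp add: \<xi>_def)
    moreover have "- v < d'" using between[of "- v" "- l" d'] v1 n d' by (simp add: \<eta>_def)
    ultimately have v: "0 < d - v" "0 < v + d'" by auto
    \<comment> \<open>\<open>chord\<close> weights its ends in the ratio \<open>exp (2 * t)\<close>;
      the point with parameter \<open>v\<close> divides the segment from \<eta> to \<xi> in the
      ratio \<open>(v + d') / (d - v)\<close>.\<close>
    define r where "r = (v + d') / (d - v)"
    have r: "r > 0" using v by (simp add: r_def)
    define t where "t = ln r / 2"
    have ee: "exp t * exp t = r" using r by (simp add: t_def flip: exp_add)
    have c: "chord \<xi> \<eta> t = (1 / (r + 1)) *\<^sub>R (r *\<^sub>R \<xi> + \<eta>)"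
    proof -
      have "exp t + exp (- t) = exp (- t) * (r + 1)"
        by (simp add: algebra_simps exp_minus flip: ee)
      moreover have "exp t *\<^sub>R \<xi> + exp (- t) *\<^sub>R \<eta> = exp (- t) *\<^sub>R (r *\<^sub>R \<xi> + \<eta>)"
        by (simp add: algebra_simps exp_minus flip: ee)
      ultimately show ?thesis unfolding chord_def by simp
    qed
    have r1: "r + 1 = (d + d') / (d - v)" using v by (simp add: r_def field_simps)
    have "r *\<^sub>R \<xi> + \<eta> = (r + 1) *\<^sub>R p + (r * d - d') *\<^sub>R l"
      by (simp add: \<xi>_def \<eta>_def algebra_simps)
    also have "r * d - d' = (r + 1) * v"
      unfolding r1 unfolding r_def using v by (simp add: field_simps)
    finally have "r *\<^sub>R \<xi> + \<eta> = (r + 1) *\<^sub>R (p + v *\<^sub>R l)" by (simp add: algebra_simps)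
    with c r have "chord \<xi> \<eta> t = p + v *\<^sub>R l" by simp
    then show ?thesis by (metis l_def)
  qed
  with n ne show thesis by (rule that)
qed

text \<open>Such an \<open>S\<close> is convex, so unless empty it has a relative interior point
  \<open>g\<close>. For \<open>x\<close> in the affine hull, the segment from \<open>x\<close> to
  \<open>g\<close> can be prolonged a little beyond \<open>g\<close> inside \<open>S\<close>, and
  \<open>x\<close> lies on the line through \<open>g\<close> and the new point.\<close>

lemma line_closed_eq_affine_hull:
  fixes S :: "'a :: euclidean_space set"
  assumes S: "S \<subseteq> ball 0 1"
    and lines: "\<And>p q v. p \<in> S \<Longrightarrow> q \<in> S \<Longrightarrow> p + v *\<^sub>R (q - p) \<in> ball 0 1 \<Longrightarrow> p + v *\<^sub>R (q - p) \<in> S"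
  shows "S = affine hull S \<inter> ball 0 1"
proof (cases "S = {}")
  case False
  have "convex S"
  proof (rule convexI)
    fix x y u v assume xy: "x \<in> S" "y \<in> S" and uv: "0 \<le> u" "0 \<le> v" "u + v = (1 :: real)"
    have eq: "u *\<^sub>R x + v *\<^sub>R y = x + v *\<^sub>R (y - x)"
      using uv(3) by (simp add: algebra_simps flip: scaleR_add_left)
    have "u *\<^sub>R x + v *\<^sub>R y \<in> ball 0 1" using xy S uv by (intro convexD[OF convex_ball]) auto
    then show "u *\<^sub>R x + v *\<^sub>R y \<in> S" unfolding eq by (rule lines[OF xy])
  qed
  then obtain g where g: "g \<in> rel_interior S" using False rel_interior_eq_empty by blast
  show ?thesis
  proof (intro equalityI subsetI)
    fix x assume x: "x \<in> affine hull S \<inter> ball 0 1"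
    obtain e where e: "e > 1" "(1 - e) *\<^sub>R x + e *\<^sub>R g \<in> S"
      using convex_rel_interior_if2[OF \<open>convex S\<close> g] x by blast
    define q where "q = (1 - e) *\<^sub>R x + e *\<^sub>R g"
    have gS: "g \<in> S" using g rel_interior_subset by blast
    have "q - g = (e - 1) *\<^sub>R (g - x)" by (simp add: q_def algebra_simps)
    then have "x = g + (- 1 / (e - 1)) *\<^sub>R (q - g)" using e(1) by simp
    then show "x \<in> S" using lines[of g q "- 1 / (e - 1)"] gS e(2) x by (simp add: q_def)
  qed (use S hull_subset[of S affine] in auto)
qed simp

section \<open>The Klein model adapted to a hemisphere\<close>

lemma norm_pair_sq: "(norm (p :: 'a :: real_normed_vector \<times> real))\<^sup>2 = (norm (fst p))\<^sup>2 + (snd p)\<^sup>2"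
  by (cases p) (simp add: norm_Pair)

text \<open>Invariance of domain; it reduces the absence of a 3-ball in
  \<open>two_dimensional\<close> to the absence of a non-empty open subset.\<close>

lemma homeomorphic_ball_imp_open:
  assumes "T homeomorphic ball (0 :: 'a :: euclidean_space) 1"
  shows "open (T :: 'a set)" "T \<noteq> {}"
proof -
  from assms have "ball (0 :: 'a) 1 homeomorphic T" by (rule homeomorphic_sym[THEN iffD1])
  then obtain f g where h: "homeomorphism (ball (0 :: 'a) 1) T f g" by (auto simp: homeomorphic_def)
  have "inj_on f (ball 0 1)"
    by (rule inj_on_inverseI[of _ g]) (use h in \<open>auto simp: homeomorphism_def\<close>)
  then have "open (f ` ball 0 1)"
    using h by (intro invariance_of_domain) (auto simp: homeomorphism_def)
  then show "open T" "T \<noteq> {}" using h by (auto simp: homeomorphism_def)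
qed

lemma one_plus_snd_pos: "p \<in> ball (0 :: complex \<times> real) 1 \<Longrightarrow> 0 < 1 + snd p"
  using norm_snd_le[of "snd p" "fst p"] by auto

lemma one_minus_norm_pos: "p \<in> ball (0 :: 'a :: real_normed_vector) 1 \<Longrightarrow> 0 < 1 - (norm p)\<^sup>2"
  by (simp add: power_less_one_iff)

locale hemisphere =
  fixes c :: complex and r :: real
  assumes r_pos: "r > 0"
begin

section \<open>The isometry between the half-space and the ball\<close>

definition height :: "complex \<times> real \<Rightarrow> real" where
  "height w = (norm (fst w - c))\<^sup>2 + (snd w)\<^sup>2"

text \<open>Normalised so that inversion in the hemisphere becomes reflection in the last
  coordinate; the hemisphere goes to the fixed disc.\<close>

definition klein :: "complex \<times> real \<Rightarrow> complex \<times> real" where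
  "klein w = ((2 * r / (r\<^sup>2 + height w)) *\<^sub>R (fst w - c), (r\<^sup>2 - height w) / (r\<^sup>2 + height w))"

definition klein_inv :: "complex \<times> real \<Rightarrow> complex \<times> real" where
  "klein_inv p = (c + (r / (1 + snd p)) *\<^sub>R fst p, r * sqrt (1 - (norm p)\<^sup>2) / (1 + snd p))"

definition hemi :: "(complex \<times> real) set" where
  "hemi = {w \<in> H3. height w = r\<^sup>2}"

lemma denom_pos: "0 < r\<^sup>2 + height w"
  using r_pos by (simp add: height_def add_pos_nonneg)

lemma one_minus_norm_klein: "1 - (norm (klein w))\<^sup>2 = (2 * r * snd w / (r\<^sup>2 + height w))\<^sup>2"
proof -
  define d where "d = r\<^sup>2 + height w"
  have d: "d \<noteq> 0" using denom_pos[of w] by (simp add: d_def)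
  have "1 - (norm (klein w))\<^sup>2 =
      (d\<^sup>2 - 4 * r\<^sup>2 * (norm (fst w - c))\<^sup>2 - (r\<^sup>2 - height w)\<^sup>2) / d\<^sup>2"
    unfolding norm_pair_sq klein_def d_def[symmetric] using d
    by (simp add: power_mult_distrib power_divide diff_divide_distrib[of _ _ "d\<^sup>2"])
  also have "d\<^sup>2 - 4 * r\<^sup>2 * (norm (fst w - c))\<^sup>2 - (r\<^sup>2 - height w)\<^sup>2 = (2 * r * snd w)\<^sup>2"
    by (simp add: d_def height_def power2_eq_square algebra_simps)
  finally show ?thesis by (simp add: d_def power_divide)
qed

lemma sqrt_one_minus_norm_klein:
  "w \<in> H3 \<Longrightarrow> sqrt (1 - (norm (klein w))\<^sup>2) = 2 * r * snd w / (r\<^sup>2 + height w)"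
  unfolding one_minus_norm_klein using r_pos denom_pos[of w] by (auto simp: H3_def)

lemma klein_in_ball: "w \<in> H3 \<Longrightarrow> klein w \<in> ball 0 1"
proof -
  assume "w \<in> H3"
  then have "0 < (2 * r * snd w / (r\<^sup>2 + height w))\<^sup>2"
    using r_pos denom_pos[of w] by (auto simp: H3_def)
  then have "(norm (klein w))\<^sup>2 < 1" using one_minus_norm_klein[of w] by linarith
  then show ?thesis by (simp add: power_less_one_iff)
qed

lemma one_plus_snd_klein: "1 + snd (klein w) = 2 * r\<^sup>2 / (r\<^sup>2 + height w)"
  using denom_pos[of w] by (simp add: klein_def field_simps)

lemma klein_inv_klein: "w \<in> H3 \<Longrightarrow> klein_inv (klein w) = w"
proof -
  assume w: "w \<in> H3"
  have "r / (1 + snd (klein w)) * (2 * r / (r\<^sup>2 + height w)) = 1"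
    unfolding one_plus_snd_klein using r_pos denom_pos[of w] by (simp add: power2_eq_square)
  then have "fst (klein_inv (klein w)) = fst w"
    using r_pos by (simp add: klein_inv_def) (simp add: klein_def)
  moreover have "snd (klein_inv (klein w)) = snd w"
    unfolding klein_inv_def snd_conv sqrt_one_minus_norm_klein[OF w] one_plus_snd_klein
    using r_pos denom_pos[of w] by (simp add: power2_eq_square)
  ultimately show ?thesis by (simp add: prod_eq_iff)
qed

lemma klein_inv_in_H3: "p \<in> ball 0 1 \<Longrightarrow> klein_inv p \<in> H3"
  using one_plus_snd_pos[of p] one_minus_norm_pos[of p] r_pos
  by (auto simp: klein_inv_def H3_def)

lemma height_klein_inv: "p \<in> ball 0 1 \<Longrightarrow> height (klein_inv p) = r\<^sup>2 * (1 - snd p) / (1 + snd p)"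
proof -
  assume p: "p \<in> ball 0 1"
  define v where "v = 1 + snd p"
  have v: "v > 0" using one_plus_snd_pos[OF p] by (simp add: v_def)
  have "height (klein_inv p) = (r\<^sup>2 * (norm (fst p))\<^sup>2 + r\<^sup>2 * (1 - (norm p)\<^sup>2)) / v\<^sup>2"
    unfolding height_def klein_inv_def v_def[symmetric] using one_minus_norm_pos[OF p]
    by (simp add: power_divide power_mult_distrib add_divide_distrib)
  also have "\<dots> = r\<^sup>2 * (1 - snd p) * v / v\<^sup>2"
    unfolding norm_pair_sq by (simp add: v_def algebra_simps power2_eq_square)
  also have "\<dots> = r\<^sup>2 * (1 - snd p) / v" using v by (simp add: power2_eq_square)
  finally show ?thesis by (simp add: v_def)
qed

lemma klein_klein_inv: "p \<in> ball 0 1 \<Longrightarrow> klein (klein_inv p) = p"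
proof -
  assume p: "p \<in> ball 0 1"
  define v where "v = 1 + snd p"
  have v: "v > 0" using one_plus_snd_pos[OF p] by (simp add: v_def)
  have h: "height (klein_inv p) = r\<^sup>2 * (1 - snd p) / v"
    using height_klein_inv[OF p] by (simp add: v_def)
  have s: "r\<^sup>2 + height (klein_inv p) = 2 * r\<^sup>2 / v"
    unfolding h using v by (simp add: field_simps v_def)
  have d: "r\<^sup>2 - height (klein_inv p) = 2 * r\<^sup>2 * snd p / v"
    unfolding h using v by (simp add: field_simps v_def)
  have "fst (klein (klein_inv p)) = fst p"
    unfolding klein_def s using v r_pos by (simp add: klein_inv_def v_def power2_eq_square)
  moreover have "snd (klein (klein_inv p)) = snd p"
    unfolding klein_def s d using v r_pos by simp
  ultimately show ?thesis by (simp add: prod_eq_iff)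
qed

text \<open>The denominator vanishes nowhere, not even outside \<open>H3\<close>;
  \<open>plane_unique\<close> applies \<open>klein\<close> to ideal points
  \<open>(z, 0)\<close>.\<close>

lemma continuous_on_klein: "continuous_on S klein"
proof -
  have "r\<^sup>2 + ((cmod (fst w - c))\<^sup>2 + (snd w)\<^sup>2) \<noteq> 0" for w
    using denom_pos[of w] by (simp add: height_def)
  then show ?thesis unfolding klein_def height_def by (intro continuous_intros) auto
qed

lemma continuous_on_klein_inv: "continuous_on (ball 0 1) klein_inv"
proof -
  have "1 + snd p \<noteq> 0" if "p \<in> ball 0 1" for p :: "complex \<times> real"
    using one_plus_snd_pos[OF that] by simp
  then show ?thesis unfolding klein_inv_def by (intro continuous_intros) auto
qed

text \<open>\<open>klein\<close> preserves distances. At the level of the argument of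
  \<open>arcosh\<close> this is an algebraic identity.\<close>

lemma cosh_arg_eq:
  assumes p: "p \<in> H3" and q: "q \<in> H3"
  shows "1 + (dist p q)\<^sup>2 / (2 * snd p * snd q) = klein_cosh (klein p) (klein q)"
proof -
  have pq: "snd p > 0" "snd q > 0" using p q by (auto simp: H3_def)
  define P where "P = r\<^sup>2 + height p"
  define Q where "Q = r\<^sup>2 + height q"
  define x where "x = fst p - c"
  define y where "y = fst q - c"
  have PQ: "P > 0" "Q > 0" using denom_pos by (auto simp: P_def Q_def)
  have xy: "(norm (x - y))\<^sup>2 = (norm x)\<^sup>2 + (norm y)\<^sup>2 - 2 * (x \<bullet> y)"
    by (simp add: inner_diff_left inner_diff_right inner_commute flip: dot_square_norm)
  have d: "(dist p q)\<^sup>2 = (norm (x - y))\<^sup>2 + (snd p - snd q)\<^sup>2"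
    by (simp add: dist_prod_def dist_norm x_def y_def)
  have "1 - klein p \<bullet> klein q = (P * Q - 4 * r\<^sup>2 * (x \<bullet> y) - (r\<^sup>2 - height p) * (r\<^sup>2 - height q)) / (P * Q)"
    unfolding klein_def P_def[symmetric] Q_def[symmetric] x_def[symmetric] y_def[symmetric]
    using PQ by (simp add: inner_prod_def field_simps power2_eq_square)
  also have "P * Q - 4 * r\<^sup>2 * (x \<bullet> y) - (r\<^sup>2 - height p) * (r\<^sup>2 - height q) =
      2 * r\<^sup>2 * (height p + height q - 2 * (x \<bullet> y))"
    by (simp add: P_def Q_def algebra_simps)
  also have "height p + height q - 2 * (x \<bullet> y) = (dist p q)\<^sup>2 + 2 * snd p * snd q"
    unfolding d xy by (simp add: height_def x_def y_def power2_eq_square algebra_simps)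
  finally have n: "1 - klein p \<bullet> klein q = 2 * r\<^sup>2 * ((dist p q)\<^sup>2 + 2 * snd p * snd q) / (P * Q)" .
  have "klein_cosh (klein p) (klein q) = ((dist p q)\<^sup>2 + 2 * snd p * snd q) / (2 * snd p * snd q)"
    unfolding klein_cosh_def n sqrt_one_minus_norm_klein[OF p] sqrt_one_minus_norm_klein[OF q]
      P_def[symmetric] Q_def[symmetric]
    using PQ pq r_pos by (simp add: field_simps power2_eq_square)
  also have "\<dots> = 1 + (dist p q)\<^sup>2 / (2 * snd p * snd q)" using pq by (simp add: field_simps)
  finally show ?thesis by simp
qed

lemma hyp_dist_klein:
  "p \<in> H3 \<Longrightarrow> q \<in> H3 \<Longrightarrow> hyp_dist p q = arcosh (klein_cosh (klein p) (klein q))"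
  by (simp add: hyp_dist_def cosh_arg_eq)

lemma klein_cosh_ge_1:
  assumes "p \<in> H3" "q \<in> H3"
  shows "1 \<le> klein_cosh (klein p) (klein q)"
    and "p \<noteq> q \<Longrightarrow> 1 < klein_cosh (klein p) (klein q)"
proof -
  have pos: "0 < 2 * snd p * snd q" using assms by (auto simp: H3_def)
  then show "1 \<le> klein_cosh (klein p) (klein q)"
    unfolding cosh_arg_eq[OF assms, symmetric] by simp
  show "1 < klein_cosh (klein p) (klein q)" if "p \<noteq> q"
    unfolding cosh_arg_eq[OF assms, symmetric] using pos that by (simp del: mult.assoc)
qed

text \<open>A geodesic line is given only through its mutual distances; by
  \<open>klein_cosh_collinear\<close> the distances among three points force their images to be
  collinear.\<close>

lemma geodesic_line_collinear:
  assumes "geodesic_line \<gamma>" "s \<noteq> t"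
  shows "\<exists>v. klein (\<gamma> u) = klein (\<gamma> s) + v *\<^sub>R (klein (\<gamma> t) - klein (\<gamma> s))"
proof -
  have H: "\<gamma> a \<in> H3" for a using assms(1) by (auto simp: geodesic_line_def)
  have eq: "klein_cosh (klein (\<gamma> a)) (klein (\<gamma> b)) = cosh (a - b)" for a b
  proof -
    have "arcosh (klein_cosh (klein (\<gamma> a)) (klein (\<gamma> b))) = \<bar>a - b\<bar>"
      using assms(1) hyp_dist_klein[OF H H, of a b] by (simp add: geodesic_line_def)
    then have "cosh (arcosh (klein_cosh (klein (\<gamma> a)) (klein (\<gamma> b)))) = cosh (a - b)" by simp
    then show ?thesis using klein_cosh_ge_1(1)[OF H H, of a b] by simp
  qed
  have b: "norm (klein (\<gamma> a)) < 1" for a using klein_in_ball[OF H, of a] by simp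
  show ?thesis using b eq assms(2) by (intro klein_cosh_collinear[of _ _ _ s t u]) auto
qed

text \<open>The chord through two image points, parametrised by arc length, pulls back to a geodesic
  line that meets \<open>P\<close> at two parameters, so all of it is in \<open>P\<close>.\<close>

lemma totally_geodesic_line:
  assumes P: "totally_geodesic P" and p: "p \<in> klein ` P" and q: "q \<in> klein ` P"
    and x: "p + v *\<^sub>R (q - p) \<in> ball 0 1"
  shows "p + v *\<^sub>R (q - p) \<in> klein ` P"
proof (cases "p = q")
  case False
  have PH: "P \<subseteq> H3" using P by (simp add: totally_geodesic_def)
  have pq: "norm p < 1" "norm q < 1" using p q PH klein_in_ball by (auto simp: subset_iff)
  obtain \<xi> \<eta> where n: "norm \<xi> = 1" "norm \<eta> = 1" "\<xi> \<noteq> \<eta>"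
    and ch: "\<And>v. norm (p + v *\<^sub>R (q - p)) < 1 \<Longrightarrow> \<exists>t. p + v *\<^sub>R (q - p) = chord \<xi> \<eta> t"
    using chord_through[OF pq False] by blast
  define \<gamma> where "\<gamma> = (\<lambda>t. klein_inv (chord \<xi> \<eta> t))"
  have cb: "chord \<xi> \<eta> t \<in> ball 0 1" for t using chord_in_ball(1)[OF n] by simp
  have k: "klein (\<gamma> t) = chord \<xi> \<eta> t" for t unfolding \<gamma>_def by (rule klein_klein_inv[OF cb])
  have H: "\<gamma> t \<in> H3" for t unfolding \<gamma>_def by (rule klein_inv_in_H3[OF cb])
  have "hyp_dist (\<gamma> s) (\<gamma> t) = \<bar>s - t\<bar>" for s t
  proof -
    have "hyp_dist (\<gamma> s) (\<gamma> t) = arcosh (cosh \<bar>s - t\<bar>)"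
      unfolding hyp_dist_klein[OF H H] k klein_cosh_chord[OF n] by simp
    also have "\<dots> = \<bar>s - t\<bar>" by (intro arcosh_cosh_real) simp
    finally show ?thesis .
  qed
  then have geo: "geodesic_line \<gamma>" using H by (auto simp: geodesic_line_def)
  obtain s where s: "p = chord \<xi> \<eta> s" using ch[of 0] pq by auto
  obtain t where t: "q = chord \<xi> \<eta> t" using ch[of 1] pq by auto
  obtain u where u: "p + v *\<^sub>R (q - p) = chord \<xi> \<eta> u" using ch[of v] x by auto
  have "s \<noteq> t" using False s t by auto
  moreover have "\<gamma> s \<in> P" "\<gamma> t \<in> P"
    using p q PH klein_inv_klein unfolding \<gamma>_def s[symmetric] t[symmetric] by auto
  ultimately have "range \<gamma> \<subseteq> P" using P geo by (auto simp: totally_geodesic_def)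
  then show ?thesis unfolding u k[symmetric] by blast
qed (use p in simp)

lemma totally_geodesic_affine:
  assumes "totally_geodesic P"
  shows "klein ` P = affine hull (klein ` P) \<inter> ball 0 1"
proof (rule line_closed_eq_affine_hull)
  show "klein ` P \<subseteq> ball 0 1"
    using assms klein_in_ball by (auto simp: totally_geodesic_def simp del: mem_ball)
qed (rule totally_geodesic_line[OF assms])

section \<open>The hemisphere as the plane of the form\<close>

lemma snd_klein_eq_0_iff: "snd (klein w) = 0 \<longleftrightarrow> height w = r\<^sup>2"
  using denom_pos[of w] by (auto simp: klein_def)

lemma klein_inv_flat_in_hemi: "y \<in> ball 0 1 \<Longrightarrow> klein_inv (y, 0) \<in> hemi"
proof -
  assume "y \<in> ball 0 1"
  then have "(y, 0 :: real) \<in> ball 0 1" by (simp add: norm_Pair)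
  then show ?thesis
    unfolding hemi_def using klein_inv_in_H3 klein_klein_inv snd_klein_eq_0_iff by fastforce
qed

lemma klein_hemi: "w \<in> hemi \<Longrightarrow> klein w = (fst (klein w), 0) \<and> fst (klein w) \<in> ball 0 1"
  using klein_in_ball[of w] norm_fst_le[of "fst (klein w)" "snd (klein w)"] snd_klein_eq_0_iff[of w]
  by (auto simp: hemi_def prod_eq_iff)

text \<open>The inverse is the vertical projection. Serves both for the equatorial disc and for
  pieces of the graph of \<open>level\<close>.\<close>

lemma graph_homeomorphic_ball:
  assumes e: "e > 0" and cont: "continuous_on (ball y1 e) \<phi>"
    and sub: "\<And>y. y \<in> ball y1 e \<Longrightarrow> (y, \<phi> y) \<in> ball 0 1"
  shows "(\<lambda>y. klein_inv (y, \<phi> y)) ` ball y1 e homeomorphic ball (0 :: complex) 1"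
proof -
  have "homeomorphism (ball y1 e) ((\<lambda>y. klein_inv (y, \<phi> y)) ` ball y1 e)
      (\<lambda>y. klein_inv (y, \<phi> y)) (\<lambda>w. fst (klein w))"
  proof (rule homeomorphismI)
    show "continuous_on (ball y1 e) (\<lambda>y. klein_inv (y, \<phi> y))"
      using sub by (intro continuous_on_compose2[OF continuous_on_klein_inv] continuous_intros cont) auto
    show "continuous_on ((\<lambda>y. klein_inv (y, \<phi> y)) ` ball y1 e) (\<lambda>w. fst (klein w))"
      by (intro continuous_intros continuous_on_klein)
  qed (use sub klein_klein_inv in \<open>auto simp del: mem_ball\<close>)
  then have "(\<lambda>y. klein_inv (y, \<phi> y)) ` ball y1 e homeomorphic ball y1 e"
    by (meson homeomorphic_def homeomorphic_sym)
  also have "ball y1 e homeomorphic ball (0 :: complex) 1"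
    using e by (intro homeomorphic_balls) auto
  finally show ?thesis .
qed

lemma hemi_eq: "hemi = (\<lambda>y. klein_inv (y, 0)) ` ball 0 1"
proof (intro equalityI subsetI)
  fix w assume w: "w \<in> hemi"
  then have "w = klein_inv (fst (klein w), 0)"
    using klein_hemi[OF w] klein_inv_klein[of w] by (simp add: hemi_def)
  then show "w \<in> (\<lambda>y. klein_inv (y, 0)) ` ball 0 1" using klein_hemi[OF w] by blast
qed (use klein_inv_flat_in_hemi in auto)

lemma totally_geodesic_hemi: "totally_geodesic hemi"
  unfolding totally_geodesic_def
proof (intro conjI allI impI subsetI; (elim conjE)?)
  fix \<gamma> s t w assume g: "geodesic_line \<gamma>" "s \<noteq> t" "\<gamma> s \<in> hemi" "\<gamma> t \<in> hemi" and "w \<in> range \<gamma>"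
  then obtain u where u: "w = \<gamma> u" by blast
  obtain v where "klein w = klein (\<gamma> s) + v *\<^sub>R (klein (\<gamma> t) - klein (\<gamma> s))"
    using geodesic_line_collinear[OF g(1,2)] u by blast
  moreover have "snd (klein (\<gamma> s)) = 0" "snd (klein (\<gamma> t)) = 0"
    using g(3,4) unfolding snd_klein_eq_0_iff by (auto simp: hemi_def)
  ultimately have "snd (klein w) = 0" by simp
  moreover have "w \<in> H3" using g(1) u by (auto simp: geodesic_line_def)
  ultimately show "w \<in> hemi" by (simp add: hemi_def snd_klein_eq_0_iff)
qed (auto simp: hemi_def)

lemma two_dimensional_hemi: "two_dimensional hemi"
  unfolding two_dimensional_def
proof
  have "(y, 0 :: real) \<in> ball 0 1" if "y \<in> ball (0 :: complex) 1" for y using that by (simp add: norm_Pair)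
  then have "hemi homeomorphic ball (0 :: complex) 1"
    unfolding hemi_eq by (intro graph_homeomorphic_ball continuous_intros) auto
  then show "\<exists>T\<subseteq>hemi. T homeomorphic ball (0 :: complex) 1" by blast
  show "\<not> (\<exists>T\<subseteq>hemi. T homeomorphic ball (0 :: complex \<times> real) 1)"
  proof
    assume "\<exists>T\<subseteq>hemi. T homeomorphic ball (0 :: complex \<times> real) 1"
    then obtain T where T: "T \<subseteq> hemi" "open T" "T \<noteq> {}"
      using homeomorphic_ball_imp_open by metis
    then obtain z \<zeta> where w: "(z, \<zeta>) \<in> T" by auto
    with T(2) obtain e where e: "e > 0" "ball (z, \<zeta>) e \<subseteq> T" by (meson openE)
    have "(z, \<zeta> + e / 2) \<in> T" using e by (auto simp: subset_iff dist_Pair_Pair dist_real_def)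
    with w T(1) have "(z, \<zeta>) \<in> hemi" "(z, \<zeta> + e / 2) \<in> hemi" by auto
    then have h: "(cmod (z - c))\<^sup>2 + \<zeta>\<^sup>2 = r\<^sup>2" "(cmod (z - c))\<^sup>2 + (\<zeta> + e / 2)\<^sup>2 = r\<^sup>2" "\<zeta> > 0"
      unfolding hemi_def height_def H3_def by simp_all
    then have "\<zeta>\<^sup>2 = (\<zeta> + e / 2)\<^sup>2" by linarith
    then show False using e(1) h(3) by (simp add: power2_eq_iff)
  qed
qed

lemma ideal_boundary_hemi: "ideal_boundary hemi = {Fin z | z. cmod (z - c) = r}"
proof -
  have closed: "closed {w. height w = r\<^sup>2}"
    unfolding height_def by (intro closed_Collect_eq continuous_intros)
  have 1: "cmod (z - c) = r" if "(z, 0) \<in> closure hemi" for z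
  proof -
    have "closure hemi \<subseteq> {w. height w = r\<^sup>2}"
      using closed by (intro closure_minimal) (auto simp: hemi_def)
    with that have "(cmod (z - c))\<^sup>2 = r\<^sup>2" by (auto simp: height_def)
    then show ?thesis using r_pos by (simp add: power2_eq_iff_nonneg)
  qed
  have 2: "(z, 0) \<in> closure hemi" if z: "cmod (z - c) = r" for z
  proof -
    \<comment> \<open>A path on the hemisphere above the radius from \<open>c\<close> to
      \<open>z\<close>, reaching \<open>z\<close> at \<open>s = 1\<close>.\<close>
    define \<phi> where "\<phi> = (\<lambda>s :: real. (c + s *\<^sub>R (z - c), r * sqrt (1 - s\<^sup>2)))"
    have "(\<phi> \<longlongrightarrow> (c + 1 *\<^sub>R (z - c), r * sqrt (1 - 1\<^sup>2))) (at_left 1)"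
      unfolding \<phi>_def by (intro tendsto_intros)
    then have lim: "(\<phi> \<longlongrightarrow> (z, 0)) (at_left 1)" by simp
    have "\<phi> s \<in> hemi" if "0 < s" "s < 1" for s
    proof -
      have s: "s\<^sup>2 < 1" using that by (simp add: power_less_one_iff)
      have "height (\<phi> s) = r\<^sup>2"
        using z s by (simp add: \<phi>_def height_def power_mult_distrib) (simp add: algebra_simps)
      then show ?thesis using s r_pos by (simp add: hemi_def H3_def \<phi>_def)
    qed
    then have "\<forall>\<^sub>F s in at_left 1. \<phi> s \<in> hemi"
      using eventually_at_left_real[of 0 "1 :: real"] by (auto elim: eventually_mono)
    then have "\<forall>\<^sub>F s in at_left 1. \<phi> s \<in> closure hemi"
      by (rule eventually_mono) (use closure_subset in blast)
    then show ?thesis using lim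
      by (rule Lim_in_closed_set[OF closed_closure _ trivial_limit_at_left_real])
  qed
  have "bounded hemi"
  proof (rule boundedI)
    fix w assume "w \<in> hemi"
    then have h: "(cmod (fst w - c))\<^sup>2 + (snd w)\<^sup>2 = r\<^sup>2" by (simp add: hemi_def height_def)
    have "w = (c, 0) + (fst w - c, snd w)" by (simp add: prod_eq_iff)
    then have "norm w \<le> norm (c, 0 :: real) + norm (fst w - c, snd w)" by (metis norm_triangle_ineq)
    also have "norm (fst w - c, snd w) = r" using h r_pos by (simp add: norm_Pair)
    finally show "norm w \<le> norm (c, 0 :: real) + r" .
  qed
  then show ?thesis using 1 2 by (auto simp: ideal_boundary_def)
qed

lemma klein_boundary: "cmod (z - c) = r \<Longrightarrow> klein (z, 0) = ((1 / r) *\<^sub>R (z - c), 0)"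
  using r_pos by (simp add: klein_def height_def power2_eq_square)

text \<open>In the ball \<open>P\<close> is an affine subspace \<open>A\<close>. As \<open>A\<close>
  is closed, it contains the ideal circle and with it the equatorial plane; it is not everything,
  since then \<open>P\<close> would be \<open>H3\<close>, which contains a 3-ball. So
  \<open>A\<close> is the equatorial plane.\<close>

lemma plane_unique:
  assumes P: "totally_geodesic P" "two_dimensional P"
    and ideal: "ideal_boundary P = {Fin z | z. cmod (z - c) = r}"
  shows "P = hemi"
proof -
  define A where "A = affine hull (klein ` P)"
  have aff: "affine A" by (simp add: A_def)
  have kP: "klein ` P = A \<inter> ball 0 1" unfolding A_def by (rule totally_geodesic_affine[OF P(1)])
  have PH: "P \<subseteq> H3" using P by (simp add: totally_geodesic_def)
  have circle: "(y, 0) \<in> A" if "norm y = 1" for y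
  proof -
    define z where "z = c + r *\<^sub>R y"
    have z: "cmod (z - c) = r" using that r_pos by (simp add: z_def)
    then have "Fin z \<in> ideal_boundary P" using ideal by blast
    then have "(z, 0) \<in> closure P" by (auto simp: ideal_boundary_def)
    moreover have "klein ` closure P \<subseteq> closure (klein ` P)"
      by (rule image_closure_subset[OF continuous_on_klein closed_closure closure_subset])
    moreover have "closure (klein ` P) \<subseteq> A"
      unfolding A_def by (rule closure_minimal[OF hull_subset closed_affine_hull])
    ultimately have "klein (z, 0) \<in> A" by blast
    then show ?thesis using r_pos unfolding klein_boundary[OF z] by (simp add: z_def)
  qed
  have zero: "(0, 0) \<in> A"
  proof -
    have "(1/2) *\<^sub>R (1 :: complex, 0 :: real) + (1/2) *\<^sub>R (- 1, 0) \<in> A"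
      using circle[of 1] circle[of "- 1"] by (intro mem_affine[OF aff]) auto
    then show ?thesis by simp
  qed
  have flat: "(y, 0) \<in> A" for y
  proof (cases "y = 0")
    case False
    have "(1 - norm y) *\<^sub>R (0 :: complex, 0 :: real) + norm y *\<^sub>R ((1 / norm y) *\<^sub>R y, 0) \<in> A"
      using circle[of "(1 / norm y) *\<^sub>R y"] False by (intro mem_affine[OF aff] zero) auto
    then show ?thesis using False by simp
  qed (use zero in simp)
  have no_ball: "A \<noteq> UNIV"
  proof
    assume "A = UNIV"
    then have "klein ` P = ball 0 1" using kP by simp
    have "w \<in> P" if w: "w \<in> H3" for w
    proof -
      obtain w' where "w' \<in> P" "klein w = klein w'"
        using klein_in_ball[OF w] \<open>klein ` P = ball 0 1\<close> by blast
      then show ?thesis using klein_inv_klein[OF w] klein_inv_klein[of w'] PH by auto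
    qed
    then have "P = H3" using PH by blast
    moreover have "ball ((0 :: complex), 1 :: real) 1 \<subseteq> H3"
    proof
      fix w assume "w \<in> ball ((0 :: complex), 1 :: real) 1"
      then have "dist 1 (snd w) < 1" using dist_snd_le[of "(0, 1)" w] by simp
      then show "w \<in> H3" by (auto simp: H3_def dist_real_def)
    qed
    moreover have "ball ((0 :: complex), 1 :: real) 1 homeomorphic ball (0 :: complex \<times> real) 1"
      by (intro homeomorphic_balls) auto
    ultimately show False using P(2) unfolding two_dimensional_def by blast
  qed
  have A_flat: "t = 0" if xt: "(x, t) \<in> A" for x t
  proof (rule ccontr)
    assume t: "t \<noteq> 0"
    have "(x', t') \<in> A" for x' t'
    proof -
      \<comment> \<open>The origin takes the weight \<open>- t' / t\<close>, so that the three
        weights sum to 1.\<close>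
      have "(t' / t) *\<^sub>R (x, t) + 1 *\<^sub>R (x' - (t' / t) *\<^sub>R x, 0) + (- t' / t) *\<^sub>R (0, 0) \<in> A"
        using flat xt zero by (intro mem_affine_3[OF aff]) auto
      then show ?thesis using t by simp
    qed
    then show False using no_ball by auto
  qed
  then have "A = {p. snd p = 0}" using flat by auto
  then have "klein ` P = {p \<in> ball 0 1. snd p = 0}" using kP by blast
  moreover have "klein ` hemi = {p \<in> ball 0 1. snd p = 0}"
  proof (intro equalityI subsetI)
    fix p assume p: "p \<in> {p \<in> ball (0 :: complex \<times> real) 1. snd p = 0}"
    then have "klein (klein_inv p) = p" "klein_inv p \<in> H3"
      using klein_klein_inv[of p] klein_inv_in_H3[of p] by auto
    moreover from this p have "klein_inv p \<in> hemi"
      using snd_klein_eq_0_iff[of "klein_inv p"] by (auto simp: hemi_def)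
    ultimately show "p \<in> klein ` hemi" by force
  next
    fix p assume "p \<in> klein ` hemi"
    then show "p \<in> {p \<in> ball 0 1. snd p = 0}"
      using klein_in_ball by (auto simp: hemi_def snd_klein_eq_0_iff simp del: mem_ball)
  qed
  ultimately have "klein ` P = klein ` hemi" by simp
  moreover have "inj_on klein H3" using klein_inv_klein by (rule inj_on_inverseI)
  ultimately show ?thesis
    using PH by (subst (asm) inj_on_image_eq_iff[of klein H3]) (auto simp: hemi_def)
qed

lemma form_plane_eq:
  assumes "form_circle f = {Fin z | z. cmod (z - c) = r}"
  shows "form_plane f = hemi"
  unfolding form_plane_def assms
proof (rule the_equality)
  show "totally_geodesic hemi \<and> two_dimensional hemi \<and>
      ideal_boundary hemi = {Fin z | z. cmod (z - c) = r}"
    by (intro conjI totally_geodesic_hemi two_dimensional_hemi ideal_boundary_hemi)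
qed (elim conjE, rule plane_unique)

text \<open>For \<open>q\<close> in the equatorial disc the inner product with
  \<open>klein w\<close> ignores the vertical part of \<open>klein w\<close>. So the hyperbolic
  cosine of the distance from \<open>w\<close> is a constant \<kappa> times that from
  \<open>q0\<close>, and the latter is least exactly at \<open>q0\<close>.\<close>

lemma nearest_point_hemi:
  assumes w: "w \<in> H3"
  shows "nearest_point hemi w = klein_inv (fst (klein w), 0)"
proof -
  define y where "y = fst (klein w)"
  define q0 where "q0 = klein_inv (y, 0)"
  have yb: "y \<in> ball 0 1"
    using klein_in_ball[OF w] norm_fst_le[of "fst (klein w)" "snd (klein w)"] by (auto simp: y_def)
  then have y0b: "(y, 0 :: real) \<in> ball 0 1" by (simp add: norm_Pair)
  have q0: "q0 \<in> hemi" unfolding q0_def by (rule klein_inv_flat_in_hemi[OF yb])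
  have kq0: "klein q0 = (y, 0)" unfolding q0_def by (rule klein_klein_inv[OF y0b])
  have HH: "q \<in> H3" if "q \<in> hemi" for q using that by (simp add: hemi_def)
  define \<kappa> where "\<kappa> = sqrt (1 - (norm (y, 0 :: real))\<^sup>2) / sqrt (1 - (norm (klein w))\<^sup>2)"
  have pos: "0 < 1 - (norm (klein w))\<^sup>2" "0 < 1 - (norm (y, 0 :: real))\<^sup>2"
    using one_minus_norm_pos[OF klein_in_ball[OF w]] one_minus_norm_pos[OF y0b] by auto
  then have \<kappa>: "\<kappa> > 0" by (simp add: \<kappa>_def)
  have split: "klein_cosh (klein w) (klein q) = \<kappa> * klein_cosh (klein q0) (klein q)" if "q \<in> hemi" for q
  proof -
    have "snd (klein q) = 0" using that by (simp add: hemi_def snd_klein_eq_0_iff)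
    then have "klein w \<bullet> klein q = (y, 0) \<bullet> klein q" by (simp add: inner_prod_def y_def)
    then show ?thesis unfolding klein_cosh_def kq0 \<kappa>_def using pos by simp
  qed
  have less: "hyp_dist w q0 < hyp_dist w q" if q: "q \<in> hemi" "q \<noteq> q0" for q
  proof -
    have "klein_cosh (klein q0) (klein q0) = 1"
      using pos unfolding kq0 klein_cosh_def by (simp add: dot_square_norm)
    moreover have "1 < klein_cosh (klein q0) (klein q)"
      using q HH q0 by (intro klein_cosh_ge_1(2)) auto
    ultimately have "klein_cosh (klein w) (klein q0) < klein_cosh (klein w) (klein q)"
      unfolding split[OF q0] split[OF q(1)] using \<kappa> by simp
    then show ?thesis
      unfolding hyp_dist_klein[OF w HH[OF q0]] hyp_dist_klein[OF w HH[OF q(1)]]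
      by (intro arcosh_real_strict_mono klein_cosh_ge_1(1) w HH q0)
  qed
  \<comment> \<open>\<open>arg_min_on\<close> is a choice; strict minimality determines its
    value.\<close>
  have "arg_min_on (hyp_dist w) hemi = q0"
    unfolding arg_min_on_def arg_min_def
  proof (rule some_equality)
    show "is_arg_min (hyp_dist w) (\<lambda>x. x \<in> hemi) q0"
      unfolding is_arg_min_def
    proof (intro conjI notI)
      assume "\<exists>q. q \<in> hemi \<and> hyp_dist w q < hyp_dist w q0"
      then obtain q where q: "q \<in> hemi" "hyp_dist w q < hyp_dist w q0" by blast
      then show False using less[of q] by (cases "q = q0") auto
    qed (rule q0)
    show "q = q0" if "is_arg_min (hyp_dist w) (\<lambda>x. x \<in> hemi) q" for q
      using that q0 less[of q] unfolding is_arg_min_def by blast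
  qed
  then show ?thesis by (simp add: nearest_point_def q0_def y_def)
qed

end

section \<open>Counting in the ring of integers\<close>

locale imaginary_quadratic =
  fixes D :: int
  assumes D_neg: "D < 0" and D_mod: "D mod 4 = 0 \<or> D mod 4 = 1"
begin

abbreviation "A \<equiv> quad_int D"

abbreviation "g \<equiv> quad_gen D"

text \<open>Bounds the points of the fundamental parallelogram spanned by 1 and \<open>g\<close>;
  the crude constants below are built from it.\<close>

definition L :: real where "L = 1 + cmod g"

lemma csqrt_D: "csqrt (of_int D) = \<i> * of_real (sqrt (- of_int D))"
  using D_neg by (subst csqrt_of_real_nonpos) auto

lemma Re_g: "Re g = of_int D / 2" and Im_g: "Im g = sqrt (- of_int D) / 2"
  by (simp_all add: quad_gen_def csqrt_D)

lemma Im_g_ge: "Im g \<ge> 1 / 2"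
proof -
  have "1 \<le> - real_of_int D" using D_neg by linarith
  then have "1 \<le> sqrt (- of_int D)" using real_le_rsqrt[of 1 "- real_of_int D"] by simp
  then show ?thesis by (simp add: Im_g)
qed

lemma L_ge_1: "L \<ge> 1" by (simp add: L_def)

text \<open>\<open>g\<close> has trace \<open>D\<close> and norm \<open>(D * D - D) / 4\<close>, an
  integer by the congruence on \<open>D\<close>; this makes the lattice a ring.\<close>

lemma g_square: "g * g = of_int D * g - of_int ((D * D - D) div 4)"
proof -
  have "4 dvd D * D - D"
  proof -
    have "D * D - D = D * (D - 1)" by (simp add: algebra_simps)
    moreover have "4 dvd D \<or> 4 dvd D - 1" using D_mod by presburger
    ultimately show ?thesis by (metis dvd_mult dvd_mult2)
  qed
  then have "real_of_int ((D * D - D) div 4) = (of_int D * of_int D - of_int D) / 4"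
    by (simp add: real_of_int_div)
  moreover have "sqrt (- real_of_int D) * sqrt (- of_int D) = - of_int D" using D_neg by simp
  ultimately show ?thesis
    by (simp add: complex_eq_iff Re_g Im_g field_simps)
qed

lemma cnj_g: "cnj g = of_int D - g"
  by (simp add: complex_eq_iff Re_g Im_g)

lemma A_I: "of_int m + of_int n * g \<in> A" by (auto simp: quad_int_def)

lemma A_int [simp]: "of_int m \<in> A" using A_I[of m 0] by simp

lemma A_of_nat [simp]: "of_nat m \<in> A" using A_int[of "int m"] by simp

lemma A_0 [simp]: "0 \<in> A" using A_int[of 0] by simp

lemma A_1 [simp]: "1 \<in> A" using A_int[of 1] by simp

lemma A_add: "x \<in> A \<Longrightarrow> y \<in> A \<Longrightarrow> x + y \<in> A"
proof -
  assume "x \<in> A" "y \<in> A"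
  then obtain m n m' n' where "x = of_int m + of_int n * g" "y = of_int m' + of_int n' * g"
    by (auto simp: quad_int_def)
  then have "x + y = of_int (m + m') + of_int (n + n') * g" by (simp add: algebra_simps)
  then show ?thesis by (simp only: A_I)
qed

lemma A_minus: "x \<in> A \<Longrightarrow> - x \<in> A"
proof -
  assume "x \<in> A"
  then obtain m n where "x = of_int m + of_int n * g" by (auto simp: quad_int_def)
  then have "- x = of_int (- m) + of_int (- n) * g" by (simp add: algebra_simps)
  then show ?thesis by (simp only: A_I)
qed

lemma A_diff: "x \<in> A \<Longrightarrow> y \<in> A \<Longrightarrow> x - y \<in> A"
  using A_add[of x "- y"] A_minus[of y] by simp

lemma A_mult: "x \<in> A \<Longrightarrow> y \<in> A \<Longrightarrow> x * y \<in> A"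
proof -
  assume "x \<in> A" "y \<in> A"
  then obtain m n m' n' where x: "x = of_int m + of_int n * g" and y: "y = of_int m' + of_int n' * g"
    by (auto simp: quad_int_def)
  define e where "e = (D * D - D) div 4"
  have "x * y = of_int m * of_int m' + (of_int m * of_int n' + of_int n * of_int m') * g
      + of_int n * of_int n' * (g * g)"
    by (simp add: x y algebra_simps)
  also have "\<dots> = of_int (m * m' - n * n' * e) + of_int (m * n' + n * m' + n * n' * D) * g"
    unfolding g_square e_def[symmetric] by (simp add: algebra_simps)
  finally show ?thesis by (simp only: A_I)
qed

lemma A_cnj: "x \<in> A \<Longrightarrow> cnj x \<in> A"
proof -
  assume "x \<in> A"
  then obtain m n where "x = of_int m + of_int n * g" by (auto simp: quad_int_def)
  then have "cnj x = of_int (m + n * D) + of_int (- n) * g" by (simp add: cnj_g algebra_simps)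
  then show ?thesis by (simp only: A_I)
qed

lemma A_norm_int: "x \<in> A \<Longrightarrow> \<exists>k::int. x * cnj x = of_int k"
proof -
  assume x: "x \<in> A"
  from A_mult[OF x A_cnj[OF x]] obtain m n where mn: "x * cnj x = of_int m + of_int n * g"
    by (auto simp: quad_int_def)
  have "Im (x * cnj x) = 0" by simp
  then have "of_int n * Im g = 0" unfolding mn by simp
  then have "n = 0" using Im_g_ge by auto
  with mn show ?thesis by auto
qed

text \<open>The bound 1/2 is that of \<open>Im_g_ge\<close>; it is the source of the factor 4 in
  \<open>cusp_dist_le\<close>.\<close>

lemma cmod_A_ge:
  assumes "x \<in> A" "x \<noteq> 0" shows "1 / 2 \<le> cmod x"
proof -
  obtain m n where x: "x = of_int m + of_int n * g" using assms by (auto simp: quad_int_def)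
  show ?thesis
  proof (cases "n = 0")
    case True
    then have "cmod x = of_int \<bar>m\<bar>" "m \<noteq> 0" using x assms(2) by auto
    then have "1 \<le> cmod x" by linarith
    then show ?thesis by simp
  next
    case False
    then have "1 \<le> \<bar>n\<bar>" by simp
    then have "1 \<le> real_of_int \<bar>n\<bar>" by linarith
    then have "1 / 2 \<le> real_of_int \<bar>n\<bar> * Im g" using Im_g_ge mult_mono[of 1 "real_of_int \<bar>n\<bar>" "1/2" "Im g"] by simp
    also have "\<dots> = \<bar>Im x\<bar>" using Im_g_ge by (simp add: x abs_mult)
    also have "\<dots> \<le> cmod x" by (rule abs_Im_le_cmod)
    finally show ?thesis .
  qed
qed

lemma lattice_coords_inj:
  assumes "of_int m + of_int n * g = of_int m' + of_int n' * g" shows "m = m' \<and> n = n'"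
proof -
  from assms have "Im (of_int m + of_int n * g) = Im (of_int m' + of_int n' * g)" by simp
  then have "n = n'" using Im_g_ge by simp
  with assms show ?thesis by simp
qed

section \<open>Counting lattice points and division with remainder\<close>

definition disc :: "real \<Rightarrow> complex set" where
  "disc R = {x \<in> A. cmod x \<le> R}"

text \<open>Both lattice coordinates are at most \<open>2 * L * R\<close> in absolute value. That
  number is at least 1, so \<open>2 * k + 1\<close> is at most \<open>6 * L * R\<close>; squaring
  gives 36.\<close>

lemma disc_card:
  assumes R: "R \<ge> 1 / 2"
  shows "finite (disc R)" "real (card (disc R)) \<le> 36 * L\<^sup>2 * R\<^sup>2"
proof -
  define k where "k = \<lfloor>2 * L * R\<rfloor>"
  have LR: "1 \<le> 2 * L * R" using mult_mono[OF L_ge_1 R] L_ge_1 by simp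
  have sub: "disc R \<subseteq> (\<lambda>(m, n). of_int m + of_int n * g) ` ({- k..k} \<times> {- k..k})"
  proof
    fix x assume x: "x \<in> disc R"
    then obtain m n where mn: "x = of_int m + of_int n * g" by (auto simp: disc_def quad_int_def)
    have xR: "cmod x \<le> R" using x by (simp add: disc_def)
    have "\<bar>of_int n\<bar> * (1 / 2) \<le> \<bar>of_int n\<bar> * Im g" using Im_g_ge by (intro mult_left_mono) auto
    also have "\<dots> = \<bar>Im x\<bar>" using Im_g_ge by (simp add: mn abs_mult)
    also have "\<dots> \<le> R" using abs_Im_le_cmod[of x] xR by linarith
    finally have n: "\<bar>real_of_int n\<bar> \<le> 2 * R" by simp
    have "\<bar>real_of_int m\<bar> = cmod (x - of_int n * g)" by (simp add: mn)
    also have "\<dots> \<le> cmod x + \<bar>of_int n\<bar> * cmod g"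
      using norm_triangle_ineq4[of x "of_int n * g"] by (simp add: norm_mult)
    also have "\<dots> \<le> R + 2 * R * cmod g" using xR n by (intro add_mono mult_right_mono) auto
    also have "\<dots> \<le> 2 * L * R" using R by (simp add: L_def algebra_simps)
    finally have "\<bar>real_of_int m\<bar> \<le> 2 * L * R" .
    moreover have "2 * R \<le> 2 * L * R" using L_ge_1 R by simp
    ultimately have "\<bar>m\<bar> \<le> k" "\<bar>n\<bar> \<le> k" using n unfolding k_def by (simp_all add: le_floor_iff)
    then show "x \<in> (\<lambda>(m, n). of_int m + of_int n * g) ` ({- k..k} \<times> {- k..k})"
      using mn by (auto intro!: image_eqI[of _ _ "(m, n)"])
  qed
  then show "finite (disc R)" by (rule finite_subset) auto
  have "card (disc R) \<le> card ({- k..k} \<times> {- k..k})"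
    using sub by (intro surj_card_le) auto
  also have "\<dots> = nat (2 * k + 1) * nat (2 * k + 1)" by (simp add: card_cartesian_product)
  finally have card: "real (card (disc R)) \<le> real (nat (2 * k + 1)) * real (nat (2 * k + 1))"
    by (metis of_nat_le_iff of_nat_mult)
  have k0: "real (nat (2 * k + 1)) \<le> 6 * L * R"
  proof -
    have "real_of_int k \<le> 2 * L * R" unfolding k_def by linarith
    moreover have "0 \<le> k" unfolding k_def using LR by linarith
    ultimately show ?thesis using LR by simp
  qed
  have "0 \<le> L * R" using L_ge_1 R by simp
  then have "real (nat (2 * k + 1)) * real (nat (2 * k + 1)) \<le> (6 * L * R) * (6 * L * R)"
    using k0 by (intro mult_mono) (auto simp: mult.commute)
  with card show "real (card (disc R)) \<le> 36 * L\<^sup>2 * R\<^sup>2" by (simp add: power2_eq_square algebra_simps)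
qed

lemma real_coords:
  obtains s t :: real where "z = of_real s + of_real t * g"
proof -
  have "z = of_real (Re z - Im z / Im g * Re g) + of_real (Im z / Im g) * g"
    using Im_g_ge by (simp add: complex_eq_iff)
  then show thesis by (rule that)
qed

text \<open>Division with remainder by \<open>x\<close>: round down the lattice coordinates of
  \<open>z / x\<close>.\<close>

lemma reduce:
  assumes "x \<noteq> 0" obtains a where "a \<in> A" "cmod (z - x * a) \<le> L * cmod x"
proof -
  obtain s t where st: "z / x = of_real s + of_real t * g" by (rule real_coords)
  define a where "a = of_int \<lfloor>s\<rfloor> + of_int \<lfloor>t\<rfloor> * g"
  have "z - x * a = x * (z / x - a)" using assms by (simp add: algebra_simps)
  also have "z / x - a = of_real (frac s) + of_real (frac t) * g"
    unfolding st by (simp add: a_def frac_def algebra_simps)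
  finally have "cmod (z - x * a) = cmod x * cmod (of_real (frac s) + of_real (frac t) * g)"
    by (simp add: norm_mult)
  moreover have "cmod (of_real (frac s) + of_real (frac t) * g) \<le> frac s + frac t * cmod g"
    using norm_triangle_ineq[of "of_real (frac s)" "of_real (frac t) * g"] by (simp add: norm_mult)
  moreover have "frac s + frac t * cmod g \<le> L"
    unfolding L_def using frac_lt_1[of s] frac_lt_1[of t] mult_right_mono[of "frac t" 1 "cmod g"] by simp
  ultimately have "cmod (z - x * a) \<le> L * cmod x"
    using mult_left_mono[of "cmod (of_real (frac s) + of_real (frac t) * g)" L "cmod x"]
    by (simp add: mult.commute)
  moreover have "a \<in> A" unfolding a_def by (rule A_I)
  ultimately show thesis by (intro that)
qed

section \<open>Ideals\<close>

definition is_ideal :: "complex set \<Rightarrow> bool" where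
  "is_ideal J \<longleftrightarrow> J \<subseteq> A \<and> 0 \<in> J \<and> (\<forall>x\<in>J. \<forall>y\<in>J. x - y \<in> J) \<and> (\<forall>x\<in>A. \<forall>y\<in>J. x * y \<in> J)"

definition congr :: "complex set \<Rightarrow> (complex \<times> complex) set" where
  "congr J = {(x, y). x \<in> A \<and> y \<in> A \<and> x - y \<in> J}"

lemma ideal_norm_eq: "ideal_norm D J = card (A // congr J)"
  by (simp add: ideal_norm_def congr_def)

lemma is_ideal_minus: "is_ideal J \<Longrightarrow> x \<in> J \<Longrightarrow> - x \<in> J"
  unfolding is_ideal_def by (metis diff_0)

lemma is_ideal_add: "is_ideal J \<Longrightarrow> x \<in> J \<Longrightarrow> y \<in> J \<Longrightarrow> x + y \<in> J"
  using is_ideal_minus[of J y] unfolding is_ideal_def by (metis diff_minus_eq_add)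

lemma is_ideal_gen2:
  assumes "a \<in> A" "b \<in> A" shows "is_ideal (ideal_gen2 D a b)"
  unfolding is_ideal_def
proof (intro conjI ballI subsetI)
  show "x \<in> A" if "x \<in> ideal_gen2 D a b" for x
    using that assms by (auto simp: ideal_gen2_def intro!: A_add A_mult)
  show "0 \<in> ideal_gen2 D a b"
    unfolding ideal_gen2_def by (intro CollectI exI[of _ 0]) simp
  show "x - y \<in> ideal_gen2 D a b" if "x \<in> ideal_gen2 D a b" "y \<in> ideal_gen2 D a b" for x y
  proof -
    from that obtain u v u' v' where "x = a * u + b * v" "y = a * u' + b * v'"
      and in_A: "u \<in> A" "v \<in> A" "u' \<in> A" "v' \<in> A" by (auto simp: ideal_gen2_def)
    then have "x - y = a * (u - u') + b * (v - v')" by (simp add: algebra_simps)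
    then show ?thesis using in_A A_diff unfolding ideal_gen2_def by blast
  qed
  show "x * y \<in> ideal_gen2 D a b" if "x \<in> A" "y \<in> ideal_gen2 D a b" for x y
  proof -
    from that obtain u v where "y = a * u + b * v" and in_A: "u \<in> A" "v \<in> A"
      by (auto simp: ideal_gen2_def)
    then have "x * y = a * (x * u) + b * (x * v)" by (simp add: algebra_simps)
    then show ?thesis using in_A that(1) A_mult unfolding ideal_gen2_def by blast
  qed
qed

lemma gen2_mem: "a \<in> ideal_gen2 D a b" "b \<in> ideal_gen2 D a b"
proof -
  have "a = a * 1 + b * 0" "b = a * 0 + b * 1" by auto
  then show "a \<in> ideal_gen2 D a b" "b \<in> ideal_gen2 D a b"
    unfolding ideal_gen2_def using A_0 A_1 by blast+
qed

lemma equiv_congr: "is_ideal J \<Longrightarrow> equiv A (congr J)"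
proof (rule equivI)
  assume J: "is_ideal J"
  show "congr J \<subseteq> A \<times> A" by (auto simp: congr_def)
  show "refl_on A (congr J)" using J by (auto simp: refl_on_def congr_def is_ideal_def)
  show "sym (congr J)"
    using is_ideal_minus[OF J] by (fastforce simp: sym_def congr_def)
  show "trans (congr J)"
  proof (rule transI)
    fix x y z assume "(x, y) \<in> congr J" "(y, z) \<in> congr J"
    then show "(x, z) \<in> congr J" using is_ideal_add[OF J, of "x - y" "y - z"] by (auto simp: congr_def)
  qed
qed

text \<open>Every class has a representative in a disc, namely a remainder modulo the single element
  \<open>x\<close>.\<close>

lemma finite_quotient:
  assumes J: "is_ideal J" and x: "x \<in> J" "x \<noteq> 0"
  shows "finite (A // congr J)"
proof -
  have xA: "x \<in> A" using J x by (auto simp: is_ideal_def)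
  have ge: "L * cmod x \<ge> 1 / 2"
    using mult_mono[OF L_ge_1 cmod_A_ge[OF xA x(2)]] L_ge_1 by simp
  have "A // congr J \<subseteq> (\<lambda>z. congr J `` {z}) ` disc (L * cmod x)"
  proof
    fix X assume "X \<in> A // congr J"
    then obtain z where z: "z \<in> A" "X = congr J `` {z}" by (auto elim: quotientE)
    obtain a where a: "a \<in> A" "cmod (z - x * a) \<le> L * cmod x" using reduce[OF x(2)] by blast
    have "z - x * a \<in> disc (L * cmod x)" using a z xA by (auto simp: disc_def intro!: A_diff A_mult)
    moreover have "(z, z - x * a) \<in> congr J"
      using J a z xA x by (auto simp: congr_def is_ideal_def mult.commute intro!: A_diff A_mult)
    then have "X = congr J `` {z - x * a}"
      using equiv_class_eq[OF equiv_congr[OF J]] z by blast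
    ultimately show "X \<in> (\<lambda>z. congr J `` {z}) ` disc (L * cmod x)" by blast
  qed
  then show ?thesis using disc_card(1)[OF ge] by (rule finite_subset[OF _ finite_imageI])
qed

text \<open>Finiteness enters because \<open>card\<close> of an infinite quotient would be 0. With
  \<open>representatives\<close>, ideal norms become accessible by counting incongruent
  elements.\<close>

lemma card_le_ideal_norm:
  assumes J: "is_ideal J" and fin: "finite (A // congr J)" and S: "S \<subseteq> A"
    and indep: "\<And>x y. x \<in> S \<Longrightarrow> y \<in> S \<Longrightarrow> x - y \<in> J \<Longrightarrow> x = y"
  shows "card S \<le> ideal_norm D J"
  unfolding ideal_norm_eq
proof (rule card_inj_on_le[OF _ _ fin])
  show "inj_on (\<lambda>x. congr J `` {x}) S"
  proof (rule inj_onI)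
    fix x y assume xy: "x \<in> S" "y \<in> S" "congr J `` {x} = congr J `` {y}"
    then have "(x, y) \<in> congr J" using eq_equiv_class[OF _ equiv_congr[OF J]] S by blast
    then show "x = y" using xy indep by (auto simp: congr_def)
  qed
  show "(\<lambda>x. congr J `` {x}) ` S \<subseteq> A // congr J" using S by (auto intro: quotientI)
qed

lemma representatives:
  assumes J: "is_ideal J"
  obtains S where "S \<subseteq> A" "card S = ideal_norm D J"
    "\<And>x y. x \<in> S \<Longrightarrow> y \<in> S \<Longrightarrow> x - y \<in> J \<Longrightarrow> x = y"
proof -
  define r where "r = (\<lambda>X. SOME x. x \<in> (X :: complex set))"
  have r: "r X \<in> X" if "X \<in> A // congr J" for X
    using in_quotient_imp_non_empty[OF equiv_congr[OF J] that] unfolding r_def by (simp add: some_in_eq)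
  have sub: "X \<subseteq> A" if "X \<in> A // congr J" for X
    using in_quotient_imp_subset[OF equiv_congr[OF J] that] .
  have eq: "X = Y" if "X \<in> A // congr J" "Y \<in> A // congr J" "r X - r Y \<in> J" for X Y
  proof -
    have "(r X, r Y) \<in> congr J" using that r sub by (auto simp: congr_def)
    then show ?thesis using quotient_eqI[OF equiv_congr[OF J] that(1,2) r[OF that(1)] r[OF that(2)]] by simp
  qed
  show thesis
  proof (rule that)
    show "r ` (A // congr J) \<subseteq> A" using r sub by blast
    have "inj_on r (A // congr J)"
      using eq J by (intro inj_onI) (simp add: is_ideal_def)
    then show "card (r ` (A // congr J)) = ideal_norm D J"
      unfolding ideal_norm_eq by (rule card_image)
    show "x = y" if "x \<in> r ` (A // congr J)" "y \<in> r ` (A // congr J)" "x - y \<in> J" for x y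
      using that eq by blast
  qed
qed

text \<open>Two of the \<open>K * K\<close> lattice points with coordinates below \<open>K\<close>
  are congruent modulo \<open>J\<close>; they differ by at most \<open>K - 1\<close> in each
  coordinate.\<close>

lemma box_pigeonhole:
  assumes J: "is_ideal J" and fin: "finite (A // congr J)" and K: "ideal_norm D J < K * K"
  obtains x where "x \<in> J" "x \<noteq> 0" "cmod x \<le> (real K - 1) * L"
proof -
  define h where "h = (\<lambda>(m, n). of_nat m + of_nat n * g :: complex)"
  define S where "S = h ` ({..<K} \<times> {..<K})"
  have "inj_on h ({..<K} \<times> {..<K})"
  proof (rule inj_onI, clarsimp simp: h_def)
    fix m n m' n' assume "of_nat m + of_nat n * g = of_nat m' + of_nat n' * g"
    then show "m = m' \<and> n = n'" using lattice_coords_inj[of "int m" "int n" "int m'" "int n'"] by simp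
  qed
  then have cS: "card S = K * K" unfolding S_def by (simp add: card_image card_cartesian_product)
  have SA: "S \<subseteq> A"
  proof
    fix x assume "x \<in> S"
    then obtain m n where "x = of_int (int m) + of_int (int n) * g" by (auto simp: S_def h_def)
    then show "x \<in> A" by (simp only: A_I)
  qed
  have "\<exists>x\<in>S. \<exists>y\<in>S. x - y \<in> J \<and> x \<noteq> y"
    using card_le_ideal_norm[OF J fin SA] K cS by fastforce
  then obtain x y where xy: "x \<in> S" "y \<in> S" "x - y \<in> J" "x \<noteq> y" by blast
  then obtain m n m' n' where mn: "x = of_nat m + of_nat n * g" "y = of_nat m' + of_nat n' * g"
    and lt: "m < K" "n < K" "m' < K" "n' < K" by (auto simp: S_def h_def)
  have "x - y = of_real (real m - real m') + of_real (real n - real n') * g"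
    by (simp add: mn algebra_simps)
  then have "cmod (x - y) \<le> \<bar>real m - real m'\<bar> + \<bar>real n - real n'\<bar> * cmod g"
    using norm_triangle_ineq[of "of_real (real m - real m')" "of_real (real n - real n') * g"]
    by (simp only: norm_mult norm_of_real)
  also have "\<dots> \<le> (real K - 1) + (real K - 1) * cmod g"
    using lt by (intro add_mono mult_right_mono) auto
  finally have "cmod (x - y) \<le> (real K - 1) * L" by (simp add: L_def algebra_simps)
  then show thesis using xy by (intro that[of "x - y"]) auto
qed

lemma ideal_norm_pos:
  assumes J: "is_ideal J" and fin: "finite (A // congr J)" shows "0 < ideal_norm D J"
proof -
  have "card {0 :: complex} \<le> ideal_norm D J"
    by (rule card_le_ideal_norm[OF J fin]) auto
  then show ?thesis by simp
qed

text \<open>Otherwise \<open>box_pigeonhole\<close>, with \<open>K\<close> the ceiling of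
  \<open>e / L\<close>, yields a non-zero element of length below \<open>e\<close>.\<close>

lemma ideal_norm_ge:
  assumes J: "is_ideal J" and fin: "finite (A // congr J)" and e: "0 \<le> e"
    and sep: "\<And>x. x \<in> J \<Longrightarrow> x \<noteq> 0 \<Longrightarrow> e \<le> cmod x"
  shows "(e / L)\<^sup>2 \<le> real (ideal_norm D J)"
proof -
  define K where "K = nat \<lceil>e / L\<rceil>"
  have eL: "0 \<le> e / L" using e L_ge_1 by simp
  have K: "e / L \<le> real K" unfolding K_def by (rule real_nat_ceiling_ge)
  have K1: "(real K - 1) * L < e" if "K \<noteq> 0"
  proof -
    have "real K = of_int \<lceil>e / L\<rceil>" using that unfolding K_def by (simp add: of_nat_nat)
    then have "real K - 1 < e / L" by linarith
    then show ?thesis using L_ge_1 by (simp add: field_simps)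
  qed
  have "K * K \<le> ideal_norm D J"
  proof (rule ccontr)
    assume "\<not> K * K \<le> ideal_norm D J"
    then have lt: "ideal_norm D J < K * K" by simp
    obtain x where "x \<in> J" "x \<noteq> 0" "cmod x \<le> (real K - 1) * L"
      by (rule box_pigeonhole[OF J fin lt])
    moreover have "K \<noteq> 0" using lt by (cases K) auto
    ultimately show False using sep[of x] K1 by linarith
  qed
  then have "real K * real K \<le> real (ideal_norm D J)" by (metis of_nat_le_iff of_nat_mult)
  moreover have "(e / L)\<^sup>2 \<le> real K * real K"
    unfolding power2_eq_square using K eL by (intro mult_mono) auto
  ultimately show ?thesis by linarith
qed

lemma short_element:
  assumes J: "is_ideal J" and fin: "finite (A // congr J)"
  obtains x where "x \<in> J" "x \<noteq> 0" "(cmod x)\<^sup>2 \<le> L\<^sup>2 * real (ideal_norm D J)"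
proof -
  define N where "N = ideal_norm D J"
  \<comment> \<open>The least \<open>K\<close> with \<open>N < K * K\<close>. As
    \<open>K - 1\<close> does not exceed \<open>sqrt N\<close>, the off-by-one in
    \<open>box_pigeonhole\<close> leaves \<open>L\<^sup>2\<close> as the only constant.\<close>
  define K where "K = nat \<lfloor>sqrt (real N)\<rfloor> + 1"
  have K: "sqrt (real N) < real K" "real K - 1 \<le> sqrt (real N)" 
    using of_nat_floor[OF real_sqrt_ge_zero[OF of_nat_0_le_iff[of N]]] unfolding K_def
    by (linarith, simp)
  have "real N = sqrt (real N) * sqrt (real N)" by simp
  also have "\<dots> < real K * real K" using K by (intro mult_strict_mono') auto
  finally have "N < K * K" by (metis of_nat_less_iff of_nat_mult)
  then obtain x where x: "x \<in> J" "x \<noteq> 0" "cmod x \<le> (real K - 1) * L"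
    using box_pigeonhole[OF J fin] unfolding N_def by blast
  have "cmod x \<le> sqrt (real N) * L" using x(3) K(2) L_ge_1 mult_right_mono[of "real K - 1" "sqrt (real N)" L] by linarith
  then have "(cmod x)\<^sup>2 \<le> (sqrt (real N) * L)\<^sup>2" by (intro power_mono) auto
  also have "\<dots> = L\<^sup>2 * real N" by (simp add: power_mult_distrib)
  finally show thesis using x by (intro that) (auto simp: N_def)
qed

text \<open>Stands in for \<open>N(x) = [A : J] [J : xA]\<close>. With \<open>s\<close> running over
  representatives modulo \<open>J\<close> and \<open>j\<close> from 0 to \<open>M\<close>, the
  elements \<open>s + j y\<close> are pairwise incongruent modulo \<open>xA\<close>. Their
  remainders are thus distinct lattice points in a disc of radius \<open>L |x|\<close>, which
  \<open>disc_card\<close> counts.\<close>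

lemma index_bound:
  assumes J: "is_ideal J" and x: "x \<in> J" "x \<noteq> 0" and y: "y \<in> J"
    and indep: "\<And>j :: nat. 0 < j \<Longrightarrow> j \<le> M \<Longrightarrow> \<not> (\<exists>a\<in>A. of_nat j * y = x * a)"
  shows "real (M + 1) * real (ideal_norm D J) \<le> 36 * L ^ 4 * (cmod x)\<^sup>2"
proof -
  have JA: "J \<subseteq> A" using J by (simp add: is_ideal_def)
  have xA: "x \<in> A" and yA: "y \<in> A" using JA x y by auto
  obtain S where S: "S \<subseteq> A" "card S = ideal_norm D J"
    and Sind: "\<And>x y. x \<in> S \<Longrightarrow> y \<in> S \<Longrightarrow> x - y \<in> J \<Longrightarrow> x = y"
    using representatives[OF J] by blast
  define red where "red = (\<lambda>z. z - x * (SOME a. a \<in> A \<and> cmod (z - x * a) \<le> L * cmod x))"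
  have red: "\<exists>a\<in>A. z - red z = x * a" "cmod (red z) \<le> L * cmod x" for z
  proof -
    have "\<exists>a. a \<in> A \<and> cmod (z - x * a) \<le> L * cmod x" using reduce[OF x(2)] by metis
    from someI_ex[OF this] show "\<exists>a\<in>A. z - red z = x * a" "cmod (red z) \<le> L * cmod x"
      by (auto simp: red_def)
  qed
  define \<phi> where "\<phi> = (\<lambda>(s, j :: nat). red (s + of_nat j * y))"
  have no: False if "j' < j" "j \<le> M" "a \<in> A" "of_nat j * y - of_nat j' * y = x * a" for j j' a
    using indep[of "j - j'"] that by (auto simp: of_nat_diff algebra_simps)
  have "inj_on \<phi> (S \<times> {..M})"
  proof (rule inj_onI, clarify)
    fix s j s' j' assume s: "s \<in> S" "s' \<in> S" and j: "j \<le> M" "j' \<le> M" and eq: "\<phi> (s, j) = \<phi> (s', j')"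
    obtain a a' where a: "a \<in> A" "s + of_nat j * y - \<phi> (s, j) = x * a"
      and a': "a' \<in> A" "s' + of_nat j' * y - \<phi> (s', j') = x * a'"
      using red(1) unfolding \<phi>_def by auto metis
    define d where "d = a - a'"
    have dA: "d \<in> A" using a a' A_diff by (simp add: d_def)
    have diff: "s - s' + (of_nat j * y - of_nat j' * y) = x * d"
      using a(2) a'(2) eq by (simp add: d_def algebra_simps) 
    \<comment> \<open>As \<open>x\<close> and \<open>y\<close> are in \<open>J\<close>, so is
      \<open>s - s'\<close>, whence \<open>s = s'\<close>; independence of the multiples of
      \<open>y\<close> then gives \<open>j = j'\<close>.\<close>
    have "s - s' = d * x + (of_nat j' * y - of_nat j * y)" using diff by (simp add: algebra_simps)
    moreover have "d * x + (of_nat j' * y - of_nat j * y) \<in> J"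
      using J dA x y is_ideal_add[OF J] unfolding is_ideal_def by (metis A_of_nat)
    ultimately have ss: "s = s'" using Sind s by auto
    then have 1: "of_nat j * y - of_nat j' * y = x * d" using diff by simp
    then have 2: "of_nat j' * y - of_nat j * y = x * (- d)" by (simp add: algebra_simps)
    show "s = s' \<and> j = j'"
      using ss no[OF _ j(1) dA 1] no[OF _ j(2) A_minus[OF dA] 2] by (cases j j' rule: linorder_cases) auto
  qed
  moreover have "\<phi> ` (S \<times> {..M}) \<subseteq> disc (L * cmod x)"
  proof clarify
    fix s j assume s: "s \<in> S"
    obtain a where "a \<in> A" "s + of_nat j * y - \<phi> (s, j) = x * a"
      using red(1)[of "s + of_nat j * y"] by (auto simp: \<phi>_def)
    then have "\<phi> (s, j) = s + of_nat j * y - x * a" by (simp add: algebra_simps)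
    also have "\<dots> \<in> A" using s S \<open>a \<in> A\<close> xA yA by (intro A_diff A_add A_mult) auto
    finally show "\<phi> (s, j) \<in> disc (L * cmod x)" using red(2) by (simp add: disc_def \<phi>_def)
  qed
  moreover have ge: "L * cmod x \<ge> 1 / 2"
    using mult_mono[OF L_ge_1 cmod_A_ge[OF xA x(2)]] L_ge_1 by simp
  ultimately have "card (S \<times> {..M}) \<le> card (disc (L * cmod x))"
    using disc_card(1) by (intro card_inj_on_le) auto
  then have "real (card (S \<times> {..M})) \<le> 36 * L\<^sup>2 * (L * cmod x)\<^sup>2"
    using disc_card(2)[OF ge] by linarith
  then show ?thesis using S(2)
    by (simp add: card_cartesian_product power_mult_distrib algebra_simps flip: power_add)
qed

end

section \<open>Cusps\<close>

text \<open>
  The binary hermitian form of determinant 1 attached to a point of \<^const>\<open>H3\<close>; up to the norm of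
  an ideal, \<^const>\<open>cusp_dist\<close> is its value at a fraction representing the cusp.
\<close>

definition point_form :: "complex \<times> real \<Rightarrow> complex \<Rightarrow> complex \<Rightarrow> real" where
  "point_form w a b = ((cmod (a - b * fst w))\<^sup>2 + (cmod b)\<^sup>2 * (snd w)\<^sup>2) / snd w"

lemma point_form_scale: "point_form w (t * a) (t * b) = (cmod t)\<^sup>2 * point_form w a b"
proof -
  have "cmod (t * a - t * b * fst w) = cmod t * cmod (a - b * fst w)"
    by (simp add: algebra_simps flip: norm_mult)
  then show ?thesis
    by (simp add: point_form_def norm_mult power_mult_distrib algebra_simps add_divide_distrib)
qed

lemma herm_form_scale: "herm_form p q \<nu> (t * x) (t * y) = (cmod t)\<^sup>2 * herm_form p q \<nu> x y"
proof -
  have scale: "Re (of_real k * u) = k * Re u" for k u by simp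
  have tt: "t * cnj t = of_real ((cmod t)\<^sup>2)" using complex_norm_square[of t] by simp
  have "\<nu> * (t * x) * cnj (t * y) + cnj \<nu> * cnj (t * x) * (t * y) =
      (t * cnj t) * (\<nu> * x * cnj y + cnj \<nu> * cnj x * y)"
    by (simp add: algebra_simps)
  also have "Re \<dots> = (cmod t)\<^sup>2 * Re (\<nu> * x * cnj y + cnj \<nu> * cnj x * y)"
    unfolding tt by (rule scale)
  finally show ?thesis
    by (simp add: herm_form_def Nm_def norm_mult power_mult_distrib algebra_simps)
qed

context imaginary_quadratic
begin

text \<open>\<open>aA + bA\<close> need not be principal, so the fraction cannot be reduced by a
  generator. Instead take a short \<open>x\<close> in the ideal: every element has a multiple by
  some positive \<open>j \<le> M\<close> in \<open>xA\<close>, hence \<open>fact M\<close> times the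
  ideal lies in \<open>xA\<close>, and \<open>x / fact M\<close> divides \<open>a\<close> and
  \<open>b\<close> in \<open>A\<close>.\<close>

lemma fraction_bounded:
  obtains c where "c > 0" and
    "\<And>a b. a \<in> A \<Longrightarrow> b \<in> A \<Longrightarrow> (a, b) \<noteq> (0, 0) \<Longrightarrow>
      \<exists>a' b' t. a' \<in> A \<and> b' \<in> A \<and> a = t * a' \<and> b = t * b' \<and>
        c \<le> (cmod t)\<^sup>2 / real (ideal_norm D (ideal_gen2 D a b))"
proof -
  \<comment> \<open>The bound \<open>36 * L ^ 4 * (cmod x)\<^sup>2\<close> of
    \<open>index_bound\<close> combined with \<open>L\<^sup>2 * N\<close> from
    \<open>short_element\<close>.\<close>
  define M where "M = nat \<lceil>36 * L ^ 6\<rceil>"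
  define c where "c = 1 / (36 * L ^ 4 * (fact M)\<^sup>2)"
  have L0: "0 < L" using L_ge_1 by simp
  have "\<exists>a' b' t. a' \<in> A \<and> b' \<in> A \<and> a = t * a' \<and> b = t * b' \<and>
        c \<le> (cmod t)\<^sup>2 / real (ideal_norm D (ideal_gen2 D a b))"
    if ab: "a \<in> A" "b \<in> A" "(a, b) \<noteq> (0, 0)" for a b
  proof -
    define J where "J = ideal_gen2 D a b"
    define N where "N = ideal_norm D J"
    have J: "is_ideal J" unfolding J_def by (rule is_ideal_gen2[OF ab(1,2)])
    have mem: "a \<in> J" "b \<in> J" unfolding J_def by (rule gen2_mem)+
    have fin: "finite (A // congr J)"
      using finite_quotient[OF J mem(1)] finite_quotient[OF J mem(2)] ab(3) by auto
    have N: "N > 0" unfolding N_def by (rule ideal_norm_pos[OF J fin])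
    obtain x where x: "x \<in> J" "x \<noteq> 0" "(cmod x)\<^sup>2 \<le> L\<^sup>2 * real N"
      using short_element[OF J fin] unfolding N_def by blast
    have torsion: "\<exists>j::nat. 0 < j \<and> j \<le> M \<and> (\<exists>a\<in>A. of_nat j * y = x * a)" if y: "y \<in> J" for y
    proof (rule ccontr)
      assume "\<not> ?thesis"
      then have "real (M + 1) * real N \<le> 36 * L ^ 4 * (cmod x)\<^sup>2"
        unfolding N_def by (intro index_bound[OF J x(1,2) y]) blast
      also have "\<dots> \<le> 36 * L ^ 4 * (L\<^sup>2 * real N)" using x(3) L0 by (intro mult_left_mono) auto
      also have "\<dots> = 36 * L ^ 6 * real N" by (simp add: power_add[symmetric] algebra_simps)
      finally have "real (M + 1) \<le> 36 * L ^ 6" using N by simp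
      moreover have "36 * L ^ 6 \<le> real M" unfolding M_def by (rule real_nat_ceiling_ge)
      ultimately show False by simp
    qed
    have div: "\<exists>a\<in>A. fact M * y = x * a" if y: "y \<in> J" for y
    proof -
      obtain j a where j: "0 < j" "j \<le> M" "a \<in> A" "of_nat j * y = x * a" using torsion[OF y] by blast
      then have "j dvd fact M" by (intro dvd_fact) auto
      then obtain k where k: "fact M = j * k" by (rule dvdE)
      have "fact M * y = of_nat (fact M) * y" by simp
      also have "\<dots> = of_nat k * (of_nat j * y)" unfolding k by simp
      also have "\<dots> = x * (of_nat k * a)" unfolding j(4) by simp
      finally show ?thesis using A_mult[OF A_of_nat j(3)] by blast
    qed
    obtain a' where a': "a' \<in> A" "fact M * a = x * a'" using div[OF mem(1)] by blast
    obtain b' where b': "b' \<in> A" "fact M * b = x * b'" using div[OF mem(2)] by blast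
    define t where "t = x / fact M"
    have eq: "a = t * a'" "b = t * b'" using a'(2) b'(2) by (simp_all add: t_def field_simps)
    \<comment> \<open>The case \<open>M = 0\<close> of \<open>index_bound\<close>, whose
      independence condition is empty: a lower bound for \<open>cmod x\<close>, and the origin of
      \<open>c\<close>.\<close>
    have "real N \<le> 36 * L ^ 4 * (cmod x)\<^sup>2"
      using index_bound[OF J x(1,2) x(1), of 0] by (simp add: N_def)
    then have "c * real N \<le> c * (36 * L ^ 4 * (cmod x)\<^sup>2)"
      using L0 by (intro mult_left_mono) (auto simp: c_def)
    also have "\<dots> = (cmod t)\<^sup>2"
      using L0 by (simp add: c_def t_def norm_divide power_divide)
    finally have "c \<le> (cmod t)\<^sup>2 / real N" using N by (simp add: field_simps)
    then show ?thesis using a'(1) b'(1) eq unfolding N_def J_def by blast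
  qed
  moreover have "c > 0" using L0 by (simp add: c_def)
  ultimately show thesis by (intro that) auto
qed

section \<open>Cusps as fractions of integers\<close>

lemma quad_field_fraction:
  assumes "x \<in> quad_field D" obtains a n where "a \<in> A" "n \<noteq> (0 :: int)" "x = a / of_int n"
proof -
  obtain r s where x: "x = of_rat r + of_rat s * csqrt (of_int D)"
    using assms by (auto simp: quad_field_def)
  obtain p q where r: "r = Fract p q" "q > 0" by (cases r) auto
  obtain p' q' where s: "s = Fract p' q'" "q' > 0" by (cases s) auto
  have sq: "csqrt (of_int D) = 2 * g - of_int D" by (simp add: quad_gen_def field_simps)
  define a where "a = of_int (p * q' - p' * q * D) + of_int (2 * p' * q) * g"
  have "x = a / of_int (q * q')"
    unfolding x r s sq using r(2) s(2) by (simp add: of_rat_rat a_def field_simps)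
  then show thesis using r(2) s(2) by (intro that[of a "q * q'"]) (simp_all only: a_def A_I, simp)
qed

lemma A_subset_field: "a \<in> A \<Longrightarrow> a / of_int n \<in> quad_field D"
proof -
  assume "a \<in> A"
  then obtain k l where a: "a = of_int k + of_int l * g" by (auto simp: quad_int_def)
  have "a / of_int n = of_rat ((of_int k + of_int l * of_int D / 2) / of_int n) +
      of_rat (of_int l / 2 / of_int n) * csqrt (of_int D)"
    by (simp add: a quad_gen_def of_rat_add of_rat_mult of_rat_divide add_divide_distrib algebra_simps)
  then show ?thesis unfolding quad_field_def by blast
qed

lemma proj_pt_in_cusps:
  assumes "x \<in> A" "y \<in> A" shows "proj_pt x y \<in> cusps D"
proof (cases "y = 0")
  case False
  obtain k :: int where k: "y * cnj y = of_int k" using A_norm_int[OF assms(2)] by blast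
  have "x / y = x * cnj y / (y * cnj y)" using False by simp
  also have "\<dots> = x * cnj y / of_int k" by (simp only: k)
  also have "\<dots> \<in> quad_field D" by (intro A_subset_field A_mult A_cnj assms)
  finally show ?thesis using False by (simp add: proj_pt_def cusps_def)
qed (simp add: proj_pt_def cusps_def)

lemma cusp_rep_props:
  assumes "\<alpha> \<in> cusps D"
  obtains a b where "cusp_rep D \<alpha> = (a, b)" "a \<in> A" "b \<in> A" "(a, b) \<noteq> (0, 0)" "proj_pt a b = \<alpha>"
proof -
  define P where "P = (\<lambda>(a, b). a \<in> A \<and> b \<in> A \<and> (a, b) \<noteq> (0, 0) \<and> proj_pt a b = \<alpha>)"
  have "\<exists>p. P p"
  proof (cases \<alpha>)
    case (Fin x)
    then have "x \<in> quad_field D" using assms by (auto simp: cusps_def)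
    then obtain a n where "a \<in> A" "n \<noteq> (0 :: int)" "x = a / of_int n" by (rule quad_field_fraction)
    then have "P (a, of_int n)" using Fin by (simp add: P_def proj_pt_def)
    then show ?thesis ..
  next
    case Infty
    then have "P (1, 0)" by (simp add: P_def proj_pt_def)
    then show ?thesis ..
  qed
  moreover have "cusp_rep D \<alpha> = (SOME p. P p)" by (simp add: cusp_rep_def P_def)
  ultimately have "P (cusp_rep D \<alpha>)" by (metis someI_ex)
  then show thesis by (cases "cusp_rep D \<alpha>") (auto simp: P_def intro: that)
qed

text \<open>At \<open>Infty\<close> this formula would say that the norm of a principal ideal is
  \<open>Nm\<close> of its generator; that cusp is treated separately, with the fraction
  1/0.\<close>

lemma cusp_dist_Fin:
  assumes "\<alpha> \<noteq> Infty" "cusp_rep D \<alpha> = (a, b)" "proj_pt a b = \<alpha>"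
  shows "cusp_dist D \<alpha> w = point_form w a b / real (ideal_norm D (ideal_gen2 D a b))"
proof -
  obtain z \<zeta> where w: "w = (z, \<zeta>)" by fastforce
  obtain x where x: "\<alpha> = Fin x" using assms(1) by (cases \<alpha>) auto
  have b: "b \<noteq> 0" and xab: "x = a / b" using assms(3) x by (auto simp: proj_pt_def split: if_splits)
  have "a - b * z = - (b * (z - x))" using b xab by (simp add: algebra_simps)
  then have "(cmod (a - b * z))\<^sup>2 = (cmod b)\<^sup>2 * (cmod (z - x))\<^sup>2"
    by (simp add: norm_mult power_mult_distrib)
  then show ?thesis using assms(2)
    by (simp add: w x cusp_dist_def point_form_def Nm_def algebra_simps add_divide_distrib)
qed

lemma gen2_norm_pos:
  assumes "a \<in> A" "b \<in> A" "(a, b) \<noteq> (0, 0)"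
  shows "finite (A // congr (ideal_gen2 D a b))" "0 < ideal_norm D (ideal_gen2 D a b)"
proof -
  note J = is_ideal_gen2[OF assms(1,2)]
  show "finite (A // congr (ideal_gen2 D a b))"
    using finite_quotient[OF J gen2_mem(1)] finite_quotient[OF J gen2_mem(2)] assms(3) by auto
  then show "0 < ideal_norm D (ideal_gen2 D a b)" by (rule ideal_norm_pos[OF J])
qed

text \<open>Trades the chosen fraction for one whose scale \<open>l\<close> is bounded below, so
  that a bound on the cusp function will bound \<open>a\<close> and \<open>b\<close>. The factor
  \<mu> stays unspecified because only the sign of the cusp value matters.\<close>

lemma cusp_normal_form:
  obtains c where "c > 0" and
    "\<And>\<alpha>. \<alpha> \<in> cusps D \<Longrightarrow> \<exists>a b l. a \<in> A \<and> b \<in> A \<and> (a, b) \<noteq> (0, 0) \<and> proj_pt a b = \<alpha> \<and> c \<le> l \<and>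
      (\<forall>w. cusp_dist D \<alpha> w = l * point_form w a b) \<and>
      (\<exists>\<mu>>0. \<forall>p q \<nu>. cusp_value D (herm_form p q \<nu>) \<alpha> = \<mu> * herm_form p q \<nu> a b)"
proof -
  obtain c where c: "c > 0" and bounded:
    "\<And>a b. a \<in> A \<Longrightarrow> b \<in> A \<Longrightarrow> (a, b) \<noteq> (0, 0) \<Longrightarrow>
      \<exists>a' b' t. a' \<in> A \<and> b' \<in> A \<and> a = t * a' \<and> b = t * b' \<and>
        c \<le> (cmod t)\<^sup>2 / real (ideal_norm D (ideal_gen2 D a b))"
    using fraction_bounded by blast
  \<comment> \<open>The 1 is the scale at \<open>Infty\<close>.\<close>
  have "\<exists>a b l. a \<in> A \<and> b \<in> A \<and> (a, b) \<noteq> (0, 0) \<and> proj_pt a b = \<alpha> \<and> min c 1 \<le> l \<and>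
      (\<forall>w. cusp_dist D \<alpha> w = l * point_form w a b) \<and>
      (\<exists>\<mu>>0. \<forall>p q \<nu>. cusp_value D (herm_form p q \<nu>) \<alpha> = \<mu> * herm_form p q \<nu> a b)"
    if \<alpha>: "\<alpha> \<in> cusps D" for \<alpha>
  proof -
    obtain a b where rep: "cusp_rep D \<alpha> = (a, b)" and ab: "a \<in> A" "b \<in> A" "(a, b) \<noteq> (0, 0)"
      and pr: "proj_pt a b = \<alpha>" using cusp_rep_props[OF \<alpha>] by blast
    define N where "N = real (ideal_norm D (ideal_gen2 D a b))"
    have N: "N > 0" using gen2_norm_pos(2)[OF ab] by (simp add: N_def)
    have val: "cusp_value D f \<alpha> = f a b / N" for f by (simp add: cusp_value_def rep N_def)
    show ?thesis
    proof (cases "\<alpha> = Infty")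
      case True
      then have b: "b = 0" "a \<noteq> 0" using pr ab by (auto simp: proj_pt_def split: if_splits)
      have "cusp_value D (herm_form p q \<nu>) \<alpha> = (cmod a)\<^sup>2 / N * herm_form p q \<nu> 1 0" for p q \<nu>
        using herm_form_scale[of p q \<nu> a 1 0] b by (simp add: val)
      moreover have "0 < (cmod a)\<^sup>2 / N" using b N by simp
      ultimately have 1: "\<exists>\<mu>>0. \<forall>p q \<nu>. cusp_value D (herm_form p q \<nu>) \<alpha> = \<mu> * herm_form p q \<nu> 1 0"
        by blast
      have 2: "cusp_dist D \<alpha> w = 1 * point_form w 1 0" for w
        using True by (cases w) (simp add: cusp_dist_def point_form_def)
      have 3: "proj_pt 1 0 = \<alpha>" using True by (simp add: proj_pt_def)
      show ?thesis
        by (rule exI[of _ 1], rule exI[of _ 0], rule exI[of _ 1]) (use 1 2 3 in simp)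
    next
      case False
      obtain a' b' t where t: "a' \<in> A" "b' \<in> A" "a = t * a'" "b = t * b'" "c \<le> (cmod t)\<^sup>2 / N"
        using bounded[OF ab] unfolding N_def by blast
      have t0: "t \<noteq> 0" using t ab by auto
      have 1: "cusp_dist D \<alpha> w = (cmod t)\<^sup>2 / N * point_form w a' b'" for w
        unfolding cusp_dist_Fin[OF False rep pr] N_def[symmetric]
        using point_form_scale[of w t a' b'] t(3,4) by simp
      have 2: "cusp_value D (herm_form p q \<nu>) \<alpha> = (cmod t)\<^sup>2 / N * herm_form p q \<nu> a' b'" for p q \<nu>
        unfolding val t(3,4) herm_form_scale by simp
      have 3: "proj_pt a' b' = \<alpha>" using pr t t0 by (auto simp: proj_pt_def)
      have 4: "(a', b') \<noteq> (0, 0)" using ab t by auto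
      have 5: "0 < (cmod t)\<^sup>2 / N" using t0 N by simp
      show ?thesis
        using 1 2 3 4 5 t by (intro exI[of _ a'] exI[of _ b'] exI[of _ "(cmod t)\<^sup>2 / N"]) auto
    qed
  qed
  moreover have "min c 1 > 0" using c by simp
  ultimately show thesis by (intro that)
qed

text \<open>The chosen pair \<open>(a, b)\<close> is \<open>c\<close> times \<open>(x, y)\<close>,
  so each non-zero element of its ideal is \<open>c\<close> times a non-zero element of
  \<open>A\<close> and has length at least \<open>cmod c / 2\<close>; \<open>ideal_norm_ge\<close>
  turns this into a lower bound for the norm.\<close>

lemma cusp_dist_le:
  assumes x: "x \<in> A" and y: "y \<in> A" and xy: "(x, y) \<noteq> (0, 0)" and w: "w \<in> H3"
  shows "cusp_dist D (proj_pt x y) w \<le> 4 * L\<^sup>2 * point_form w x y"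
proof -
  define \<alpha> where "\<alpha> = proj_pt x y"
  have \<alpha>: "\<alpha> \<in> cusps D" unfolding \<alpha>_def by (rule proj_pt_in_cusps[OF x y])
  have L2: "1 \<le> L\<^sup>2" using L_ge_1 by simp
  have w0: "snd w > 0" using w by (auto simp: H3_def)
  have pf: "point_form w x y \<ge> 0" using w0 by (simp add: point_form_def)
  show ?thesis
  proof (cases "\<alpha> = Infty")
    case True
    then have y0: "y = 0" by (auto simp: \<alpha>_def proj_pt_def split: if_splits)
    have "cmod x \<ge> 1 / 2" using cmod_A_ge[OF x] xy y0 by auto
    then have "(1 / 2)\<^sup>2 \<le> (cmod x)\<^sup>2" by (intro power_mono) auto
    then have "1 \<le> 4 * (cmod x)\<^sup>2" by (simp add: power2_eq_square)
    then have "1 / snd w \<le> 4 * (cmod x)\<^sup>2 / snd w" using w0 by (intro divide_right_mono) auto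
    also have "\<dots> = 4 * 1 * point_form w x y" by (simp add: point_form_def y0)
    also have "\<dots> \<le> 4 * L\<^sup>2 * point_form w x y" using L2 pf by (intro mult_right_mono) auto
    finally show ?thesis using True by (cases w) (simp add: \<alpha>_def cusp_dist_def)
  next
    case False
    then have y0: "y \<noteq> 0" by (auto simp: \<alpha>_def proj_pt_def split: if_splits)
    obtain a b where rep: "cusp_rep D \<alpha> = (a, b)" and ab: "a \<in> A" "b \<in> A" "(a, b) \<noteq> (0, 0)"
      and pr: "proj_pt a b = \<alpha>" using cusp_rep_props[OF \<alpha>] by blast
    have b0: "b \<noteq> 0" and q: "a / b = x / y"
      using pr y0 by (auto simp: \<alpha>_def proj_pt_def split: if_splits)
    define c where "c = b / y"
    have c: "c \<noteq> 0" "b = c * y" "a = c * x" using b0 y0 q by (auto simp: c_def field_simps)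
    define N where "N = real (ideal_norm D (ideal_gen2 D a b))"
    have N: "N > 0" using gen2_norm_pos(2)[OF ab] by (simp add: N_def)
    have "(cmod c / 2 / L)\<^sup>2 \<le> N"
      unfolding N_def
    proof (rule ideal_norm_ge[OF is_ideal_gen2[OF ab(1,2)] gen2_norm_pos(1)[OF ab]])
      fix z assume z: "z \<in> ideal_gen2 D a b" "z \<noteq> 0"
      then obtain u v where uv: "u \<in> A" "v \<in> A" "z = a * u + b * v" by (auto simp: ideal_gen2_def)
      have zc: "z = c * (x * u + y * v)" by (simp add: uv c algebra_simps)
      then have "1 / 2 \<le> cmod (x * u + y * v)" using z x y uv by (intro cmod_A_ge A_add A_mult) auto
      then show "cmod c / 2 \<le> cmod z"
        unfolding zc norm_mult using mult_left_mono[of "1/2" "cmod (x * u + y * v)" "cmod c"] by simp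
    qed simp
    then have "(cmod c)\<^sup>2 \<le> 4 * L\<^sup>2 * N" using L_ge_1 by (simp add: power_divide field_simps)
    then have "(cmod c)\<^sup>2 * point_form w x y \<le> 4 * L\<^sup>2 * N * point_form w x y"
      using pf by (rule mult_right_mono)
    then have "(cmod c)\<^sup>2 * point_form w x y / N \<le> 4 * L\<^sup>2 * point_form w x y"
      using N by (simp add: field_simps)
    then show ?thesis
      unfolding \<alpha>_def[symmetric] cusp_dist_Fin[OF False rep pr] N_def[symmetric]
      by (simp add: c point_form_scale)
  qed
qed

text \<open>The \<open>(n + 1)^2\<close> multipliers \<open>pt p\<close> fall into
  \<open>n^2\<close> boxes according to the fractional coordinates of \<open>pt p * z\<close>. For
  two in the same box, \<open>y\<close> is the difference of the multipliers and \<open>x\<close>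
  that of the integral parts.\<close>

lemma dirichlet:
  fixes n :: nat
  assumes n: "n > 0"
  obtains x y where "x \<in> A" "y \<in> A" "y \<noteq> 0" "cmod y \<le> real n * L" "cmod (x - y * z) \<le> L / real n"
proof -
  define pt where "pt = (\<lambda>(i :: nat, j :: nat). of_nat i + of_nat j * g :: complex)"
  define S where "S = (\<lambda>p. SOME s. \<exists>t. pt p * z = of_real s + of_real t * g)"
  define T where "T = (\<lambda>p. SOME t. pt p * z = of_real (S p) + of_real t * g)"
  have "\<exists>s t. pt p * z = of_real s + of_real t * g" for p by (metis real_coords)
  then have "\<exists>t. pt p * z = of_real (S p) + of_real t * g" for p unfolding S_def by (rule someI_ex)
  then have ST: "pt p * z = of_real (S p) + of_real (T p) * g" for p unfolding T_def by (rule someI_ex)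
  define box where "box = (\<lambda>x :: real. \<lfloor>real n * frac x\<rfloor>)"
  have box: "box x \<in> {0..<int n}" for x
  proof -
    have "real n * frac x < real n" using n frac_lt_1[of x] by simp
    then show ?thesis using frac_ge_0[of x] by (auto simp: box_def floor_less_iff)
  qed
  have box_close: "\<bar>frac s - frac s'\<bar> \<le> 1 / real n" if "box s = box s'" for s s'
  proof -
    have "\<bar>real n * frac s - real n * frac s'\<bar> < 1" using that unfolding box_def by linarith
    moreover have "real n * frac s - real n * frac s' = real n * (frac s - frac s')"
      by (simp add: algebra_simps)
    ultimately have "real n * \<bar>frac s - frac s'\<bar> < 1" by (simp add: abs_mult)
    then show ?thesis using n by (simp add: field_simps)
  qed
  define \<psi> where "\<psi> = (\<lambda>p. (box (S p), box (T p)))"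
  have "\<not> inj_on \<psi> ({..n} \<times> {..n})"
  proof
    assume "inj_on \<psi> ({..n} \<times> {..n})"
    moreover have "\<psi> ` ({..n} \<times> {..n}) \<subseteq> {0..<int n} \<times> {0..<int n}"
      using box by (auto simp: \<psi>_def)
    ultimately have "card ({..n} \<times> {..n}) \<le> card ({0..<int n} \<times> {0..<int n})"
      by (intro card_inj_on_le) auto
    then show False by (simp add: card_cartesian_product)
  qed
  then obtain p p' where p: "p \<in> {..n} \<times> {..n}" "p' \<in> {..n} \<times> {..n}" "p \<noteq> p'" "\<psi> p = \<psi> p'"
    by (auto simp: inj_on_def)
  define y where "y = pt p - pt p'"
  define x where "x = of_int (\<lfloor>S p\<rfloor> - \<lfloor>S p'\<rfloor>) + of_int (\<lfloor>T p\<rfloor> - \<lfloor>T p'\<rfloor>) * g"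
  obtain i j i' j' where ij: "p = (i, j)" "p' = (i', j')" "i \<le> n" "j \<le> n" "i' \<le> n" "j' \<le> n"
    using p by auto
  have y_eq: "y = of_int (int i - int i') + of_int (int j - int j') * g"
    by (simp add: y_def ij pt_def algebra_simps)
  have yA: "y \<in> A" unfolding y_eq by (rule A_I)
  have xA: "x \<in> A" unfolding x_def by (rule A_I)
  have y0: "y \<noteq> 0"
  proof
    assume "y = 0"
    then have "of_int (int i) + of_int (int j) * g = of_int (int i') + of_int (int j') * g"
      by (simp add: y_def ij pt_def)
    from lattice_coords_inj[OF this] show False using p(3) ij by simp
  qed
  have tri: "cmod (of_real s + of_real t * g) \<le> e * L" if "\<bar>s\<bar> \<le> e" "\<bar>t\<bar> \<le> e" for s t e :: real
  proof -
    have "cmod (of_real s + of_real t * g) \<le> \<bar>s\<bar> + \<bar>t\<bar> * cmod g"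
      using norm_triangle_ineq[of "of_real s" "of_real t * g"] by (simp add: norm_mult)
    also have "\<dots> \<le> e + e * cmod g" using that by (intro add_mono mult_right_mono) auto
    finally show ?thesis by (simp add: L_def algebra_simps)
  qed
  have "y = of_real (real i - real i') + of_real (real j - real j') * g"
    by (simp add: y_eq)
  then have yn: "cmod y \<le> real n * L" using tri[of "real i - real i'" "real n" "real j - real j'"] ij by auto
  have "y * z - x = of_real (frac (S p) - frac (S p')) + of_real (frac (T p) - frac (T p')) * g"
    using ST[of p] ST[of p'] by (simp add: y_def x_def frac_def algebra_simps)
  moreover have "\<bar>frac (S p) - frac (S p')\<bar> \<le> 1 / real n" "\<bar>frac (T p) - frac (T p')\<bar> \<le> 1 / real n"
    using p(4) by (auto simp: \<psi>_def intro!: box_close)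
  ultimately have "cmod (y * z - x) \<le> 1 / real n * L" using tri by metis
  then have "cmod (x - y * z) \<le> L / real n" by (simp add: norm_minus_commute)
  with xA yA y0 yn show thesis by (rule that)
qed

text \<open>For low points take \<open>n\<close> near \<open>1 / sqrt \<zeta>\<close> in
  \<open>dirichlet\<close>: the two terms \<open>|x - y z|^2 / \<zeta>\<close> and
  \<open>|y|^2 \<zeta>\<close> of \<open>point_form\<close> are then at most \<open>L^2\<close> and
  \<open>4 L^2\<close>, whence the 5. High points are close to \<open>Infty\<close>.\<close>

lemma cusp_dist_bounded:
  obtains C where "\<And>w. w \<in> H3 \<Longrightarrow> \<exists>\<alpha>\<in>cusps D. cusp_dist D \<alpha> w \<le> C"
proof (rule that)
  fix w assume w: "w \<in> H3"
  obtain z \<zeta> where wz: "w = (z, \<zeta>)" by fastforce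
  have z0: "\<zeta> > 0" using w wz by (auto simp: H3_def)
  have L1: "1 \<le> L\<^sup>2" using L_ge_1 by simp
  show "\<exists>\<alpha>\<in>cusps D. cusp_dist D \<alpha> w \<le> 4 * L\<^sup>2 * (5 * L\<^sup>2)"
  proof (cases "\<zeta> \<ge> 1")
    case True
    have "1 * 1 \<le> 4 * L\<^sup>2 * (5 * L\<^sup>2)" using L1 by (intro mult_mono) auto
    moreover have "1 / \<zeta> \<le> 1" using True by simp
    ultimately have "cusp_dist D Infty w \<le> 4 * L\<^sup>2 * (5 * L\<^sup>2)" by (simp add: wz cusp_dist_def)
    then show ?thesis by (auto simp: cusps_def)
  next
    case False
    define n where "n = nat \<lceil>1 / sqrt \<zeta>\<rceil>"
    have s: "0 < sqrt \<zeta>" "sqrt \<zeta> < 1" using z0 False by auto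
    have ge1: "1 \<le> 1 / sqrt \<zeta>" using s by simp
    have n1: "1 / sqrt \<zeta> \<le> real n" unfolding n_def by (rule real_nat_ceiling_ge)
    have "real n < 1 / sqrt \<zeta> + 1" unfolding n_def using ge1 by linarith
    \<comment> \<open>Rounding up at most doubles \<open>1 / sqrt \<zeta>\<close>, which is at least
      1 in this case.\<close>
    then have n2: "real n \<le> 2 / sqrt \<zeta>" using ge1 by simp
    have n0: "n > 0" using order_trans[OF ge1 n1] by simp
    obtain x y where xy: "x \<in> A" "y \<in> A" "y \<noteq> 0" "cmod y \<le> real n * L" "cmod (x - y * z) \<le> L / real n"
      by (rule dirichlet[OF n0, of z])
    have "cmod (x - y * z) \<le> L * sqrt \<zeta>"
    proof -
      have "1 \<le> real n * sqrt \<zeta>" using n1 s by (simp add: field_simps)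
      then have "1 / real n \<le> sqrt \<zeta>" using n0 by (simp add: field_simps)
      then have "L * (1 / real n) \<le> L * sqrt \<zeta>" using L_ge_1 by (intro mult_left_mono) auto
      then show ?thesis using xy(5) by simp
    qed
    then have "(cmod (x - y * z))\<^sup>2 \<le> (L * sqrt \<zeta>)\<^sup>2" by (intro power_mono) auto
    then have 1: "(cmod (x - y * z))\<^sup>2 \<le> L\<^sup>2 * \<zeta>" using z0 by (simp add: power_mult_distrib)
    have "real n * L \<le> 2 / sqrt \<zeta> * L" using n2 L_ge_1 by (intro mult_right_mono) auto
    then have "cmod y \<le> 2 / sqrt \<zeta> * L" using xy(4) by linarith
    then have "(cmod y)\<^sup>2 \<le> (2 / sqrt \<zeta> * L)\<^sup>2" by (intro power_mono) auto
    then have "(cmod y)\<^sup>2 \<le> 4 * L\<^sup>2 / \<zeta>" using z0 by (simp add: power_mult_distrib power_divide)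
    then have "(cmod y)\<^sup>2 * \<zeta> \<le> 4 * L\<^sup>2" using z0 by (simp add: field_simps)
    then have 2: "(cmod y)\<^sup>2 * \<zeta>\<^sup>2 \<le> 4 * L\<^sup>2 * \<zeta>"
      using z0 mult_right_mono[of "(cmod y)\<^sup>2 * \<zeta>" "4 * L\<^sup>2" \<zeta>] by (simp add: power2_eq_square mult.assoc)
    have "point_form w x y \<le> 5 * L\<^sup>2"
      unfolding point_form_def wz using 1 2 z0 by (simp add: field_simps)
    then have "4 * L\<^sup>2 * point_form w x y \<le> 4 * L\<^sup>2 * (5 * L\<^sup>2)" by (intro mult_left_mono) auto
    moreover have "cusp_dist D (proj_pt x y) w \<le> 4 * L\<^sup>2 * point_form w x y"
      using xy w by (intro cusp_dist_le) auto
    ultimately have "cusp_dist D (proj_pt x y) w \<le> 4 * L\<^sup>2 * (5 * L\<^sup>2)" by linarith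
    then show ?thesis using proj_pt_in_cusps[OF xy(1,2)] by blast
  qed
qed

end

section \<open>The ocean as a graph over the plane\<close>

lemma cmod_diff_sq: "(cmod (x - y))\<^sup>2 = (cmod x)\<^sup>2 - 2 * (x \<bullet> y) + (cmod y)\<^sup>2"
  by (simp add: inner_diff_left inner_diff_right inner_commute flip: dot_square_norm)

context hemisphere
begin

text \<open>Time component of the lightlike vector of the fraction \<open>a / b\<close>, scaled by
  \<open>l\<close>; \<open>form_B\<close> is its space part. By \<open>normal_form\<close>, the last
  component of \<open>form_B\<close> is \<open>l / a0\<close> times the value of the form.\<close>

definition form_W :: "real \<Rightarrow> complex \<Rightarrow> complex \<Rightarrow> real" where
  "form_W l a b = l * ((cmod (a - c * b))\<^sup>2 + r\<^sup>2 * (cmod b)\<^sup>2)"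

definition form_B :: "real \<Rightarrow> complex \<Rightarrow> complex \<Rightarrow> complex \<times> real" where
  "form_B l a b = ((- (2 * r * l)) *\<^sub>R ((a - c * b) * cnj b), l * ((cmod (a - c * b))\<^sup>2 - r\<^sup>2 * (cmod b)\<^sup>2))"

text \<open>The vector is lightlike: \<open>(u - v)^2 + 4 u v = (u + v)^2\<close> for
  \<open>u = |a - c b|^2\<close> and \<open>v = r^2 |b|^2\<close>.\<close>

lemma norm_form_B: "0 \<le> l \<Longrightarrow> norm (form_B l a b) = form_W l a b"
proof -
  assume l: "0 \<le> l"
  have "(norm (form_B l a b))\<^sup>2 = (form_W l a b)\<^sup>2"
    unfolding norm_pair_sq form_B_def form_W_def
    by (simp add: norm_mult power_mult_distrib) (simp add: power2_eq_square algebra_simps)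
  moreover have "0 \<le> form_W l a b" using l by (simp add: form_W_def)
  ultimately show ?thesis by (simp add: power2_eq_iff_nonneg)
qed

text \<open>The numerator of \<open>point_form\<close> is affine in \<open>fst w - c\<close> and
  \<open>height w\<close>. After division by \<open>r\<^sup>2 + height w\<close> it is affine in
  \<open>klein w\<close>, and the denominator \<open>snd w\<close> is absorbed by the square
  root.\<close>

lemma point_form_klein:
  assumes w: "w \<in> H3"
  shows "l * point_form w a b * (r * sqrt (1 - (norm (klein w))\<^sup>2)) =
    form_W l a b + form_B l a b \<bullet> klein w"
proof -
  define d where "d = r\<^sup>2 + height w"
  define h where "h = height w"
  define z where "z = fst w - c"
  define a' where "a' = a - c * b"
  define s where "s = (a' * cnj b) \<bullet> z"
  have d: "d > 0" unfolding d_def by (rule denom_pos)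
  have w0: "snd w > 0" using w by (auto simp: H3_def)
  have az: "a - b * fst w = a' - b * z" by (simp add: a'_def z_def algebra_simps)
  have s: "a' \<bullet> (b * z) = s" by (simp add: s_def inner_complex_def algebra_simps)
  have h: "h = (cmod z)\<^sup>2 + (snd w)\<^sup>2" by (simp add: h_def height_def z_def)
  have "(cmod (a - b * fst w))\<^sup>2 + (cmod b)\<^sup>2 * (snd w)\<^sup>2 = (cmod a')\<^sup>2 - 2 * s + (cmod b)\<^sup>2 * h"
    unfolding az cmod_diff_sq s h by (simp add: norm_mult power_mult_distrib algebra_simps)
  then have "point_form w a b * snd w = (cmod a')\<^sup>2 - 2 * s + (cmod b)\<^sup>2 * h"
    using w0 by (simp add: point_form_def)
  moreover have "l * point_form w a b * (r * sqrt (1 - (norm (klein w))\<^sup>2)) =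
      l * (point_form w a b * snd w) * (2 * r\<^sup>2 / d)"
    unfolding sqrt_one_minus_norm_klein[OF w] d_def[symmetric] by (simp add: power2_eq_square)
  moreover have "form_W l a b + form_B l a b \<bullet> klein w =
      l * ((cmod a')\<^sup>2 - 2 * s + (cmod b)\<^sup>2 * h) * (2 * r\<^sup>2 / d)"
  proof -
    have B: "form_B l a b \<bullet> klein w = - (2 * r * l) * (2 * r / d) * s
        + l * ((cmod a')\<^sup>2 - r\<^sup>2 * (cmod b)\<^sup>2) * ((r\<^sup>2 - h) / d)"
      unfolding form_B_def klein_def d_def[symmetric]
      unfolding a'_def[symmetric] z_def[symmetric] h_def[symmetric]
      by (simp add: inner_prod_def s_def)
    have W: "form_W l a b = l * ((cmod a')\<^sup>2 + r\<^sup>2 * (cmod b)\<^sup>2) * (d / d)"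
      using d by (simp add: form_W_def a'_def)
    have "form_W l a b + form_B l a b \<bullet> klein w =
       (l * ((cmod a')\<^sup>2 + r\<^sup>2 * (cmod b)\<^sup>2) * d - 2 * r * l * (2 * r) * s
        + l * ((cmod a')\<^sup>2 - r\<^sup>2 * (cmod b)\<^sup>2) * (r\<^sup>2 - h)) / d"
      unfolding B W using d by (simp add: field_simps)
    also have "l * ((cmod a')\<^sup>2 + r\<^sup>2 * (cmod b)\<^sup>2) * d - 2 * r * l * (2 * r) * s
        + l * ((cmod a')\<^sup>2 - r\<^sup>2 * (cmod b)\<^sup>2) * (r\<^sup>2 - h) =
        l * ((cmod a')\<^sup>2 - 2 * s + (cmod b)\<^sup>2 * h) * (2 * r\<^sup>2)"
      unfolding d_def h_def[symmetric] by (simp add: algebra_simps power2_eq_square)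
    finally show ?thesis by simp
  qed
  ultimately show ?thesis by simp
qed

end

text \<open>\<open>normal_form\<close> has the square completed, so \<open>c\<close> and
  \<open>r\<close> are centre and radius of the circle. \<open>a0\<close> may have either sign; this
  is the sign common to all cusps.\<close>

locale ocean_plane = imaginary_quadratic D + hemisphere c r
  for D :: int and c :: complex and r :: real +
  fixes a0 :: real and p q :: rat and \<nu> :: complex
  assumes a0: "a0 \<noteq> 0"
    and normal_form: "\<And>x y. herm_form p q \<nu> x y = a0 * ((cmod (x - c * y))\<^sup>2 - r\<^sup>2 * (cmod y)\<^sup>2)"
    and integral: "integral_form D (herm_form p q \<nu>)"
    and anisotropic: "anisotropic_form D (herm_form p q \<nu>)"
begin

abbreviation "f \<equiv> herm_form p q \<nu>"

section \<open>The affine functions attached to the cusps\<close>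

lemma form_ge_1:
  assumes "a \<in> A" "b \<in> A" "(a, b) \<noteq> (0, 0)" shows "1 \<le> \<bar>f a b\<bar>"
proof -
  have "a \<in> quad_field D" "b \<in> quad_field D"
    using A_subset_field[of a 1] A_subset_field[of b 1] assms by auto
  then have "f a b \<noteq> 0" using anisotropic assms(3) by (auto simp: anisotropic_form_def)
  moreover have "f a b \<in> \<int>" using integral assms by (auto simp: integral_form_def)
  ultimately show ?thesis by (auto elim!: Ints_cases simp: abs_real_def)
qed

lemma cusp_family:
  obtains W B where "cusp_functions (cusps D) W B"
    and "\<And>\<alpha> w. \<alpha> \<in> cusps D \<Longrightarrow> w \<in> H3 \<Longrightarrow>
      cusp_dist D \<alpha> w * (r * sqrt (1 - (norm (klein w))\<^sup>2)) = W \<alpha> + B \<alpha> \<bullet> klein w"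
    and "\<And>\<alpha>. \<alpha> \<in> cusps D \<Longrightarrow> \<exists>k>0. cusp_value D f \<alpha> * a0 = k * snd (B \<alpha>)"
proof -
  obtain c0 where c0: "c0 > 0" and ex: "\<And>\<alpha>. \<alpha> \<in> cusps D \<Longrightarrow>
      \<exists>a b l. a \<in> A \<and> b \<in> A \<and> (a, b) \<noteq> (0, 0) \<and> proj_pt a b = \<alpha> \<and> c0 \<le> l \<and>
      (\<forall>w. cusp_dist D \<alpha> w = l * point_form w a b) \<and>
      (\<exists>\<mu>>0. \<forall>p q \<nu>. cusp_value D (herm_form p q \<nu>) \<alpha> = \<mu> * herm_form p q \<nu> a b)"
    using cusp_normal_form by blast
  define P where "P = (\<lambda>\<alpha> (a, b, l). a \<in> A \<and> b \<in> A \<and> (a, b) \<noteq> (0, 0) \<and> proj_pt a b = \<alpha> \<and> c0 \<le> l \<and>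
      (\<forall>w. cusp_dist D \<alpha> w = l * point_form w a b) \<and>
      (\<exists>\<mu>>0. cusp_value D f \<alpha> = \<mu> * f a b))"
  have "\<exists>t. P \<alpha> t" if \<alpha>: "\<alpha> \<in> cusps D" for \<alpha>
  proof -
    obtain a b l where "a \<in> A \<and> b \<in> A \<and> (a, b) \<noteq> (0, 0) \<and> proj_pt a b = \<alpha> \<and> c0 \<le> l \<and>
      (\<forall>w. cusp_dist D \<alpha> w = l * point_form w a b) \<and>
      (\<exists>\<mu>>0. \<forall>p q \<nu>. cusp_value D (herm_form p q \<nu>) \<alpha> = \<mu> * herm_form p q \<nu> a b)"
      using ex[OF \<alpha>] by blast
    then have "P \<alpha> (a, b, l)" unfolding P_def prod.case by blast
    then show ?thesis ..
  qed
  then obtain t where t: "\<And>\<alpha>. \<alpha> \<in> cusps D \<Longrightarrow> P \<alpha> (t \<alpha>)" by metis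
  define a where "a = (\<lambda>\<alpha>. fst (t \<alpha>))"
  define b where "b = (\<lambda>\<alpha>. fst (snd (t \<alpha>)))"
  define l where "l = (\<lambda>\<alpha>. snd (snd (t \<alpha>)))"
  have ab: "a \<alpha> \<in> A" "b \<alpha> \<in> A" "(a \<alpha>, b \<alpha>) \<noteq> (0, 0)" "proj_pt (a \<alpha>) (b \<alpha>) = \<alpha>" "c0 \<le> l \<alpha>"
    and dist: "\<And>w. cusp_dist D \<alpha> w = l \<alpha> * point_form w (a \<alpha>) (b \<alpha>)"
    and val: "\<exists>\<mu>>0. cusp_value D f \<alpha> = \<mu> * f (a \<alpha>) (b \<alpha>)" if "\<alpha> \<in> cusps D" for \<alpha>
    using t[OF that] by (auto simp: P_def a_def b_def l_def split: prod.splits)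
  have l_pos: "l \<alpha> > 0" if "\<alpha> \<in> cusps D" for \<alpha> using ab(5)[OF that] c0 by linarith
  define W where "W = (\<lambda>\<alpha>. form_W (l \<alpha>) (a \<alpha>) (b \<alpha>))"
  define B where "B = (\<lambda>\<alpha>. form_B (l \<alpha>) (a \<alpha>) (b \<alpha>))"
  have snd_B: "a0 * snd (B \<alpha>) = l \<alpha> * f (a \<alpha>) (b \<alpha>)" for \<alpha>
    by (simp add: B_def form_B_def normal_form)
  have key: "cusp_dist D \<alpha> w * (r * sqrt (1 - (norm (klein w))\<^sup>2)) = W \<alpha> + B \<alpha> \<bullet> klein w"
    if "\<alpha> \<in> cusps D" "w \<in> H3" for \<alpha> w
    unfolding dist[OF that(1)] W_def B_def by (rule point_form_klein[OF that(2)])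
  have "cusp_functions (cusps D) W B"
  proof
    show "norm (B \<alpha>) \<le> W \<alpha>" if "\<alpha> \<in> cusps D" for \<alpha>
      using norm_form_B l_pos[OF that] by (simp add: W_def B_def)
    show "finite {\<alpha> \<in> cusps D. W \<alpha> \<le> R}" for R
    proof -
      \<comment> \<open>\<open>R1\<close> bounds \<open>|a - c b|\<close> and \<open>r |b|\<close>,
        which bounds \<open>a\<close>; the summands \<open>R1 / r\<close> and 1/2 in
        \<open>R2\<close> let the same disc hold \<open>b\<close> and meet the hypothesis of
        \<open>disc_card\<close>.\<close>
      define R1 where "R1 = sqrt (\<bar>R\<bar> / c0)"
      define R2 where "R2 = R1 + cmod c * (R1 / r) + R1 / r + 1 / 2"
      have R1: "R1 \<ge> 0" using c0 by (simp add: R1_def)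
      have R2: "R2 \<ge> 1 / 2" using R1 r_pos by (simp add: R2_def)
      have "{\<alpha> \<in> cusps D. W \<alpha> \<le> R} \<subseteq> (\<lambda>(x, y). proj_pt x y) ` (disc R2 \<times> disc R2)"
      proof clarify
        fix \<alpha> assume \<alpha>: "\<alpha> \<in> cusps D" and W: "W \<alpha> \<le> R"
        define u where "u = cmod (a \<alpha> - c * b \<alpha>)"
        define v where "v = r * cmod (b \<alpha>)"
        have "c0 * (u\<^sup>2 + v\<^sup>2) \<le> l \<alpha> * (u\<^sup>2 + v\<^sup>2)" using ab(5)[OF \<alpha>] by (intro mult_right_mono) auto
        also have "\<dots> = W \<alpha>" by (simp add: W_def form_W_def u_def v_def power_mult_distrib)
        finally have "u\<^sup>2 + v\<^sup>2 \<le> \<bar>R\<bar> / c0" using W c0 by (simp add: field_simps)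
        moreover have "0 \<le> u\<^sup>2" "0 \<le> v\<^sup>2" by auto
        ultimately have "u\<^sup>2 \<le> \<bar>R\<bar> / c0" "v\<^sup>2 \<le> \<bar>R\<bar> / c0" by linarith+
        then have u: "u \<le> R1" and "v \<le> R1" unfolding R1_def by (auto intro: real_le_rsqrt)
        then have v: "cmod (b \<alpha>) \<le> R1 / r" using r_pos by (simp add: v_def field_simps)
        have "cmod (a \<alpha>) \<le> u + cmod c * cmod (b \<alpha>)"
          using norm_triangle_ineq[of "a \<alpha> - c * b \<alpha>" "c * b \<alpha>"] by (simp add: u_def norm_mult)
        also have "\<dots> \<le> R1 + cmod c * (R1 / r)" using u v by (intro add_mono mult_left_mono) auto
        also have "\<dots> \<le> R2" using R1 r_pos by (simp add: R2_def)
        finally have "cmod (a \<alpha>) \<le> R2" .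
        moreover have "R1 / r \<le> R2" using R1 r_pos by (simp add: R2_def)
        ultimately have "(a \<alpha>, b \<alpha>) \<in> disc R2 \<times> disc R2" using v ab[OF \<alpha>] by (auto simp: disc_def)
        then show "\<alpha> \<in> (\<lambda>(x, y). proj_pt x y) ` (disc R2 \<times> disc R2)"
          using ab(4)[OF \<alpha>] by force
      qed
      then show ?thesis using disc_card(1)[OF R2] by (auto intro: finite_subset)
    qed
    obtain C where C: "\<And>w. w \<in> H3 \<Longrightarrow> \<exists>\<alpha>\<in>cusps D. cusp_dist D \<alpha> w \<le> C"
      using cusp_dist_bounded by blast
    have "\<exists>\<alpha>\<in>cusps D. W \<alpha> + B \<alpha> \<bullet> x \<le> C * r * sqrt (1 - (norm x)\<^sup>2)" if x: "x \<in> ball 0 1" for x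
    proof -
      define w where "w = klein_inv x"
      have w: "w \<in> H3" "klein w = x"
        unfolding w_def using klein_inv_in_H3[OF x] klein_klein_inv[OF x] by auto
      obtain \<alpha> where \<alpha>: "\<alpha> \<in> cusps D" "cusp_dist D \<alpha> w \<le> C" using C[OF w(1)] by blast
      have "0 \<le> r * sqrt (1 - (norm x)\<^sup>2)" using r_pos one_minus_norm_pos[OF x] by simp
      then have "cusp_dist D \<alpha> w * (r * sqrt (1 - (norm x)\<^sup>2)) \<le> C * (r * sqrt (1 - (norm x)\<^sup>2))"
        using \<alpha>(2) by (intro mult_right_mono)
      then show ?thesis using key[OF \<alpha>(1) w(1)] \<alpha>(1) unfolding w(2)
        by (intro bexI[of _ \<alpha>]) (simp_all add: mult.assoc)
    qed
    then show "\<exists>C. \<forall>x\<in>ball 0 1. \<exists>\<alpha>\<in>cusps D. W \<alpha> + B \<alpha> \<bullet> x \<le> C * sqrt (1 - (norm x)\<^sup>2)" by blast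
    \<comment> \<open>The scale is at least \<open>c0\<close>, and \<open>f\<close> takes a non-zero
      integer value.\<close>
    have "c0 / \<bar>a0\<bar> \<le> \<bar>snd (B \<alpha>)\<bar>" if \<alpha>: "\<alpha> \<in> cusps D" for \<alpha>
    proof -
      have "c0 * 1 \<le> l \<alpha> * \<bar>f (a \<alpha>) (b \<alpha>)\<bar>"
        using form_ge_1[OF ab(1-3)[OF \<alpha>]] ab(5)[OF \<alpha>] c0 by (intro mult_mono) auto
      also have "\<dots> = \<bar>a0 * snd (B \<alpha>)\<bar>" unfolding snd_B using l_pos[OF \<alpha>] by (simp add: abs_mult)
      finally show ?thesis using a0 by (simp add: abs_mult field_simps)
    qed
    then show "\<exists>c>0. \<forall>\<alpha>\<in>cusps D. c \<le> \<bar>snd (B \<alpha>)\<bar>"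
      using c0 a0 by (intro exI[of _ "c0 / \<bar>a0\<bar>"]) auto
  qed
  moreover note key
  moreover have "\<exists>k>0. cusp_value D f \<alpha> * a0 = k * snd (B \<alpha>)" if \<alpha>: "\<alpha> \<in> cusps D" for \<alpha>
  proof -
    obtain \<mu> where \<mu>: "\<mu> > 0" "cusp_value D f \<alpha> = \<mu> * f (a \<alpha>) (b \<alpha>)" using val[OF \<alpha>] by blast
    have "f (a \<alpha>) (b \<alpha>) = a0 * snd (B \<alpha>) / l \<alpha>" using snd_B[of \<alpha>] l_pos[OF \<alpha>] by (simp add: field_simps)
    then have "cusp_value D f \<alpha> * a0 = (\<mu> * (a0 * a0) / l \<alpha>) * snd (B \<alpha>)" using \<mu>(2) by simp
    moreover have "0 < a0 * a0" using a0 by (auto simp: zero_less_mult_iff)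
    then have "0 < \<mu> * (a0 * a0) / l \<alpha>" using \<mu>(1) l_pos[OF \<alpha>] by simp
    ultimately show ?thesis by blast
  qed
  ultimately show thesis by (rule that)
qed

text \<open>Through \<open>klein\<close> the projection sends \<open>(y, level y)\<close> to
  \<open>(y, 0)\<close>: the graph of a continuous function is mapped to its base.\<close>

lemma nearest_point_homeomorphism:
  "\<exists>g. homeomorphism (ocean D f) hemi (nearest_point hemi) g"
proof -
  obtain W B where fam: "cusp_functions (cusps D) W B"
    and key: "\<And>\<alpha> w. \<alpha> \<in> cusps D \<Longrightarrow> w \<in> H3 \<Longrightarrow>
      cusp_dist D \<alpha> w * (r * sqrt (1 - (norm (klein w))\<^sup>2)) = W \<alpha> + B \<alpha> \<bullet> klein w"
    and val: "\<And>\<alpha>. \<alpha> \<in> cusps D \<Longrightarrow> \<exists>k>0. cusp_value D f \<alpha> * a0 = k * snd (B \<alpha>)"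
    using cusp_family by blast
  interpret cusp_functions "cusps D" W B by (rule fam)
  have cell_iff: "w \<in> horo_cell D \<alpha> \<longleftrightarrow> w \<in> H3 \<and> klein w \<in> cell \<alpha>" if \<alpha>: "\<alpha> \<in> cusps D" for \<alpha> w
  proof (cases "w \<in> H3")
    case True
    define s where "s = r * sqrt (1 - (norm (klein w))\<^sup>2)"
    have s: "s > 0" using r_pos one_minus_norm_pos[OF klein_in_ball[OF True]] by (simp add: s_def)
    have "cusp_dist D \<alpha> w \<le> cusp_dist D \<beta> w \<longleftrightarrow> m \<alpha> (klein w) \<le> m \<beta> (klein w)"
      if \<beta>: "\<beta> \<in> cusps D" for \<beta>
      unfolding m_def key[OF \<alpha> True, symmetric] key[OF \<beta> True, symmetric] s_def[symmetric]
      using s by simp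
    then show ?thesis using True klein_in_ball[OF True] by (auto simp: horo_cell_def cell_def dominated_def)
  qed (simp add: horo_cell_def)
  \<comment> \<open>Multiplying both values by \<open>a0\<close> removes its sign from the product,
    as \<open>a0 * a0\<close> is positive.\<close>
  have sign: "cusp_value D f \<alpha> * cusp_value D f \<beta> < 0 \<longleftrightarrow> snd (B \<alpha>) * snd (B \<beta>) < 0"
    if \<alpha>: "\<alpha> \<in> cusps D" and \<beta>: "\<beta> \<in> cusps D" for \<alpha> \<beta>
  proof -
    obtain k k' where k: "k > 0" "cusp_value D f \<alpha> * a0 = k * snd (B \<alpha>)"
      and k': "k' > 0" "cusp_value D f \<beta> * a0 = k' * snd (B \<beta>)" 
      using val[OF \<alpha>] val[OF \<beta>] by blast
    have a2: "0 < a0 * a0" using a0 by (auto simp: zero_less_mult_iff)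
    have "cusp_value D f \<alpha> * cusp_value D f \<beta> < 0 \<longleftrightarrow>
        (a0 * a0) * (cusp_value D f \<alpha> * cusp_value D f \<beta>) < 0"
      using a2 by (auto simp: mult_less_0_iff)
    also have "(a0 * a0) * (cusp_value D f \<alpha> * cusp_value D f \<beta>) =
        (cusp_value D f \<alpha> * a0) * (cusp_value D f \<beta> * a0)" by (simp add: algebra_simps)
    also have "\<dots> = (k * k') * (snd (B \<alpha>) * snd (B \<beta>))" unfolding k(2) k'(2) by (simp add: algebra_simps)
    also have "\<dots> < 0 \<longleftrightarrow> snd (B \<alpha>) * snd (B \<beta>) < 0"
      using k(1) k'(1) by (auto simp: mult_less_0_iff zero_less_mult_iff)
    finally show ?thesis .
  qed
  have graph_ball: "(y, level y) \<in> ball 0 1" if "y \<in> ball 0 1" for y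
    using level_in[of y] that Pos_subset_ball by auto
  have two_dim: "two_dimensional (spine_cell D i j)"
    if i: "i \<in> positive" and j: "j \<in> negative" and e: "e > 0" "ball y1 e \<subseteq> ball 0 1"
      and sub: "(\<lambda>y. (y, level y)) ` ball y1 e \<subseteq> cell i \<inter> cell j" for i j y1 e
  proof -
    have ij: "i \<in> cusps D" "j \<in> cusps D" and sg: "snd (B i) > 0" "snd (B j) < 0"
      using i j by (auto simp: positive_def negative_def)
    have gb: "(y, level y) \<in> ball 0 1" if "y \<in> ball y1 e" for y using graph_ball e(2) that by blast
    have "(\<lambda>y. klein_inv (y, level y)) ` ball y1 e homeomorphic ball (0 :: complex) 1"
      using e gb by (intro graph_homeomorphic_ball continuous_on_subset[OF continuous_level]) auto
    moreover have "(\<lambda>y. klein_inv (y, level y)) ` ball y1 e \<subseteq> spine_cell D i j"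
    proof (rule image_subsetI)
      fix y assume y: "y \<in> ball y1 e"
      then have "(y, level y) \<in> cell i \<inter> cell j" using sub by blast
      then show "klein_inv (y, level y) \<in> spine_cell D i j"
        using gb[OF y] klein_inv_in_H3 klein_klein_inv ij by (simp add: spine_cell_def cell_iff del: mem_ball)
    qed
    \<comment> \<open>In an open subset of the cell the functions of \<open>i\<close> and
      \<open>j\<close> would agree along a vertical segment, forcing equal slopes; but the slopes
      have opposite signs.\<close>
    moreover have "\<not> (\<exists>T\<subseteq>spine_cell D i j. T homeomorphic ball (0 :: complex \<times> real) 1)"
    proof
      assume "\<exists>T\<subseteq>spine_cell D i j. T homeomorphic ball (0 :: complex \<times> real) 1"
      then obtain T where T: "T \<subseteq> spine_cell D i j" "open T" "T \<noteq> {}"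
        using homeomorphic_ball_imp_open by metis
      then obtain w where w: "w \<in> T" by blast
      define U where "U = ball 0 1 \<inter> klein_inv -` T"
      have "open U"
        unfolding U_def by (rule continuous_open_preimage[OF continuous_on_klein_inv open_ball T(2)])
      have TH: "T \<subseteq> H3" using T(1) by (auto simp: spine_cell_def horo_cell_def)
      then have "w \<in> H3" using w by blast
      then have "klein w \<in> U" using w klein_inv_klein[of w] klein_in_ball[of w] by (simp add: U_def)
      with \<open>open U\<close> obtain d where d: "d > 0" "ball (klein w) d \<subseteq> U" by (meson openE)
      obtain y t where yt: "klein w = (y, t)" by fastforce
      have U_eq: "m i x = m j x" if "x \<in> U" for x
      proof -
        have xb: "x \<in> ball 0 1" "klein_inv x \<in> T" using that by (auto simp: U_def)
        then have "klein_inv x \<in> horo_cell D i \<inter> horo_cell D j" using T(1) by (auto simp: spine_cell_def)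
        then have "x \<in> cell i \<inter> cell j" using cell_iff ij klein_klein_inv[OF xb(1)] by auto
        then show ?thesis using ij by (auto simp: cell_def dominated_def intro!: antisym)
      qed
      have "(y, t) \<in> U" "(y, t + d / 2) \<in> U"
        using d yt by (auto simp: subset_iff dist_Pair_Pair dist_real_def)
      then have "m i (y, t) = m j (y, t)" "m i (y, t + d / 2) = m j (y, t + d / 2)" using U_eq by auto
      then have "snd (B i) * (d / 2) = snd (B j) * (d / 2)"
        unfolding m_pair[of _ y t] m_pair[of _ y "t + d / 2"] distrib_left by linarith
      then show False using d(1) sg by simp
    qed
    ultimately show ?thesis unfolding two_dimensional_def by blast
  qed
  have ocean_iff: "w \<in> ocean D f \<longleftrightarrow> w \<in> H3 \<and> klein w \<in> Pos \<inter> Neg" for w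
  proof
    assume "w \<in> ocean D f"
    then obtain \<alpha> \<beta> where \<alpha>\<beta>: "\<alpha> \<in> cusps D" "\<beta> \<in> cusps D" "w \<in> horo_cell D \<alpha>" "w \<in> horo_cell D \<beta>"
      and "cusp_value D f \<alpha> * cusp_value D f \<beta> < 0" by (auto simp: ocean_def spine_cell_def)
    then have "snd (B \<alpha>) * snd (B \<beta>) < 0" using sign by simp
    then show "w \<in> H3 \<and> klein w \<in> Pos \<inter> Neg"
      using \<alpha>\<beta> cell_iff by (auto simp: Pos_def Neg_def positive_def negative_def mult_less_0_iff)
  next
    assume w: "w \<in> H3 \<and> klein w \<in> Pos \<inter> Neg"
    then obtain y where y: "y \<in> ball 0 1" "klein w = (y, level y)" using Pos_Int_Neg_eq_graph by auto
    then have "norm y < 1" by simp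
    \<comment> \<open>Besides two cells containing the point, this yields a disc of the graph inside
      the same two cells, as \<open>two_dim\<close> requires.\<close>
    then obtain i j y1 e where ij: "i \<in> positive" "j \<in> negative" "(y, level y) \<in> cell i \<inter> cell j"
      "e > 0" "ball y1 e \<subseteq> ball 0 1" "(\<lambda>y. (y, level y)) ` ball y1 e \<subseteq> cell i \<inter> cell j"
      by (rule thick_pair)
    have c: "i \<in> cusps D" "j \<in> cusps D" "snd (B i) > 0" "snd (B j) < 0"
      using ij(1,2) by (auto simp: positive_def negative_def)
    then have "i \<noteq> j" by auto
    moreover have "cusp_value D f i * cusp_value D f j < 0" using sign c by (simp add: mult_pos_neg)
    moreover have "two_dimensional (spine_cell D i j)" using ij by (intro two_dim)
    moreover have "w \<in> spine_cell D i j"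
      using w ij(3) c y(2) by (simp add: spine_cell_def cell_iff)
    ultimately show "w \<in> ocean D f" unfolding ocean_def using c by blast
  qed
  have near: "nearest_point hemi w = klein_inv (fst (klein w), 0)" if "w \<in> ocean D f" for w
    using that ocean_iff by (intro nearest_point_hemi) auto
  have flat: "(y, 0 :: real) \<in> ball 0 1" if "y \<in> ball (0 :: complex) 1" for y
    using that by (simp add: norm_Pair)
  have ocean_graph: "fst (klein w) \<in> ball 0 1 \<and> klein w = (fst (klein w), level (fst (klein w)))"
    if "w \<in> ocean D f" for w
    using that Pos_Int_Neg_eq_graph ocean_iff by auto
  have lift: "klein_inv (y, level y) \<in> ocean D f \<and> klein (klein_inv (y, level y)) = (y, level y)"
    if y: "y \<in> ball 0 1" for y
    using level_in[of y] y klein_klein_inv[OF graph_ball[OF y]] klein_inv_in_H3[OF graph_ball[OF y]]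
    by (simp add: ocean_iff)
  define G where "G = (\<lambda>q. klein_inv (fst (klein q), level (fst (klein q))))"
  have "homeomorphism (ocean D f) hemi (nearest_point hemi) G"
  proof (rule homeomorphismI)
    have "continuous_on (ocean D f) (\<lambda>w. klein_inv (fst (klein w), 0))"
      using ocean_graph flat
      by (intro continuous_on_compose2[OF continuous_on_klein_inv] continuous_intros continuous_on_klein) blast
    then show "continuous_on (ocean D f) (nearest_point hemi)" using near by simp
    have "continuous_on hemi (\<lambda>q. level (fst (klein q)))"
      using klein_hemi
      by (intro continuous_on_compose2[OF continuous_level] continuous_intros continuous_on_klein) blast
    moreover have "(\<lambda>q. (fst (klein q), level (fst (klein q)))) ` hemi \<subseteq> ball 0 1"
      using klein_hemi graph_ball by (intro image_subsetI) metis
    ultimately show "continuous_on hemi G"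
      unfolding G_def
      by (intro continuous_on_compose2[OF continuous_on_klein_inv] continuous_intros continuous_on_klein)
    show "nearest_point hemi ` ocean D f \<subseteq> hemi"
      using near ocean_graph klein_inv_flat_in_hemi by (auto simp del: mem_ball)
    show "G ` hemi \<subseteq> ocean D f" using lift klein_hemi by (auto simp: G_def simp del: mem_ball)
    show "G (nearest_point hemi w) = w" if w: "w \<in> ocean D f" for w
    proof -
      have "klein (nearest_point hemi w) = (fst (klein w), 0)"
        unfolding near[OF w] using ocean_graph[OF w] flat by (intro klein_klein_inv) blast
      then have "G (nearest_point hemi w) = klein_inv (klein w)"
        using ocean_graph[OF w] by (simp add: G_def)
      then show ?thesis using klein_inv_klein ocean_iff w by auto
    qed
    show "nearest_point hemi (G q) = q" if q: "q \<in> hemi" for q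
    proof -
      have y: "fst (klein q) \<in> ball 0 1" "klein q = (fst (klein q), 0)" using klein_hemi[OF q] by auto
      have "nearest_point hemi (G q) = klein_inv (fst (klein q), 0)"
        using near lift[OF y(1)] by (simp add: G_def)
      also have "\<dots> = klein_inv (klein q)" using y(2) by simp
      also have "\<dots> = q" using q by (intro klein_inv_klein) (simp add: hemi_def)
      finally show ?thesis .
    qed
  qed
  then show ?thesis by blast
qed

lemma form_circle_eq: "form_circle f = {Fin z | z. cmod (z - c) = r}"
proof -
  have f_eq: "f z w = a0 * (cmod w)\<^sup>2 * ((cmod (z / w - c))\<^sup>2 - r\<^sup>2)" if "w \<noteq> 0" for z w
  proof -
    have "z - c * w = w * (z / w - c)" using that by (simp add: algebra_simps)
    then have "(cmod (z - c * w))\<^sup>2 = (cmod w)\<^sup>2 * (cmod (z / w - c))\<^sup>2"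
      by (simp add: norm_mult power_mult_distrib)
    then show ?thesis by (simp add: normal_form algebra_simps)
  qed
  have zero_iff: "f z w = 0 \<longleftrightarrow> cmod (z / w - c) = r" if "w \<noteq> 0" for z w
    unfolding f_eq[OF that] using a0 that r_pos by (auto simp: power2_eq_iff_nonneg)
  have w0: "w \<noteq> 0" if "f z w = 0" "(z, w) \<noteq> (0, 0)" for z w
    using that a0 by (auto simp: normal_form)
  show ?thesis
  proof (intro equalityI subsetI)
    fix \<xi> assume "\<xi> \<in> form_circle f"
    then obtain z w where "\<xi> = proj_pt z w" "(z, w) \<noteq> (0, 0)" "f z w = 0" by (auto simp: form_circle_def)
    then show "\<xi> \<in> {Fin z | z. cmod (z - c) = r}" using w0[of z w] zero_iff[of w z] by (auto simp: proj_pt_def)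
  next
    fix \<xi> assume "\<xi> \<in> {Fin z | z. cmod (z - c) = r}"
    then obtain z where z: "\<xi> = Fin z" "cmod (z - c) = r" by blast
    then have "\<xi> = proj_pt z 1" "f z 1 = 0" using zero_iff[of 1 z] by (auto simp: proj_pt_def)
    then show "\<xi> \<in> form_circle f" unfolding form_circle_def by force
  qed
qed

end

theorem theorem6p1:
  fixes D :: int and f :: "complex \<Rightarrow> complex \<Rightarrow> real"
  assumes "D < 0" and "fundamental_discriminant D"
    and "binary_hermitian_form D f"
    and "integral_form D f"
    and "indefinite_form D f"
    and "anisotropic_form D f"
  shows "\<exists>g. homeomorphism (ocean D f) (form_plane f) (nearest_point (form_plane f)) g"
proof -
  obtain p q \<nu> where f: "f = herm_form p q \<nu>" using assms(3) by (auto simp: binary_hermitian_form_def)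
  interpret imaginary_quadratic D
    using assms(1,2) by unfold_locales (auto simp: fundamental_discriminant_def)
  define a0 where "a0 = (of_rat p :: real)"
  have "1 \<in> quad_field D" "0 \<in> quad_field D" using A_subset_field[of 1 1] A_subset_field[of 0 1] by auto
  \<comment> \<open>The leading coefficient is \<open>f 1 0\<close>; that it is non-zero keeps
    \<open>Infty\<close> off the circle.\<close>
  then have "f 1 0 \<noteq> 0" using assms(6) by (auto simp: anisotropic_form_def)
  then have a0: "a0 \<noteq> 0" by (simp add: f herm_form_def Nm_def a0_def)
  \<comment> \<open>Completing the square in \<open>x\<close>: the mixed term of
    \<open>a0 |x - c y|^2\<close> has to be that of \<open>f\<close>. Then \<rho> is minus the
    determinant of \<open>f\<close> divided by the square of \<open>a0\<close>.\<close>
  define c where "c = - cnj \<nu> / of_real a0"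
  define \<rho> where "\<rho> = (cmod c)\<^sup>2 - of_rat q / a0"
  have form: "herm_form p q \<nu> x y = a0 * ((cmod (x - c * y))\<^sup>2 - \<rho> * (cmod y)\<^sup>2)" for x y
  proof -
    have "a0 * (x \<bullet> (c * y)) = - Re (\<nu> * x * cnj y)"
    proof -
      have "x \<bullet> (c * y) = Re (x * cnj (c * y))" by (simp add: inner_complex_def algebra_simps)
      also have "x * cnj (c * y) = - (\<nu> * x * cnj y) / of_real a0" by (simp add: c_def)
      finally show ?thesis using a0 by (simp add: Re_divide_of_real)
    qed
    moreover have "Re (\<nu> * x * cnj y + cnj \<nu> * cnj x * y) = 2 * Re (\<nu> * x * cnj y)"
      by (simp add: algebra_simps)
    moreover have "a0 * (cmod (x - c * y))\<^sup>2 =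
        a0 * (cmod x)\<^sup>2 - 2 * (a0 * (x \<bullet> (c * y))) + a0 * (cmod c)\<^sup>2 * (cmod y)\<^sup>2"
      unfolding cmod_diff_sq by (simp add: norm_mult power_mult_distrib algebra_simps)
    moreover have "a0 * \<rho> = a0 * (cmod c)\<^sup>2 - of_rat q" using a0 by (simp add: \<rho>_def algebra_simps)
    ultimately show ?thesis
      by (simp add: herm_form_def Nm_def a0_def[symmetric] right_diff_distrib left_diff_distrib flip: mult.assoc)
  qed
  \<comment> \<open>Otherwise no value of \<open>f\<close> would have the sign opposite to
    \<open>a0\<close>, against indefiniteness.\<close>
  have "\<rho> > 0"
  proof (rule ccontr)
    assume "\<not> \<rho> > 0"
    then have nonneg: "0 \<le> (cmod (x - c * y))\<^sup>2 - \<rho> * (cmod y)\<^sup>2" for x y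
      using mult_nonpos_nonneg[of \<rho> "(cmod y)\<^sup>2"] zero_le_power2[of "cmod (x - c * y)"]
        zero_le_power2[of "cmod y"] by linarith
    obtain x y x' y' where "f x y > 0" "f x' y' < 0" using assms(5) by (auto simp: indefinite_form_def)
    then show False
      using nonneg[of x y] nonneg[of x' y'] by (auto simp: f form zero_less_mult_iff mult_less_0_iff)
  qed
  define r where "r = sqrt \<rho>"
  have r: "r > 0" "r\<^sup>2 = \<rho>" using \<open>\<rho> > 0\<close> by (auto simp: r_def)
  interpret ocean_plane D c r a0 p q \<nu>
    using r a0 form assms(4,6) f by unfold_locales auto
  have "form_plane (herm_form p q \<nu>) = hemi" by (rule form_plane_eq[OF form_circle_eq])
  then show ?thesis using nearest_point_homeomorphism unfolding f by simp
qed

end
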